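(* Let $X$ be a standard Brownian motion on $\mathbb X=\mathbb R$ ($dX_t=dW_t$), let $\beta>0$ and $\delta(t)=\frac1{1+\beta t}$. Let $a<b$ and $0<c<d$ satisfy $$\frac{\int_0^\infty e^{-s}\frac{\sqrt{2\beta s}}{\sinh((b-a)\sqrt{2\beta s})}\,ds}{\sqrt{\frac{\pi\beta}{2}}+\int_0^\infty e^{-s}\sqrt{2\beta s}\,\coth((b-a)\sqrt{2\beta s})\,ds}<\frac cd<\int_0^\infty e^{-(s+(b-a)\sqrt{2\beta s})}\,ds.$$ Define, for $x\in\mathbb R$, $$J_b(x)=d\,\mathbb E^x[\delta(\rho_{\{b\}})],\qquad J_{ab}(x)=c\,\mathbb E^x\big[\delta(\rho_{\{a,b\}})1_{\{X_{\rho_{\{a,b\}}}=a\}}\big]+d\,\mathbb E^x\big[\delta(\rho_{\{a,b\}})1_{\{X_{\rho_{\{a,b\}}}=b\}}\big].$$ Let $f:\mathbb R\to[0,\infty)$ be any continuous function satisfying the growth condition and the piecewise-$C^2$ condition (defined in the context) such that $f(a)=c$, $f(b)=d$ and $f(x)<\min\{J_b(x),J_{ab}(x)\}$ for all $x\in\mathbb R\setminus\{a,b\}$. Then $\{b\}$ is the unique optimal mild equilibrium, while both $\{b\}$ and $\{a,b\}$ are strong equilibria.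
   Context: $\mathbb P^x,\mathbb E^x$ refer to $X_0=x$. For Borel $A\subset\mathbb X$, $\rho_A=\inf\{t>0:X_t\in A\}$, and $J(x,A)=\mathbb E^x[\delta(\rho_A)f(X_{\rho_A})]$, the random variable being $0$ on $\{\rho_A=\infty\}$. Growth condition: for every $x\in\mathbb X$, $\lim_{t\to\infty}\delta(t)f(X_t)=0$ $\mathbb P^x$-a.s., and there is $\zeta>0$ with $\mathbb E^x[\sup_{t\ge0}(\delta(t)f(X_t))^{1+\zeta}]<\infty$ for all $x\in\mathbb X$. Piecewise-$C^2$ condition: there is a finite or countable set $(\theta_n)_{n\in I}\subset\mathbb X$, $I\subset\mathbb Z$, $\theta_n<\theta_{n+1}$, with $f$ twice continuously differentiable up to the endpoints on each $[\theta_n,\theta_{n+1}]$ (with the obvious reading for outermost pieces of $\mathbb X$) and $\inf_{n\in I}(\theta_{n+1}-\theta_n)>0$. Mild equilibrium: a closed set $S\subset\mathbb X$ with $f(x)\le J(x,S)$ for all $x\notin S$ and $f(x)\ge J(x,S)$ for all $x\in S$. A mild equilibrium $S$ is optimal if $J(x,S)\ge J(x,R)$ for every mild equilibrium $R$ and every $x\in\mathbb X$. Strong equilibrium: a closed set $S\subset\mathbb X$ with $f(x)\le J(x,S)$ for all $x\notin S$ and such that for each $x\in S$ there is $\varepsilon(x)>0$ with $f(x)-\mathbb E^x[\delta(\rho_S^{\varepsilon'})f(X_{\rho_S^{\varepsilon'}})]\ge0$ for all $0<\varepsilon'\le\varepsilon(x)$, where $\rho^{\varepsilon}_S=\inf\{t\ge\varepsilon:X_t\in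 S\}$. *)

theory Defs
  imports "HOL-Probability.Probability"
begin

text \<open>
  Only times \<open>t \<ge> 0\<close> of a process \<open>X :: real \<Rightarrow> 'w \<Rightarrow> real\<close> are relevant.
  All paths (not just almost all) are continuous, so that hitting times of closed sets are
  measurable without completing \<open>M\<close>.
\<close>

definition brownian_motion_from :: "'w measure \<Rightarrow> (real \<Rightarrow> 'w \<Rightarrow> real) \<Rightarrow> real \<Rightarrow> bool" where
  "brownian_motion_from M X x \<longleftrightarrow>
     prob_space M \<and>
     (\<forall>t\<ge>0. X t \<in> borel_measurable M) \<and>
     (AE \<omega> in M. X 0 \<omega> = x) \<and>
     (\<forall>\<omega>\<in>space M. continuous_on {0..} (\<lambda>t. X t \<omega>)) \<and>
     (\<forall>s t. 0 \<le> s \<and> s < t \<longrightarrow>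
        distributed M lborel (\<lambda>\<omega>. X t \<omega> - X s \<omega>)
          (\<lambda>z. ennreal (normal_density 0 (sqrt (t - s)) z))) \<and>
     (\<forall>n (\<tau> :: nat \<Rightarrow> real). 0 \<le> \<tau> 0 \<and> (\<forall>i<n. \<tau> i < \<tau> (Suc i)) \<longrightarrow>
        prob_space.indep_vars M (\<lambda>_. borel) (\<lambda>i \<omega>. X (\<tau> (Suc i)) \<omega> - X (\<tau> i) \<omega>) {..<n})"

text \<open>The measure \<open>P x\<close> plays the role of \<open>\<bbbP>\<^sup>x\<close>, the law under which the common process starts in \<open>x\<close>.\<close>

definition brownian_family :: "(real \<Rightarrow> 'w measure) \<Rightarrow> (real \<Rightarrow> 'w \<Rightarrow> real) \<Rightarrow> bool" where
  "brownian_family P X \<longleftrightarrow> (\<forall>x. brownian_motion_from (P x) X x)"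

definition hyperbolic_discount :: "real \<Rightarrow> real \<Rightarrow> real" where
  "hyperbolic_discount \<beta> t = 1 / (1 + \<beta> * t)"

definition hitting_time :: "(real \<Rightarrow> 'w \<Rightarrow> real) \<Rightarrow> real set \<Rightarrow> 'w \<Rightarrow> ereal" where
  "hitting_time X A \<omega> = Inf (ereal ` {t. 0 < t \<and> X t \<omega> \<in> A})"

definition hitting_time_after ::
    "(real \<Rightarrow> 'w \<Rightarrow> real) \<Rightarrow> real \<Rightarrow> real set \<Rightarrow> 'w \<Rightarrow> ereal" where
  "hitting_time_after X \<epsilon> A \<omega> = Inf (ereal ` {t. \<epsilon> \<le> t \<and> X t \<omega> \<in> A})"

definition discounted_reward ::
    "(real \<Rightarrow> 'w \<Rightarrow> real) \<Rightarrow> (real \<Rightarrow> real) \<Rightarrow> (real \<Rightarrow> real) \<Rightarrow> ('w \<Rightarrow> ereal) \<Rightarrow> 'w \<Rightarrow> real" where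
  "discounted_reward X \<delta> g \<tau> \<omega> =
     (if \<tau> \<omega> = \<infinity> then 0
      else \<delta> (real_of_ereal (\<tau> \<omega>)) * g (X (real_of_ereal (\<tau> \<omega>)) \<omega>))"

definition J_value ::
    "(real \<Rightarrow> 'w measure) \<Rightarrow> (real \<Rightarrow> 'w \<Rightarrow> real) \<Rightarrow> (real \<Rightarrow> real) \<Rightarrow> (real \<Rightarrow> real)
       \<Rightarrow> real \<Rightarrow> real set \<Rightarrow> real" where
  "J_value P X \<delta> f x A = (\<integral>\<omega>. discounted_reward X \<delta> f (hitting_time X A) \<omega> \<partial>(P x))"

definition growth_condition ::
    "(real \<Rightarrow> 'w measure) \<Rightarrow> (real \<Rightarrow> 'w \<Rightarrow> real) \<Rightarrow> (real \<Rightarrow> real) \<Rightarrow> (real \<Rightarrow> real) \<Rightarrow> bool" where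
  "growth_condition P X \<delta> f \<longleftrightarrow>
     (\<forall>x. AE \<omega> in P x. ((\<lambda>t. \<delta> t * f (X t \<omega>)) \<longlongrightarrow> 0) at_top) \<and>
     (\<exists>\<zeta>>0. \<forall>x. (\<integral>\<^sup>+\<omega>. (SUP t\<in>{0..}. ennreal ((\<delta> t * f (X t \<omega>)) powr (1 + \<zeta>))) \<partial>(P x)) < \<infinity>)"

text \<open>Derivatives are taken within \<open>T\<close>, hence one-sided at the endpoints of an interval \<open>T\<close>.\<close>

definition C2_on :: "real set \<Rightarrow> (real \<Rightarrow> real) \<Rightarrow> bool" where
  "C2_on T f \<longleftrightarrow>
     (\<exists>f' f''. (\<forall>x\<in>T. (f has_real_derivative f' x) (at x within T)) \<and>
               (\<forall>x\<in>T. (f' has_real_derivative f'' x) (at x within T)) \<and>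
               continuous_on T f'')"

text \<open>
  The index set consists of consecutive integers, so \<open>\<theta> n\<close> and \<open>\<theta> (n + 1)\<close> are neighbours.
  The unbounded outermost pieces occur when \<open>I\<close> has a least or greatest element; if \<open>I\<close> is empty,
  the only piece is the whole line.  The infimum is taken in \<open>ereal\<close> so that it is
  \<open>\<infinity>\<close> when there are fewer than two points.
\<close>

definition piecewise_C2 :: "(real \<Rightarrow> real) \<Rightarrow> bool" where
  "piecewise_C2 f \<longleftrightarrow>
     (\<exists>(I :: int set) (\<theta> :: int \<Rightarrow> real).
        (\<forall>i\<in>I. \<forall>j\<in>I. {i..j} \<subseteq> I) \<and>
        (\<forall>n. n \<in> I \<and> n + 1 \<in> I \<longrightarrow> \<theta> n < \<theta> (n + 1)) \<and>
        (INF n\<in>{n. n \<in> I \<and> n + 1 \<in> I}. ereal (\<theta> (n + 1) - \<theta> n)) > 0 \<and>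
        (\<forall>n. n \<in> I \<and> n + 1 \<in> I \<longrightarrow> C2_on {\<theta> n..\<theta> (n + 1)} f) \<and>
        (\<forall>n. n \<in> I \<and> n - 1 \<notin> I \<longrightarrow> C2_on {..\<theta> n} f) \<and>
        (\<forall>n. n \<in> I \<and> n + 1 \<notin> I \<longrightarrow> C2_on {\<theta> n..} f) \<and>
        (I = {} \<longrightarrow> C2_on UNIV f))"

definition mild_equilibrium ::
    "(real \<Rightarrow> 'w measure) \<Rightarrow> (real \<Rightarrow> 'w \<Rightarrow> real) \<Rightarrow> (real \<Rightarrow> real) \<Rightarrow> (real \<Rightarrow> real)
       \<Rightarrow> real set \<Rightarrow> bool" where
  "mild_equilibrium P X \<delta> f S \<longleftrightarrow>
     closed S \<and>
     (\<forall>x. x \<notin> S \<longrightarrow> f x \<le> J_value P X \<delta> f x S) \<and>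
     (\<forall>x\<in>S. f x \<ge> J_value P X \<delta> f x S)"

definition optimal_mild_equilibrium ::
    "(real \<Rightarrow> 'w measure) \<Rightarrow> (real \<Rightarrow> 'w \<Rightarrow> real) \<Rightarrow> (real \<Rightarrow> real) \<Rightarrow> (real \<Rightarrow> real)
       \<Rightarrow> real set \<Rightarrow> bool" where
  "optimal_mild_equilibrium P X \<delta> f S \<longleftrightarrow>
     mild_equilibrium P X \<delta> f S \<and>
     (\<forall>R. mild_equilibrium P X \<delta> f R \<longrightarrow> (\<forall>x. J_value P X \<delta> f x S \<ge> J_value P X \<delta> f x R))"

definition strong_equilibrium ::
    "(real \<Rightarrow> 'w measure) \<Rightarrow> (real \<Rightarrow> 'w \<Rightarrow> real) \<Rightarrow> (real \<Rightarrow> real) \<Rightarrow> (real \<Rightarrow> real)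
       \<Rightarrow> real set \<Rightarrow> bool" where
  "strong_equilibrium P X \<delta> f S \<longleftrightarrow>
     closed S \<and>
     (\<forall>x. x \<notin> S \<longrightarrow> f x \<le> J_value P X \<delta> f x S) \<and>
     (\<forall>x\<in>S. \<exists>\<epsilon>>0. \<forall>\<epsilon>'. 0 < \<epsilon>' \<and> \<epsilon>' \<le> \<epsilon> \<longrightarrow>
        f x - (\<integral>\<omega>. discounted_reward X \<delta> f (hitting_time_after X \<epsilon>' S) \<omega> \<partial>(P x)) \<ge> 0)"

end

theory Submission
  imports Defs
begin

text \<open>
  If \<open>s\<close> is drawn from the exponential law with mean one, then \<open>1 / (1 + \<beta> t)\<close> is the mean of
  \<open>exp (- \<beta> s t)\<close>. Every hyperbolically discounted expectation is therefore an average over \<open>s\<close> of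
  exponentially discounted ones, and those are explicit. With \<open>k = sqrt (2 \<beta> s)\<close> the processes
  \<open>exp (k X\<^sub>t - k\<^sup>2 t / 2)\<close> and \<open>exp (- k X\<^sub>t - k\<^sup>2 t / 2)\<close> are martingales, so a combination \<open>v\<close> of
  \<open>exp (k y)\<close> and \<open>exp (- k y)\<close> that is bounded on the closure of an open set satisfies: stopping
  when the path leaves the set does not change the mean of \<open>exp (- \<beta> s t) v (X\<^sub>t)\<close> (\<open>exit_identity\<close>).

  Optimality of \<open>{b}\<close>. Let \<open>F\<close> be \<open>d\<close> times the mean over \<open>s\<close> of \<open>exp (- k \<bar>y - b\<bar>)\<close>; this is the value
  of waiting for \<open>b\<close>. The hypotheses give \<open>f < F\<close> off \<open>b\<close>, the point \<open>a\<close> being covered by the upper bound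
  on \<open>c / d\<close>, and \<open>f = F = d\<close> at \<open>b\<close>. A mild equilibrium \<open>R\<close> contains \<open>b\<close>, because
  \<open>d\<close> is the largest reward and a positive delay strictly discounts it. Start at \<open>x\<close> outside \<open>R\<close> and
  let \<open>\<rho>\<close> be the hitting time of \<open>R\<close>. For fixed \<open>s\<close> the mean of \<open>exp (- \<beta> s \<rho>) exp (- k \<bar>X\<^sub>\<rho> - b\<bar>)\<close> is
  \<open>exp (- k \<bar>x - b\<bar>)\<close>. Both factors decrease in \<open>s\<close>, so they are positively correlated under
  the mixing law, and averaging over \<open>s\<close> gives that the mean of \<open>\<delta> \<rho> F (X\<^sub>\<rho>)\<close> is at most \<open>F x\<close>
  (\<open>discounted_point_value_le\<close>). Since \<open>f \<le> F\<close>, no mild equilibrium beats \<open>{b}\<close>. A point \<open>x \<noteq> b\<close> of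
  an optimal mild equilibrium would be worth at most \<open>f x < F x\<close> there, hence uniqueness.

  Strong equilibria. At \<open>b\<close> the largest reward is available at once, so waiting cannot help. At \<open>a\<close>
  compare \<open>c\<close> with the value of waiting for a time \<open>\<epsilon>\<close> and then until \<open>{a, b}\<close> is hit. Its
  component with parameter \<open>s\<close> is at most the mean of \<open>u (X\<^sub>\<epsilon>)\<close>, where \<open>u\<close> is the value of waiting for
  \<open>{a, b}\<close>. The function \<open>u\<close> has a kink at \<open>a\<close>, so this mean is \<open>c\<close> plus half the jump of \<open>u'\<close> times
  the mean of \<open>\<bar>X\<^sub>\<epsilon> - a\<bar>\<close>, of order \<open>sqrt \<epsilon>\<close>, plus terms of order \<open>\<epsilon>\<close> (\<open>delayed_two_point_reward\<close>).
  The lower bound on \<open>c / d\<close> says exactly that the jump, averaged over \<open>s\<close>, is negative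
  (\<open>threshold_integrals\<close>), so for small \<open>\<epsilon>\<close> waiting loses.
\<close>

section \<open>Hyperbolic discounting as a mixture of exponential discounting\<close>

definition exp_law :: "real measure" where
  "exp_law = density lborel (exponential_density 1)"

lemma sets_exp_law [measurable_cong, simp]: "sets exp_law = sets borel"
  by (simp add: exp_law_def)

lemma space_exp_law [simp]: "space exp_law = UNIV"
  by (simp add: exp_law_def)

interpretation exp_law: prob_space exp_law
  unfolding exp_law_def by (rule prob_space_exponential_density) simp

lemma AE_exp_law_pos: "AE s in exp_law. 0 < s"
proof -
  have "AE s in lborel. s \<noteq> (0::real)"
    by (rule AE_lborel_singleton)
  then show ?thesis
    unfolding exp_law_def
    by (subst AE_density) (auto simp: exponential_density_def elim!: eventually_mono)
qed

lemma integral_exp_law: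
  fixes H :: "real \<Rightarrow> real"
  assumes [measurable]: "H \<in> borel_measurable borel"
  shows "(\<integral>s. H s \<partial>exp_law) = (\<integral>s. exponential_density 1 s * H s \<partial>lborel)"
  unfolding exp_law_def by (subst integral_density) (auto simp: exponential_density_nonneg)

lemma interval_integral_exp_law:
  fixes H G :: "real \<Rightarrow> real"
  assumes [measurable]: "H \<in> borel_measurable borel"
    and G: "\<And>s. 0 < s \<Longrightarrow> G s = exp (- s) * H s"
  shows "(LBINT s=0..\<infinity>. G s) = (\<integral>s. H s \<partial>exp_law)"
proof -
  have "(LBINT s=0..\<infinity>. G s) = (\<integral>s. indicator {0<..} s * (exp (- s) * H s) \<partial>lborel)"
    unfolding interval_lebesgue_integral_0_infty set_lebesgue_integral_def
    by (intro Bochner_Integration.integral_cong) (auto simp: G indicator_def)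
  also have "\<dots> = (\<integral>s. exponential_density 1 s * H s \<partial>lborel)"
    by (rule integral_cong_AE)
       (use AE_lborel_singleton[of 0] in \<open>auto simp: exponential_density_def indicator_def elim!: eventually_mono\<close>)
  finally show ?thesis
    by (simp add: integral_exp_law)
qed

text \<open>The weight \<open>exp (- q s)\<close> turns the exponential density of rate \<open>1\<close> into that of rate
  \<open>1 + q\<close>, up to the factor \<open>1 / (1 + q)\<close>, and \<open>s / (1 + q)\<close> has the latter law.\<close>

lemma exp_law_tilt:
  fixes H :: "real \<Rightarrow> real"
  assumes [measurable]: "H \<in> borel_measurable borel" and q: "0 \<le> q"
  shows "(\<integral>s. exp (- (q * s)) * H s \<partial>exp_law) = (\<integral>s. H (s / (1 + q)) \<partial>exp_law) / (1 + q)"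
proof -
  have "(\<integral>s. exp (- (q * s)) * H s \<partial>exp_law)
      = (\<integral>s. exponential_density 1 s * (exp (- (q * s)) * H s) \<partial>lborel)"
    by (rule integral_exp_law) measurable
  also have "\<dots> = \<bar>1 / (1 + q)\<bar> *\<^sub>R (\<integral>s. exponential_density 1 (0 + 1 / (1 + q) * s)
        * (exp (- (q * (0 + 1 / (1 + q) * s))) * H (0 + 1 / (1 + q) * s)) \<partial>lborel)"
    using q by (intro lborel_integral_real_affine) auto
  also have "(\<lambda>s. exponential_density 1 (0 + 1 / (1 + q) * s)
        * (exp (- (q * (0 + 1 / (1 + q) * s))) * H (0 + 1 / (1 + q) * s)))
      = (\<lambda>s. exponential_density 1 s * H (s / (1 + q)))"
  proof
    fix s
    have "- (s / (1 + q)) + - (q * (s / (1 + q))) = - s"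
    proof -
      have "- (s / (1 + q)) + - (q * (s / (1 + q))) = - ((1 + q) * (s / (1 + q)))"
        by (simp only: distrib_right mult_1 minus_add_distrib)
      then show ?thesis using q by simp
    qed
    then have "exp (- (s / (1 + q))) * exp (- (q * (s / (1 + q)))) = exp (- s)"
      by (simp add: exp_add[symmetric])
    moreover have "s / (1 + q) < 0 \<longleftrightarrow> s < 0"
      using q by (simp add: divide_less_0_iff)
    ultimately show "exponential_density 1 (0 + 1 / (1 + q) * s)
        * (exp (- (q * (0 + 1 / (1 + q) * s))) * H (0 + 1 / (1 + q) * s))
      = exponential_density 1 s * H (s / (1 + q))"
      by (simp add: exponential_density_def)
  qed
  also have "(\<integral>s. exponential_density 1 s * H (s / (1 + q)) \<partial>lborel) = (\<integral>s. H (s / (1 + q)) \<partial>exp_law)"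
    by (rule integral_exp_law[symmetric]) measurable
  finally show ?thesis using q by simp
qed

lemma exp_law_laplace:
  assumes "0 \<le> q"
  shows "(\<integral>s. exp (- (q * s)) \<partial>exp_law) = 1 / (1 + q)"
  using exp_law_tilt[of "\<lambda>_. 1" q] assms exp_law.prob_space by simp

text \<open>Tilting by \<open>exp (- q s)\<close> moves mass towards small \<open>s\<close>, where a decreasing \<open>H\<close> is larger. The
  two sides compare the mean of the product of two decreasing functions of \<open>s\<close> with the product of
  their means; with \<open>H = exp (- r s)\<close> this is \<open>(1 + q + r) \<le> (1 + q) (1 + r)\<close>, the reason why a
  hyperbolic discounter who discounts in two stages loses.\<close>

lemma exp_law_association:
  fixes H :: "real \<Rightarrow> real"
  assumes [measurable]: "H \<in> borel_measurable borel" and q: "0 \<le> q"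
    and bounds: "\<And>s. 0 \<le> s \<Longrightarrow> 0 \<le> H s \<and> H s \<le> 1"
    and anti: "\<And>s t. 0 \<le> s \<Longrightarrow> s \<le> t \<Longrightarrow> H t \<le> H s"
  shows "(\<integral>s. H s \<partial>exp_law) / (1 + q) \<le> (\<integral>s. exp (- (q * s)) * H s \<partial>exp_law)"
proof -
  have ae: "AE s in exp_law. 0 \<le> s"
    using AE_exp_law_pos by eventually_elim simp
  have "(\<integral>s. H s \<partial>exp_law) \<le> (\<integral>s. H (s / (1 + q)) \<partial>exp_law)"
  proof (rule integral_mono_AE)
    have "AE s in exp_law. norm (H s) \<le> 1"
      using ae
    proof eventually_elim
      case (elim s)
      from bounds[OF this] show ?case by simp
    qed
    then show "integrable exp_law H"
      by (rule exp_law.integrable_const_bound) simp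
    have "AE s in exp_law. norm (H (s / (1 + q))) \<le> 1"
      using ae
    proof eventually_elim
      case (elim s)
      with q have "0 \<le> s / (1 + q)" by simp
      from bounds[OF this] show ?case by simp
    qed
    then show "integrable exp_law (\<lambda>s. H (s / (1 + q)))"
      by (rule exp_law.integrable_const_bound) measurable
    show "AE s in exp_law. H s \<le> H (s / (1 + q))"
      using ae
    proof eventually_elim
      case (elim s)
      then have "s / (1 + q) \<le> s" using q by (simp add: divide_le_eq distrib_left)
      with elim q show ?case by (intro anti) auto
    qed
  qed
  with q show ?thesis
    by (simp add: exp_law_tilt divide_right_mono)
qed

lemma exp_law_powr_moment:
  fixes x :: real
  assumes x: "0 < x"
  shows "has_bochner_integral exp_law (\<lambda>s. s powr (x - 1)) (Gamma x)"
proof (rule has_bochner_integral_nn_integral)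
  have "((\<lambda>t. t powr (x - 1) / exp t) has_integral Gamma x) {0..}"
    using x by (rule Gamma_integral_real)
  then have "(\<integral>\<^sup>+t. ennreal (t powr (x - 1) / exp t) * indicator {0..} t \<partial>lborel) = ennreal (Gamma x)"
    by (intro nn_integral_has_integral_lebesgue') auto
  also have "(\<integral>\<^sup>+t. ennreal (t powr (x - 1) / exp t) * indicator {0..} t \<partial>lborel)
      = (\<integral>\<^sup>+t. ennreal (exponential_density 1 t) * ennreal (t powr (x - 1)) \<partial>lborel)"
    by (intro nn_integral_cong)
       (auto simp: exponential_density_def indicator_def ennreal_mult'[symmetric] exp_minus field_simps)
  also have "\<dots> = (\<integral>\<^sup>+t. ennreal (t powr (x - 1)) \<partial>exp_law)"
    unfolding exp_law_def by (subst nn_integral_density) auto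
  finally show "(\<integral>\<^sup>+t. ennreal (t powr (x - 1)) \<partial>exp_law) = ennreal (Gamma x)" .
qed (use x in \<open>auto intro: less_imp_le Gamma_real_pos\<close>)

text \<open>The moment of order one half is \<open>Gamma (3 / 2)\<close>; it accounts for the constant
  \<open>sqrt (pi * \<beta> / 2)\<close> in the lower bound on \<open>c / d\<close>.\<close>

lemma exp_law_moments:
  shows "integrable exp_law (\<lambda>s. s)" and "integrable exp_law sqrt"
    and "(\<integral>s. sqrt s \<partial>exp_law) = sqrt pi / 2"
proof -
  have "has_bochner_integral exp_law (\<lambda>s. s) (Gamma 2)"
    using exp_law_powr_moment[of 2]
    by (subst has_bochner_integral_cong_AE[where g = "\<lambda>s. s powr (2 - 1)"])
       (use AE_exp_law_pos in \<open>auto elim!: eventually_mono\<close>)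
  then show "integrable exp_law (\<lambda>s. s)" by (rule integrable.intros)
  have "Gamma (3 / 2 :: real) = sqrt pi / 2"
    using Gamma_plus1[of "1/2 :: real"] nonpos_Ints_nonpos[of "1/2 :: real"]
    by (auto simp: Gamma_one_half_real)
  then have "has_bochner_integral exp_law sqrt (sqrt pi / 2)"
    using exp_law_powr_moment[of "3/2"]
    by (subst has_bochner_integral_cong_AE[where g = "\<lambda>s. s powr (3/2 - 1)"])
       (use AE_exp_law_pos \<open>Gamma (3 / 2) = sqrt pi / 2\<close> in \<open>auto elim!: eventually_mono simp: powr_half_sqrt\<close>)
  then show "integrable exp_law sqrt" "(\<integral>s. sqrt s \<partial>exp_law) = sqrt pi / 2"
    by (simp_all add: has_bochner_integral_iff)
qed

text \<open>By the Laplace transform \<open>exp (- k \<bar>z\<bar>)\<close> of the time that Brownian motion needs to move by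
  \<open>z\<close>, this is the expected hyperbolic discount factor at the first visit to a point at distance
  \<open>\<bar>z\<bar>\<close>.\<close>

definition point_value :: "real \<Rightarrow> real \<Rightarrow> real" where
  "point_value \<beta> z = (\<integral>s. exp (- (sqrt (2 * \<beta> * s) * \<bar>z\<bar>)) \<partial>exp_law)"

lemma point_value_bounds:
  assumes "0 < \<beta>"
  shows "0 \<le> point_value \<beta> z" "point_value \<beta> z \<le> 1"
proof -
  show "0 \<le> point_value \<beta> z" unfolding point_value_def by simp
  have "AE s in exp_law. exp (- (sqrt (2 * \<beta> * s) * \<bar>z\<bar>)) \<le> 1"
    using AE_exp_law_pos by eventually_elim (use assms in simp)
  moreover from this have "integrable exp_law (\<lambda>s. exp (- (sqrt (2 * \<beta> * s) * \<bar>z\<bar>)))"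
    by (intro exp_law.integrable_const_bound[where B = 1]) auto
  ultimately show "point_value \<beta> z \<le> 1"
    unfolding point_value_def by (intro exp_law.integral_le_const)
qed

lemma measurable_point_value [measurable]: "point_value \<beta> \<in> borel_measurable borel"
  unfolding point_value_def[abs_def] by measurable

lemma point_value_0 [simp]: "point_value \<beta> 0 = 1"
  using exp_law.prob_space by (simp add: point_value_def)

lemma measurable_hyperbolic_discount [measurable]: "hyperbolic_discount \<beta> \<in> borel_measurable borel"
  unfolding hyperbolic_discount_def[abs_def] by measurable

lemma hyperbolic_discount_bounds:
  assumes "0 < \<beta>" "0 \<le> t"
  shows "0 \<le> hyperbolic_discount \<beta> t" "hyperbolic_discount \<beta> t \<le> 1" "0 < t \<Longrightarrow> hyperbolic_discount \<beta> t < 1"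
proof -
  have "0 \<le> \<beta> * t" using assms by simp
  then show "0 \<le> hyperbolic_discount \<beta> t" "hyperbolic_discount \<beta> t \<le> 1"
    by (simp_all add: hyperbolic_discount_def)
  assume "0 < t"
  with assms have "0 < \<beta> * t" by simp
  then show "hyperbolic_discount \<beta> t < 1" by (simp add: hyperbolic_discount_def)
qed

section \<open>Passing to the limit under a bound on second moments\<close>

text \<open>The bound on second moments makes the sequence uniformly integrable: truncating at \<open>K\<close> lowers
  each mean by at most \<open>C / K\<close>, and for the truncated variables bounded convergence applies.\<close>

lemma (in prob_space) integral_tendsto_of_L2_bounded:
  fixes Y :: "nat \<Rightarrow> 'a \<Rightarrow> real"
  assumes int: "\<And>n. integrable M (Y n)"
    and nonneg: "\<And>n \<omega>. \<omega> \<in> space M \<Longrightarrow> 0 \<le> Y n \<omega>"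
    and lim: "\<And>\<omega>. \<omega> \<in> space M \<Longrightarrow> (\<lambda>n. Y n \<omega>) \<longlonglongrightarrow> Z \<omega>"
    and mean: "\<And>n. expectation (Y n) = e"
    and int2: "\<And>n. integrable M (\<lambda>\<omega>. (Y n \<omega>)\<^sup>2)"
    and bound: "\<And>n. expectation (\<lambda>\<omega>. (Y n \<omega>)\<^sup>2) \<le> C"
  shows "integrable M Z" and "expectation Z = e"
proof -
  have [measurable]: "\<And>n. Y n \<in> borel_measurable M" using int by auto
  have [measurable]: "Z \<in> borel_measurable M"
    by (rule borel_measurable_LIMSEQ_real[OF lim]) auto
  have Z0: "0 \<le> Z \<omega>" if "\<omega> \<in> space M" for \<omega>
    using lim[OF that] by (rule LIMSEQ_le_const) (use nonneg[OF that] in auto)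
  have e0: "0 \<le> e"
    unfolding mean[of 0, symmetric] by (rule integral_nonneg_AE) (use nonneg in auto)
  have "(\<integral>\<^sup>+\<omega>. ennreal (Z \<omega>) \<partial>M) = (\<integral>\<^sup>+\<omega>. liminf (\<lambda>n. ennreal (Y n \<omega>)) \<partial>M)"
    by (intro nn_integral_cong lim_imp_Liminf[symmetric] tendsto_ennrealI lim) auto
  also have "\<dots> \<le> liminf (\<lambda>n. \<integral>\<^sup>+\<omega>. ennreal (Y n \<omega>) \<partial>M)"
    by (rule nn_integral_liminf) auto
  also have "(\<lambda>n. \<integral>\<^sup>+\<omega>. ennreal (Y n \<omega>) \<partial>M) = (\<lambda>n. ennreal e)"
    using nonneg by (auto simp: nn_integral_eq_integral[OF int] mean)
  also have "liminf (\<lambda>n::nat. ennreal e) = ennreal e" by (simp add: Liminf_const)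
  finally have le: "(\<integral>\<^sup>+\<omega>. ennreal (Z \<omega>) \<partial>M) \<le> ennreal e" .
  show intZ: "integrable M Z"
  proof (rule integrableI_nonneg)
    show "(\<integral>\<^sup>+\<omega>. ennreal (Z \<omega>) \<partial>M) < \<infinity>"
      using le by (rule le_less_trans) simp
  qed (use Z0 in auto)
  have "expectation Z \<le> e"
    using le e0 Z0 by (subst (asm) nn_integral_eq_integral[OF intZ]) auto
  moreover have "e - C / K \<le> expectation Z" if K: "0 < K" for K :: real
  proof -
    have "(\<lambda>n. expectation (\<lambda>\<omega>. min (Y n \<omega>) K)) \<longlonglongrightarrow> expectation (\<lambda>\<omega>. min (Z \<omega>) K)"
    proof (rule integral_dominated_convergence[where w = "\<lambda>_. K"])
      show "AE \<omega> in M. (\<lambda>n. min (Y n \<omega>) K) \<longlonglongrightarrow> min (Z \<omega>) K"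
        by (auto intro!: tendsto_min lim)
      show "AE \<omega> in M. norm (min (Y n \<omega>) K) \<le> K" for n
        using K nonneg by (auto simp: min_def)
    qed auto
    moreover have "e - C / K \<le> expectation (\<lambda>\<omega>. min (Y n \<omega>) K)" for n
    proof -
      have "e - C / K \<le> expectation (Y n) - expectation (\<lambda>\<omega>. (Y n \<omega>)\<^sup>2) / K"
        using bound[of n] K by (simp add: mean divide_right_mono)
      also have "\<dots> = expectation (\<lambda>\<omega>. Y n \<omega> - (Y n \<omega>)\<^sup>2 / K)"
        using int int2 by simp
      also have "\<dots> \<le> expectation (\<lambda>\<omega>. min (Y n \<omega>) K)"
      proof (rule integral_mono)
        show "integrable M (\<lambda>\<omega>. min (Y n \<omega>) K)" using int by auto
        fix \<omega> assume \<omega>: "\<omega> \<in> space M"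
        \<comment> \<open>completing the square shows \<open>y \<le> K + y\<^sup>2 / K\<close>\<close>
        have "Y n \<omega> - (Y n \<omega>)\<^sup>2 / K \<le> K"
        proof -
          have "0 \<le> (Y n \<omega> - K)\<^sup>2 + Y n \<omega> * K" using K nonneg[OF \<omega>] by simp
          then have "Y n \<omega> * K \<le> K * K + (Y n \<omega>)\<^sup>2"
            by (simp add: power2_eq_square algebra_simps)
          then have "(Y n \<omega> * K - (Y n \<omega>)\<^sup>2) / K \<le> K * K / K"
            using K by (intro divide_right_mono) auto
          then show ?thesis using K by (simp add: diff_divide_distrib)
        qed
        then show "Y n \<omega> - (Y n \<omega>)\<^sup>2 / K \<le> min (Y n \<omega>) K" using K by simp
      qed (use int int2 in auto)
      finally show ?thesis .
    qed
    ultimately have "e - C / K \<le> expectation (\<lambda>\<omega>. min (Z \<omega>) K)"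
      by (intro LIMSEQ_le_const) auto
    also have "\<dots> \<le> expectation Z" using intZ by (intro integral_mono) auto
    finally show ?thesis .
  qed
  then have "e \<le> expectation Z"
  proof -
    have "((\<lambda>K::real. e - C / K) \<longlongrightarrow> e - 0) at_top"
      by (intro tendsto_diff tendsto_const tendsto_divide_0[OF tendsto_const]
          filterlim_at_top_imp_at_infinity filterlim_ident)
    then show ?thesis
      using \<open>\<And>K. 0 < K \<Longrightarrow> e - C / K \<le> expectation Z\<close>
      by (intro tendsto_upperbound[of "\<lambda>K. e - C / K" _ at_top])
         (auto intro: eventually_mono[OF eventually_gt_at_top[of 0]])
  qed
  ultimately show "expectation Z = e" by simp
qed

section \<open>Independence of the increments from the past\<close>

locale brownian_motion = prob_space M for M :: "'w measure" +
  fixes X :: "real \<Rightarrow> 'w \<Rightarrow> real" and x :: real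
  assumes brownian: "brownian_motion_from M X x"
begin

lemma measurable_X: "0 \<le> t \<Longrightarrow> X t \<in> borel_measurable M"
  using brownian by (auto simp: brownian_motion_from_def)

lemma AE_start: "AE \<omega> in M. X 0 \<omega> = x"
  using brownian by (auto simp: brownian_motion_from_def)

lemma continuous_path: "\<omega> \<in> space M \<Longrightarrow> continuous_on {0..} (\<lambda>t. X t \<omega>)"
  using brownian by (auto simp: brownian_motion_from_def)

lemma distributed_increment:
  "0 \<le> s \<Longrightarrow> s < t \<Longrightarrow> distributed M lborel (\<lambda>\<omega>. X t \<omega> - X s \<omega>)
     (\<lambda>z. ennreal (normal_density 0 (sqrt (t - s)) z))"
  using brownian by (auto simp: brownian_motion_from_def)

lemma indep_increments:
  "0 \<le> \<tau> 0 \<Longrightarrow> (\<And>i. i < n \<Longrightarrow> \<tau> i < \<tau> (Suc i)) \<Longrightarrow>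
     indep_vars (\<lambda>_. borel) (\<lambda>i \<omega>. X (\<tau> (Suc i)) \<omega> - X (\<tau> i) \<omega>) {..<n}" for \<tau> :: "nat \<Rightarrow> real"
  using brownian by (auto simp: brownian_motion_from_def)

definition cylinder :: "real set \<Rightarrow> (real \<Rightarrow> real set) \<Rightarrow> 'w set" where
  "cylinder S B = {\<omega> \<in> space M. \<forall>s\<in>S. X s \<omega> \<in> B s}"

lemma cylinder_in_events:
  assumes "finite S" "\<And>s. s \<in> S \<Longrightarrow> 0 \<le> s" "\<And>s. B s \<in> sets borel"
  shows "cylinder S B \<in> events"
proof -
  have [measurable]: "X s \<in> borel_measurable M" if "s \<in> S" for s
    using that assms(2) measurable_X by auto
  show ?thesis
    unfolding cylinder_def using assms(1,3) by measurable
qed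

text \<open>The positions at finitely many times up to \<open>t\<close> are sums of the increments between the sorted
  times, and these are independent of the increment from \<open>t\<close> to \<open>u\<close>. Adding the times \<open>0\<close> and
  \<open>t\<close> makes the sums start at the initial position and makes the increment from \<open>t\<close> to \<open>u\<close> the
  last one of the list. The initial position is \<open>x\<close> only almost surely, so the cylinder is replaced
  by an event of the increments that agrees with it up to a null set.\<close>

lemma indep_cylinder_increment:
  assumes S: "finite S" "S \<subseteq> {0..t}" and B: "\<And>s. B s \<in> sets borel"
    and t: "0 \<le> t" "t < u" and C: "C \<in> sets borel"
  defines "D \<equiv> \<lambda>\<omega>. X u \<omega> - X t \<omega>"
  shows "prob (cylinder S B \<inter> (D -` C \<inter> space M)) = prob (cylinder S B) * prob (D -` C \<inter> space M)"
proof -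
  define L where "L = sorted_list_of_set (insert 0 (insert t S))"
  define m where "m = length L - 1"
  have fin: "finite (insert 0 (insert t S))" using S by simp
  have setL: "set L = insert 0 (insert t S)" and sL: "sorted L" "distinct L"
    unfolding L_def by (simp_all only: set_sorted_list_of_set[OF fin] sorted_sorted_list_of_set
        distinct_sorted_list_of_set)
  have lenL: "length L = Suc m"
    unfolding m_def using setL by (cases L) auto
  have nth_less: "L ! i < L ! j" if "i < j" "j < length L" for i j
    using sL that by (metis (no_types, lifting) nat_less_le nth_eq_iff_index_eq order_less_le
        order_less_trans sorted_nth_mono)
  have in_range: "0 \<le> y \<and> y \<le> t" if "y \<in> set L" for y
    using that S t by (auto simp: setL)
  have L0: "L ! 0 = 0"
  proof -
    obtain j where "j < length L" "L ! j = 0" using setL by (metis in_set_conv_nth insertI1)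
    moreover have "0 \<le> L ! 0" using in_range lenL by auto
    ultimately show ?thesis using nth_less[of 0 j] by (cases "j = 0") auto
  qed
  have Lm: "L ! m = t"
  proof -
    obtain j where j: "j < length L" "L ! j = t" using setL by (metis in_set_conv_nth insertI1 insertI2)
    moreover have "L ! m \<le> t" using in_range lenL by auto
    ultimately show ?thesis using nth_less[of j m] lenL by (cases "j = m") auto
  qed
  define \<tau> where "\<tau> = (\<lambda>i. if i \<le> m then L ! i else u)"
  define I where "I = (\<lambda>i \<omega>. X (\<tau> (Suc i)) \<omega> - X (\<tau> i) \<omega>)"
  have "\<tau> i < \<tau> (Suc i)" if "i < Suc m" for i
    using that nth_less[of i "Suc i"] lenL Lm t by (cases "i = m") (auto simp: \<tau>_def)
  then have ind: "indep_vars (\<lambda>_. borel) I {..<Suc m}"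
    unfolding I_def by (intro indep_increments) (auto simp: \<tau>_def L0)
  have I_last: "I m = D" by (auto simp: I_def D_def \<tau>_def Lm)
  have pos: "X (L ! j) \<omega> = X 0 \<omega> + (\<Sum>i<j. I i \<omega>)" if "j \<le> m" for j \<omega>
  proof -
    have "(\<Sum>i<j. I i \<omega>) = X (\<tau> j) \<omega> - X (\<tau> 0) \<omega>"
      unfolding I_def by (rule sum_lessThan_telescope)
    then show ?thesis using that by (simp add: \<tau>_def L0)
  qed
  define A where "A = {..<m}"
  define F where "F = {y \<in> space (PiM A (\<lambda>_. borel :: real measure)).
      \<forall>j\<in>{j. j \<le> m \<and> L ! j \<in> S}. x + (\<Sum>i<j. y i) \<in> B (L ! j)}"
  have "F \<in> sets (PiM A (\<lambda>_. borel))"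
  proof -
    have [measurable]: "(\<lambda>y. x + (\<Sum>i<j. y i)) \<in> borel_measurable (PiM A (\<lambda>_. borel))"
      if "j \<in> {j. j \<le> m \<and> L ! j \<in> S}" for j
      using that by (intro borel_measurable_add borel_measurable_const borel_measurable_sum
          measurable_component_singleton) (auto simp: A_def)
    show ?thesis unfolding F_def using B by measurable
  qed
  have iv: "indep_var (PiM A (\<lambda>_. borel)) (\<lambda>\<omega>. restrict (\<lambda>i. I i \<omega>) A)
      (PiM {m} (\<lambda>_. borel)) (\<lambda>\<omega>. restrict (\<lambda>i. I i \<omega>) {m})"
    by (rule indep_var_restrict[OF ind]) (auto simp: A_def)
  define G where "G = {y \<in> space (PiM {m} (\<lambda>_. borel :: real measure)). y m \<in> C}"
  have "G \<in> sets (PiM {m} (\<lambda>_. borel))"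
    unfolding G_def using C by measurable
  define EF where "EF = (\<lambda>\<omega>. restrict (\<lambda>i. I i \<omega>) A) -` F \<inter> space M"
  have G_eq: "(\<lambda>\<omega>. restrict (\<lambda>i. I i \<omega>) {m}) -` G \<inter> space M = D -` C \<inter> space M"
    by (auto simp: G_def I_last space_PiM)
  have EF_meas: "EF \<in> events"
    unfolding EF_def using \<open>F \<in> _\<close> indep_var_rv1[OF iv] by (rule measurable_sets[rotated])
  have "(\<lambda>\<omega>. (restrict (\<lambda>i. I i \<omega>) A, restrict (\<lambda>i. I i \<omega>) {m})) -` (F \<times> G) \<inter> space M
      = EF \<inter> ((\<lambda>\<omega>. restrict (\<lambda>i. I i \<omega>) {m}) -` G \<inter> space M)"
    by (auto simp: EF_def)
  with indep_varD[OF iv \<open>F \<in> _\<close> \<open>G \<in> _\<close>]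
  have prod: "prob (EF \<inter> (D -` C \<inter> space M)) = prob EF * prob (D -` C \<inter> space M)"
    by (simp add: EF_def G_eq)
  have ae: "AE \<omega> in M. \<omega> \<in> EF \<longleftrightarrow> \<omega> \<in> cylinder S B"
    using AE_start AE_space
  proof eventually_elim
    case (elim \<omega>)
    have "\<omega> \<in> EF \<longleftrightarrow> (\<forall>j. j \<le> m \<and> L ! j \<in> S \<longrightarrow> X (L ! j) \<omega> \<in> B (L ! j))"
    proof -
      have "(\<Sum>i<j. (\<lambda>i\<in>A. I i \<omega>) i) = (\<Sum>i<j. I i \<omega>)" if "j \<le> m" for j
        using that by (intro sum.cong) (auto simp: A_def)
      then show ?thesis
        using elim by (auto simp: EF_def F_def space_PiM pos)
    qed
    also have "\<dots> \<longleftrightarrow> (\<forall>s\<in>S. X s \<omega> \<in> B s)"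
    proof -
      have "\<exists>j\<le>m. L ! j = s" if "s \<in> S" for s
        using that setL lenL by (metis in_set_conv_nth insertI2 less_Suc_eq_le)
      then show ?thesis by blast
    qed
    finally show ?case using elim by (simp add: cylinder_def)
  qed
  have cyl: "cylinder S B \<in> events"
    using S B by (intro cylinder_in_events) auto
  have D_meas: "D -` C \<inter> space M \<in> events"
  proof -
    have [measurable]: "X u \<in> borel_measurable M" "X t \<in> borel_measurable M"
      using t measurable_X by auto
    have "D \<in> borel_measurable M" unfolding D_def by measurable
    then show ?thesis using C by (rule measurable_sets)
  qed
  have "prob EF = prob (cylinder S B)"
    using ae EF_meas cyl by (intro finite_measure_eq_AE) auto
  moreover have "prob (EF \<inter> (D -` C \<inter> space M)) = prob (cylinder S B \<inter> (D -` C \<inter> space M))"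
    using ae EF_meas cyl D_meas by (intro finite_measure_eq_AE) (auto elim!: eventually_mono)
  ultimately show ?thesis using prod by simp
qed

text \<open>The \<open>\<sigma>\<close>-algebra of the path up to \<open>t\<close>. Cylinders are taken as generators because they are
  closed under intersection, as the extension of independence from generators requires.\<close>

definition past :: "real \<Rightarrow> 'w measure" where
  "past t = sigma (space M) {cylinder S B |S B. finite S \<and> S \<subseteq> {0..t} \<and> (\<forall>s. B s \<in> sets borel)}"

lemma space_past [simp]: "space (past t) = space M"
  unfolding past_def by (rule space_measure_of) (auto simp: cylinder_def)

lemma sets_past: "sets (past t) = sigma_sets (space M)
   {cylinder S B |S B. finite S \<and> S \<subseteq> {0..t} \<and> (\<forall>s. B s \<in> sets borel)}"
  unfolding past_def by (rule sets_measure_of) (auto simp: cylinder_def)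

lemma measurable_X_past:
  assumes "0 \<le> s" "s \<le> t"
  shows "X s \<in> borel_measurable (past t)"
proof (rule measurableI)
  fix B :: "real set" assume "B \<in> sets borel"
  then have "cylinder {s} (\<lambda>_. B) \<in> sets (past t)"
    unfolding sets_past using assms by (intro sigma_sets.Basic) fastforce
  also have "cylinder {s} (\<lambda>_. B) = X s -` B \<inter> space (past t)"
    by (auto simp: cylinder_def)
  finally show "X s -` B \<inter> space (past t) \<in> sets (past t)" .
qed auto

lemma subalgebra_past: "subalgebra M (past t)"
proof -
  have "{cylinder S B |S B. finite S \<and> S \<subseteq> {0..t} \<and> (\<forall>s. B s \<in> sets borel)} \<subseteq> events"
    by (auto intro!: cylinder_in_events)
  from sets.sigma_sets_subset[OF this] show ?thesis
    by (simp add: subalgebra_def sets_past)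
qed

lemma indep_past_increment:
  assumes t: "0 \<le> t" "t < u" and H: "H \<in> borel_measurable (past t)"
  shows "indep_var borel H borel (\<lambda>\<omega>. X u \<omega> - X t \<omega>)"
proof -
  define D where "D = (\<lambda>\<omega>. X u \<omega> - X t \<omega>)"
  let ?C = "{cylinder S B |S B. finite S \<and> S \<subseteq> {0..t} \<and> (\<forall>s. B s \<in> sets borel)}"
  let ?D = "{D -` C \<inter> space M |C. C \<in> sets borel}"
  have [measurable]: "D \<in> borel_measurable M"
    unfolding D_def using t by (intro borel_measurable_diff measurable_X) auto
  have cyl: "?C \<subseteq> events" by (auto intro!: cylinder_in_events)
  have "indep_set ?C ?D"
  proof (rule indep_setI)
    show "?D \<subseteq> events" by auto
    fix a b assume "a \<in> ?C" "b \<in> ?D"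
    then show "prob (a \<inter> b) = prob a * prob b"
      using indep_cylinder_increment[OF _ _ _ t] by (auto simp: D_def)
  qed (rule cyl)
  moreover have "Int_stable ?C"
  proof (rule Int_stableI)
    fix a b assume "a \<in> ?C" "b \<in> ?C"
    then obtain S B S' B' where *: "a = cylinder S B" "finite S" "S \<subseteq> {0..t}" "\<And>s. B s \<in> sets borel"
      "b = cylinder S' B'" "finite S'" "S' \<subseteq> {0..t}" "\<And>s. B' s \<in> sets borel" by auto
    define B2 where "B2 = (\<lambda>s. (if s \<in> S then B s else UNIV) \<inter> (if s \<in> S' then B' s else UNIV))"
    have "a \<inter> b = cylinder (S \<union> S') B2"
      unfolding *(1,5) cylinder_def B2_def by auto
    moreover have "B2 s \<in> sets borel" for s using * by (auto simp: B2_def)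
    ultimately show "a \<inter> b \<in> ?C"
      using * by (intro CollectI exI[of _ "S \<union> S'"] exI[of _ B2]) auto
  qed
  moreover have "Int_stable ?D"
  proof (rule Int_stableI)
    fix a b assume "a \<in> ?D" "b \<in> ?D"
    then obtain C C' where "a = D -` C \<inter> space M" "b = D -` C' \<inter> space M" "C \<in> sets borel" "C' \<in> sets borel"
      by auto
    then show "a \<inter> b \<in> ?D" by (intro CollectI exI[of _ "C \<inter> C'"]) auto
  qed
  ultimately have ind: "indep_set (sets (past t)) (sigma_sets (space M) ?D)"
    unfolding sets_past by (rule indep_set_sigma_sets)
  have "H \<in> borel_measurable M"
    using subalgebra_past H by (rule measurable_from_subalg)
  moreover have "sigma_sets (space M) {H -` A \<inter> space M |A. A \<in> sets borel} \<subseteq> sets (past t)"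
  proof -
    have "{H -` A \<inter> space M |A. A \<in> sets borel} \<subseteq> sets (past t)"
      using measurable_sets[OF H] by auto
    from sets.sigma_sets_subset[OF this] show ?thesis by simp
  qed
  ultimately show ?thesis
    using ind unfolding indep_var_eq indep_sets2_eq D_def[symmetric] by auto
qed

end

section \<open>Hitting times of closed sets\<close>

lemma grid_floor_tendsto:
  fixes r :: real
  assumes "0 \<le> r"
  shows "(\<lambda>n. real (nat \<lfloor>r * real (Suc n)\<rfloor>) / real (Suc n)) \<longlonglongrightarrow> r"
    and "(\<lambda>n. real (nat \<lceil>r * real (Suc n)\<rceil>) / real (Suc n)) \<longlonglongrightarrow> r"
proof -
  have inv: "(\<lambda>n. 1 / real (Suc n)) \<longlonglongrightarrow> 0" by (rule LIMSEQ_Suc[OF lim_1_over_n])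
  have *: "\<bar>real (nat \<lfloor>r * real (Suc n)\<rfloor>) / real (Suc n) - r\<bar> \<le> 1 / real (Suc n)"
    "\<bar>real (nat \<lceil>r * real (Suc n)\<rceil>) / real (Suc n) - r\<bar> \<le> 1 / real (Suc n)" for n
  proof -
    have "real (nat \<lfloor>r * real (Suc n)\<rfloor>) = of_int \<lfloor>r * real (Suc n)\<rfloor>"
      "real (nat \<lceil>r * real (Suc n)\<rceil>) = of_int \<lceil>r * real (Suc n)\<rceil>"
      using assms by (simp_all add: of_nat_nat)
    then have "\<bar>real (nat \<lfloor>r * real (Suc n)\<rfloor>) - r * real (Suc n)\<bar> \<le> 1"
      "\<bar>real (nat \<lceil>r * real (Suc n)\<rceil>) - r * real (Suc n)\<bar> \<le> 1" by linarith+
    then have "\<bar>real (nat \<lfloor>r * real (Suc n)\<rfloor>) - r * real (Suc n)\<bar> / real (Suc n) \<le> 1 / real (Suc n)"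
      "\<bar>real (nat \<lceil>r * real (Suc n)\<rceil>) - r * real (Suc n)\<bar> / real (Suc n) \<le> 1 / real (Suc n)"
      by (intro divide_right_mono; simp)+
    moreover have "\<bar>a - r * real (Suc n)\<bar> / real (Suc n) = \<bar>a / real (Suc n) - r\<bar>" for a
    proof -
      have "\<bar>a / real (Suc n) - r\<bar> = \<bar>(a - r * real (Suc n)) / real (Suc n)\<bar>"
        by (simp add: diff_divide_distrib)
      then show ?thesis by simp
    qed
    ultimately show "\<bar>real (nat \<lfloor>r * real (Suc n)\<rfloor>) / real (Suc n) - r\<bar> \<le> 1 / real (Suc n)"
    "\<bar>real (nat \<lceil>r * real (Suc n)\<rceil>) / real (Suc n) - r\<bar> \<le> 1 / real (Suc n)" by simp_all
  qed
  show "(\<lambda>n. real (nat \<lfloor>r * real (Suc n)\<rfloor>) / real (Suc n)) \<longlonglongrightarrow> r"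
    by (rule LIM_zero_cancel, rule tendsto_rabs_zero_cancel, rule tendsto_sandwich[OF _ _ tendsto_const inv])
       (use *(1) in auto)
  show "(\<lambda>n. real (nat \<lceil>r * real (Suc n)\<rceil>) / real (Suc n)) \<longlonglongrightarrow> r"
    by (rule LIM_zero_cancel, rule tendsto_rabs_zero_cancel, rule tendsto_sandwich[OF _ _ tendsto_const inv])
       (use *(2) in auto)
qed

lemma Inf_ereal_image_attained:
  fixes A :: "real set"
  assumes "closed A" "A \<noteq> {}" "bdd_below A"
  shows "Inf (ereal ` A) = ereal (Inf A)" "Inf A \<in> A"
proof -
  show "Inf A \<in> A" using assms by (intro closed_contains_Inf)
  then show "Inf (ereal ` A) = ereal (Inf A)"
    using assms by (intro Inf_eqI) (auto intro: cInf_lower)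
qed

context brownian_motion
begin

lemma continuous_path_subset: "\<omega> \<in> space M \<Longrightarrow> T \<subseteq> {0..} \<Longrightarrow> continuous_on T (\<lambda>t. X t \<omega>)"
  using continuous_path continuous_on_subset by blast

lemma path_tendsto:
  assumes "\<omega> \<in> space M" "u \<longlonglongrightarrow> s" "\<And>n. 0 \<le> u n" "0 \<le> s"
  shows "(\<lambda>n. X (u n) \<omega>) \<longlonglongrightarrow> X s \<omega>"
  by (rule continuous_on_tendsto_compose[OF continuous_path[OF assms(1)] assms(2)]) (use assms in auto)

lemma closed_visits:
  assumes "\<omega> \<in> space M" "0 \<le> t0" "closed C"
  shows "closed {t. t0 \<le> t \<and> X t \<omega> \<in> C}"
proof -
  have "closed ({t0..} \<inter> (\<lambda>t. X t \<omega>) -` C)"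
    by (rule continuous_closed_preimage[OF continuous_path_subset]) (use assms in auto)
  also have "{t0..} \<inter> (\<lambda>t. X t \<omega>) -` C = {t. t0 \<le> t \<and> X t \<omega> \<in> C}" by auto
  finally show ?thesis .
qed

text \<open>Paths are continuous, so the times in \<open>{t0..}\<close> at which a closed set is visited form a closed
  set and their infimum is itself such a time.\<close>

lemma hitting_time_after_cases:
  assumes "\<omega> \<in> space M" "0 \<le> t0" "closed C"
  obtains "hitting_time_after X t0 C \<omega> = \<infinity>" "\<And>t. t0 \<le> t \<Longrightarrow> X t \<omega> \<notin> C"
  | s where "hitting_time_after X t0 C \<omega> = ereal s" "t0 \<le> s" "X s \<omega> \<in> C"
      "\<And>t. t0 \<le> t \<Longrightarrow> t < s \<Longrightarrow> X t \<omega> \<notin> C"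
proof (cases "{t. t0 \<le> t \<and> X t \<omega> \<in> C} = {}")
  case True
  have "hitting_time_after X t0 C \<omega> = \<infinity>"
    unfolding hitting_time_after_def True by (simp add: top_ereal_def)
  with True show ?thesis by (intro that(1)) auto
next
  case False
  let ?A = "{t. t0 \<le> t \<and> X t \<omega> \<in> C}"
  have bdd: "bdd_below ?A" by (rule bdd_belowI[of _ t0]) auto
  note att = Inf_ereal_image_attained[OF closed_visits[OF assms] False bdd]
  have "X t \<omega> \<notin> C" if "t0 \<le> t" "t < Inf ?A" for t
    using cInf_lower[OF _ bdd, of t] that by auto
  with att show ?thesis
    by (intro that(2)[of "Inf ?A"]) (auto simp: hitting_time_after_def)
qed

lemma hitting_time_after_le_iff:
  assumes "\<omega> \<in> space M" "0 \<le> t0" "closed C"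
  shows "hitting_time_after X t0 C \<omega> \<le> ereal t \<longleftrightarrow> (\<exists>s. t0 \<le> s \<and> s \<le> t \<and> X s \<omega> \<in> C)"
  by (rule hitting_time_after_cases[OF assms]) (auto simp: not_le[symmetric], force)

lemma hitting_time_after_ge:
  assumes "\<omega> \<in> space M" "0 \<le> t0" "closed C"
  shows "ereal t0 \<le> hitting_time_after X t0 C \<omega>"
  by (rule hitting_time_after_cases[OF assms]) auto

text \<open>On a compact time interval a continuous path avoids a closed set if and only if it keeps a
  positive distance from it, and by continuity the distance need only be checked at the rational
  fractions of the interval.\<close>

lemma hitting_event_in_past:
  assumes t: "0 \<le> t0" "t0 \<le> t" and C: "closed C"
  shows "{\<omega> \<in> space M. hitting_time_after X t0 C \<omega> > ereal t} \<in> sets (past t)"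
proof (cases "C = {}")
  case True
  then have "{\<omega> \<in> space M. hitting_time_after X t0 C \<omega> > ereal t} = space (past t)"
    by (auto simp: hitting_time_after_def top_ereal_def)
  then show ?thesis by (metis sets.top)
next
  case False
  define p where "p q = t0 + q * (t - t0)" for q :: real
  define good where "good n = {\<omega> \<in> space (past t).
     \<forall>jN :: nat \<times> nat. fst jN \<le> Suc (snd jN) \<longrightarrow>
        1 / real (Suc n) \<le> infdist (X (p (real (fst jN) / real (Suc (snd jN)))) \<omega>) C}" for n
  have p_range: "0 \<le> p q \<and> t0 \<le> p q \<and> p q \<le> t" if "0 \<le> q" "q \<le> 1" for q
  proof -
    have "0 \<le> q * (t - t0)" using that t by simp
    moreover have "q * (t - t0) \<le> 1 * (t - t0)"
      using that t by (intro mult_right_mono) auto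
    ultimately have "0 \<le> q * (t - t0)" "q * (t - t0) \<le> 1 * (t - t0)" by auto
    then show ?thesis using t by (simp add: p_def)
  qed
  have "good n \<in> sets (past t)" for n
  proof -
    have "{\<omega> \<in> space (past t). fst jN \<le> Suc (snd jN) \<longrightarrow>
        1 / real (Suc n) \<le> infdist (X (p (real (fst jN) / real (Suc (snd jN)))) \<omega>) C} \<in> sets (past t)"
      for jN :: "nat \<times> nat"
    proof (cases "fst jN \<le> Suc (snd jN)")
      case True
      then have "X (p (real (fst jN) / real (Suc (snd jN)))) \<in> borel_measurable (past t)"
        using p_range by (intro measurable_X_past) (auto simp: divide_le_eq)
      then have "(\<lambda>\<omega>. infdist (X (p (real (fst jN) / real (Suc (snd jN)))) \<omega>) C) \<in> borel_measurable (past t)"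
        by (rule measurable_compose) (intro borel_measurable_continuous_onI continuous_intros)
      from borel_measurable_le[OF borel_measurable_const this] True show ?thesis by simp
    qed (use sets.top[of "past t"] in simp)
    then show ?thesis unfolding good_def by (intro sets.sets_Collect_countable_All)
  qed
  moreover have "{\<omega> \<in> space M. hitting_time_after X t0 C \<omega> > ereal t} = (\<Union>n. good n)"
  proof (intro set_eqI iffI)
    fix \<omega> assume "\<omega> \<in> {\<omega> \<in> space M. hitting_time_after X t0 C \<omega> > ereal t}"
    then have \<omega>: "\<omega> \<in> space M" and no: "\<And>s. t0 \<le> s \<Longrightarrow> s \<le> t \<Longrightarrow> X s \<omega> \<notin> C"
      using hitting_time_after_le_iff[OF _ t(1) C, of \<omega> t] by (auto simp: not_le[symmetric])
    have "continuous_on {t0..t} (\<lambda>s. infdist (X s \<omega>) C)"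
      using t by (intro continuous_on_infdist continuous_path_subset \<omega>) auto
    then obtain s where s: "s \<in> {t0..t}" "\<And>r. r \<in> {t0..t} \<Longrightarrow> infdist (X s \<omega>) C \<le> infdist (X r \<omega>) C"
      using continuous_attains_inf[of "{t0..t}" "\<lambda>s. infdist (X s \<omega>) C"] t by auto
    have "0 < infdist (X s \<omega>) C"
      using no s(1) C False by (simp add: infdist_pos_not_in_closed)
    then obtain n where n: "1 / real (Suc n) < infdist (X s \<omega>) C"
      using reals_Archimedean by (auto simp: inverse_eq_divide)
    have "\<omega> \<in> good n"
      unfolding good_def
    proof (intro CollectI conjI allI impI)
      fix jN :: "nat \<times> nat" assume "fst jN \<le> Suc (snd jN)"
      then have "p (real (fst jN) / real (Suc (snd jN))) \<in> {t0..t}"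
        using p_range[of "real (fst jN) / real (Suc (snd jN))"] by (auto simp: divide_le_eq)
      from s(2)[OF this] n show "1 / real (Suc n) \<le> infdist (X (p (real (fst jN) / real (Suc (snd jN)))) \<omega>) C"
        by linarith
    qed (use \<omega> in simp)
    then show "\<omega> \<in> (\<Union>n. good n)" by auto
  next
    fix \<omega> assume "\<omega> \<in> (\<Union>n. good n)"
    then obtain n where g: "\<omega> \<in> good n" by auto
    then have \<omega>: "\<omega> \<in> space M" by (simp add: good_def)
    have "X s \<omega> \<notin> C" if s: "t0 \<le> s" "s \<le> t" for s
    proof -
      obtain r where r: "0 \<le> r" "r \<le> 1" "s = p r"
      proof (cases "t = t0")
        case True then show ?thesis using that[of 0] s by (auto simp: p_def)
      next
        case False
        with s t show ?thesis by (intro that[of "(s - t0) / (t - t0)"]) (auto simp: p_def)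
      qed
      define q where "q = (\<lambda>n. real (nat \<lfloor>r * real (Suc n)\<rfloor>) / real (Suc n))"
      have le: "nat \<lfloor>r * real (Suc m)\<rfloor> \<le> Suc m" for m
      proof -
        have "r * real (Suc m) \<le> 1 * real (Suc m)" using r by (intro mult_right_mono) auto
        then have "\<lfloor>r * real (Suc m)\<rfloor> \<le> \<lfloor>real (Suc m)\<rfloor>" by (intro floor_mono) simp
        then show ?thesis by (simp only: floor_of_nat nat_le_iff)
      qed
      then have q01: "0 \<le> q m" "q m \<le> 1" for m
        unfolding q_def by (auto simp: divide_le_eq simp del: of_nat_Suc)
      have "q \<longlonglongrightarrow> r" unfolding q_def by (rule grid_floor_tendsto(1)) (rule r)
      then have "(\<lambda>m. X (p (q m)) \<omega>) \<longlonglongrightarrow> X (p r) \<omega>"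
        using p_range q01 r unfolding p_def by (intro path_tendsto[OF \<omega>] tendsto_intros) (auto simp: p_def)
      then have "(\<lambda>m. infdist (X (p (q m)) \<omega>) C) \<longlonglongrightarrow> infdist (X (p r) \<omega>) C"
        by (rule tendsto_infdist)
      moreover have "1 / real (Suc n) \<le> infdist (X (p (q m)) \<omega>) C" for m
        using g le[of m] unfolding good_def q_def by (auto dest!: spec[of _ "(nat \<lfloor>r * real (Suc m)\<rfloor>, m)"])
      ultimately have "1 / real (Suc n) \<le> infdist (X (p r) \<omega>) C"
        by (intro LIMSEQ_le_const) auto
      then show ?thesis using r(3) by auto
    qed
    then show "\<omega> \<in> {\<omega> \<in> space M. hitting_time_after X t0 C \<omega> > ereal t}"
      using hitting_time_after_le_iff[OF \<omega> t(1) C, of t] \<omega> by (auto simp: not_le[symmetric])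
  qed
  ultimately show ?thesis by auto
qed

lemma measurable_hitting_time_after:
  assumes "0 \<le> t0" "closed C"
  shows "hitting_time_after X t0 C \<in> borel_measurable M"
proof (rule borel_measurableI_greater)
  fix y :: ereal
  have ev: "{\<omega> \<in> space M. hitting_time_after X t0 C \<omega> > ereal t} \<in> events" if "t0 \<le> t" for t
    using hitting_event_in_past[OF assms(1) that assms(2)] subalgebra_past[of t]
    by (auto simp: subalgebra_def)
  consider t where "y = ereal t" "t0 \<le> t" | "y < ereal t0" | "y = \<infinity>"
  proof (cases y)
    case (real r)
    then show ?thesis using that by (cases "t0 \<le> r") auto
  qed (use that in auto)
  then show "{\<omega> \<in> space M. y < hitting_time_after X t0 C \<omega>} \<in> events"
  proof cases
    case 2
    then have "{\<omega> \<in> space M. y < hitting_time_after X t0 C \<omega>} = space M"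
      using hitting_time_after_ge[OF _ assms] by (auto intro: less_le_trans)
    then show ?thesis by simp
  qed (use ev in auto)
qed

text \<open>The infimum over strictly positive times need not be attained by a positive time; the delayed
  hitting times, which are attained, decrease to it.\<close>

lemma hitting_time_eq_INF:
  "hitting_time X C \<omega> = (INF n. hitting_time_after X (1 / real (Suc n)) C \<omega>)"
proof -
  have "(INF n. hitting_time_after X (1 / real (Suc n)) C \<omega>) \<le> ereal t"
    if "0 < t" "X t \<omega> \<in> C" for t
  proof -
    obtain n where "1 / real (Suc n) < t"
      using reals_Archimedean[OF \<open>0 < t\<close>] by (auto simp: inverse_eq_divide)
    with that show ?thesis
      by (intro INF_lower2[of n]) (auto simp: hitting_time_after_def intro!: Inf_lower)
  qed
  moreover have "0 < t" if "1 / real (Suc n) \<le> t" for n t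
    using that by (rule less_le_trans[rotated]) simp
  ultimately show ?thesis
    unfolding hitting_time_def hitting_time_after_def
    by (intro antisym INF_greatest Inf_superset_mono image_mono) (auto intro!: Inf_greatest)
qed

lemma measurable_hitting_time:
  assumes "closed C"
  shows "hitting_time X C \<in> borel_measurable M"
proof -
  have [measurable]: "hitting_time_after X (1 / real (Suc n)) C \<in> borel_measurable M" for n
    using assms by (intro measurable_hitting_time_after) auto
  show ?thesis
    unfolding hitting_time_eq_INF[abs_def] by measurable
qed

text \<open>Rounding the random time up to a grid leaves countably many fixed times, and the rounded times
  converge to the random one.\<close>

lemma measurable_X_at:
  fixes \<tau> :: "'w \<Rightarrow> real"
  assumes [measurable]: "\<tau> \<in> borel_measurable M" and nonneg: "\<And>\<omega>. \<omega> \<in> space M \<Longrightarrow> 0 \<le> \<tau> \<omega>"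
  shows "(\<lambda>\<omega>. X (\<tau> \<omega>) \<omega>) \<in> borel_measurable M"
proof (rule borel_measurable_LIMSEQ_real)
  show "(\<lambda>n. X (real (nat \<lceil>\<tau> \<omega> * real (Suc n)\<rceil>) / real (Suc n)) \<omega>) \<longlonglongrightarrow> X (\<tau> \<omega>) \<omega>"
    if "\<omega> \<in> space M" for \<omega>
    using that nonneg
    by (intro path_tendsto grid_floor_tendsto divide_nonneg_nonneg of_nat_0_le_iff) auto
  fix n
  have [measurable]: "X (real j / real (Suc n)) \<in> borel_measurable M" for j :: nat
    by (intro measurable_X) simp
  show "(\<lambda>\<omega>. X (real (nat \<lceil>\<tau> \<omega> * real (Suc n)\<rceil>) / real (Suc n)) \<omega>) \<in> borel_measurable M"
    by (rule measurable_compose_countable[where f = "\<lambda>j. X (real j / real (Suc n))"]) measurable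
qed

lemma measurable_discounted_reward:
  assumes [measurable]: "\<tau> \<in> borel_measurable M" "g \<in> borel_measurable borel" "\<delta> \<in> borel_measurable borel"
    and nonneg: "\<And>\<omega>. \<omega> \<in> space M \<Longrightarrow> 0 \<le> \<tau> \<omega>"
  shows "discounted_reward X \<delta> g \<tau> \<in> borel_measurable M"
proof -
  have [measurable]: "(\<lambda>\<omega>. X (real_of_ereal (\<tau> \<omega>)) \<omega>) \<in> borel_measurable M"
    using nonneg by (intro measurable_X_at) (auto intro: real_of_ereal_pos)
  show ?thesis
    unfolding discounted_reward_def[abs_def] by measurable
qed

lemma hitting_time_nonneg: "0 \<le> hitting_time X C \<omega>"
  unfolding hitting_time_def by (auto intro!: Inf_greatest)

lemma hitting_time_in_closed:
  assumes \<omega>: "\<omega> \<in> space M" and C: "closed C" and fin: "hitting_time X C \<omega> \<noteq> \<infinity>"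
  shows "X (real_of_ereal (hitting_time X C \<omega>)) \<omega> \<in> C"
proof -
  define A where "A = {t. 0 < t \<and> X t \<omega> \<in> C}"
  have ne: "A \<noteq> {}"
  proof
    assume "A = {}"
    then have "hitting_time X C \<omega> = \<infinity>"
      unfolding hitting_time_def A_def[symmetric] by (simp add: top_ereal_def)
    with fin show False by simp
  qed
  have bdd: "bdd_below A" by (rule bdd_belowI[of _ 0]) (auto simp: A_def)
  have "hitting_time X C \<omega> = ereal (Inf A)"
    unfolding hitting_time_def A_def[symmetric] using ereal_Inf'[OF bdd ne] by simp
  moreover have "Inf A \<in> closure A" using ne bdd by (rule closure_contains_Inf)
  moreover have "closure A \<subseteq> {t. 0 \<le> t \<and> X t \<omega> \<in> C}"
    by (rule closure_minimal) (auto simp: A_def closed_visits[OF \<omega> order_refl C])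
  ultimately show ?thesis by auto
qed

lemma AE_hitting_time_outside:
  assumes "x \<notin> R"
  shows "AE \<omega> in M. X 0 \<omega> = x \<and> hitting_time X R \<omega> = hitting_time_after X 0 R \<omega>"
  using AE_start
proof eventually_elim
  case (elim \<omega>)
  then have "{t. 0 < t \<and> X t \<omega> \<in> R} = {t. 0 \<le> t \<and> X t \<omega> \<in> R}"
    using assms by (auto simp: less_le)
  with elim show ?case by (simp add: hitting_time_def hitting_time_after_def)
qed

end

section \<open>Optional stopping of the exponential martingales\<close>

text \<open>Completing the square turns the integrand into a normal density with shifted mean.\<close>

lemma normal_exponential_moment:
  assumes "0 < \<sigma>"
  shows "has_bochner_integral lborel (\<lambda>z. normal_density 0 \<sigma> z * exp (k * z)) (exp (k\<^sup>2 * \<sigma>\<^sup>2 / 2))"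
proof -
  have "normal_density 0 \<sigma> z * exp (k * z) = exp (k\<^sup>2 * \<sigma>\<^sup>2 / 2) * normal_density (k * \<sigma>\<^sup>2) \<sigma> z" for z
  proof -
    have "- z\<^sup>2 / (2 * \<sigma>\<^sup>2) + k * z = k\<^sup>2 * \<sigma>\<^sup>2 / 2 + - (z - k * \<sigma>\<^sup>2)\<^sup>2 / (2 * \<sigma>\<^sup>2)"
      using assms by (simp add: field_simps power2_eq_square)
    then have "exp (- z\<^sup>2 / (2 * \<sigma>\<^sup>2)) * exp (k * z) = exp (k\<^sup>2 * \<sigma>\<^sup>2 / 2) * exp (- (z - k * \<sigma>\<^sup>2)\<^sup>2 / (2 * \<sigma>\<^sup>2))"
      by (simp only: exp_add[symmetric])
    then show ?thesis by (simp add: normal_density_def)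
  qed
  then show ?thesis
    using assms by (simp add: has_bochner_integral_iff)
qed

context brownian_motion
begin

definition exp_mart :: "real \<Rightarrow> real \<Rightarrow> 'w \<Rightarrow> real" where
  "exp_mart k t \<omega> = exp (k * X t \<omega> - k\<^sup>2 * t / 2)"

lemma exp_increment_moment:
  assumes "0 \<le> s" "s < t"
  shows "integrable M (\<lambda>\<omega>. exp (k * (X t \<omega> - X s \<omega>)))"
    and "expectation (\<lambda>\<omega>. exp (k * (X t \<omega> - X s \<omega>))) = exp (k\<^sup>2 * (t - s) / 2)"
proof -
  note D = distributed_increment[OF assms]
  note N = normal_exponential_moment[of "sqrt (t - s)" k]
  show "integrable M (\<lambda>\<omega>. exp (k * (X t \<omega> - X s \<omega>)))"
    using distributed_integrable[OF D, of "\<lambda>z. exp (k * z)"] N assms by (auto simp: has_bochner_integral_iff)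
  show "expectation (\<lambda>\<omega>. exp (k * (X t \<omega> - X s \<omega>))) = exp (k\<^sup>2 * (t - s) / 2)"
    using distributed_integral[OF D, of "\<lambda>z. exp (k * z)"] N assms by (auto simp: has_bochner_integral_iff)
qed

lemma integrable_exp_mart:
  assumes "0 \<le> t"
  shows "integrable M (exp_mart k t)"
proof (cases "t = 0")
  case True
  have [measurable]: "X 0 \<in> borel_measurable M" by (rule measurable_X) simp
  have "integrable M (\<lambda>\<omega>. exp (k * x)) \<longleftrightarrow> integrable M (exp_mart k 0)"
  proof (rule integrable_cong_AE)
    show "AE \<omega> in M. exp (k * x) = exp_mart k 0 \<omega>"
      using AE_start by eventually_elim (simp add: exp_mart_def)
  qed (simp_all add: exp_mart_def[abs_def])
  with True show ?thesis by simp
next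
  case False
  with assms have t: "0 < t" by simp
  have [measurable]: "X 0 \<in> borel_measurable M" "X t \<in> borel_measurable M"
    using assms by (auto intro!: measurable_X)
  have "integrable M (\<lambda>\<omega>. exp (k * x - k\<^sup>2 * t / 2) * exp (k * (X t \<omega> - X 0 \<omega>))) \<longleftrightarrow> integrable M (exp_mart k t)"
  proof (rule integrable_cong_AE)
    show "AE \<omega> in M. exp (k * x - k\<^sup>2 * t / 2) * exp (k * (X t \<omega> - X 0 \<omega>)) = exp_mart k t \<omega>"
      using AE_start by eventually_elim (simp add: exp_mart_def exp_add[symmetric] algebra_simps)
  qed (simp_all add: exp_mart_def[abs_def])
  with exp_increment_moment(1)[OF _ t] show ?thesis by auto
qed

text \<open>Beyond \<open>t\<close> the process is multiplied by \<open>exp (k (X\<^sub>u - X\<^sub>t) - k\<^sup>2 (u - t) / 2)\<close>, which is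
  independent of the past and has mean one.\<close>

lemma exp_mart_orthogonal:
  assumes t: "0 \<le> t" "t \<le> u" and A: "A \<in> sets (past t)"
  shows "expectation (\<lambda>\<omega>. indicator A \<omega> * (exp_mart k u \<omega> - exp_mart k t \<omega>)) = 0"
proof (cases "t = u")
  case False
  with t have u: "t < u" by simp
  define H where "H = (\<lambda>\<omega>. indicator A \<omega> * exp_mart k t \<omega>)"
  define E where "E = (\<lambda>\<omega>. exp (k * (X u \<omega> - X t \<omega>)))"
  have A': "A \<in> events" using A subalgebra_past[of t] by (auto simp: subalgebra_def)
  have H: "H \<in> borel_measurable (past t)"
  proof -
    have [measurable]: "X t \<in> borel_measurable (past t)" using t by (intro measurable_X_past) auto
    show ?thesis unfolding H_def exp_mart_def using A by measurable
  qed
  have "indep_var borel ((\<lambda>y. y) \<circ> H) borel ((\<lambda>z. exp (k * z)) \<circ> (\<lambda>\<omega>. X u \<omega> - X t \<omega>))"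
    by (rule indep_var_compose[OF indep_past_increment[OF t(1) u H]]) auto
  then have ind: "indep_var borel H borel E" by (simp add: comp_def E_def)
  have intH: "integrable M H"
    unfolding H_def using A' integrable_real_mult_indicator[OF A' integrable_exp_mart[OF t(1), of k]]
    by (simp add: mult.commute)
  have intE: "integrable M E" unfolding E_def by (rule exp_increment_moment[OF t(1) u])
  have eq: "indicator A \<omega> * (exp_mart k u \<omega> - exp_mart k t \<omega>) = exp (- (k\<^sup>2 * (u - t) / 2)) * (H \<omega> * E \<omega>) - H \<omega>" for \<omega>
  proof -
    have "exp_mart k u \<omega> = exp (- (k\<^sup>2 * (u - t) / 2)) * (exp_mart k t \<omega> * E \<omega>)"
      unfolding exp_mart_def E_def exp_add[symmetric] by (simp add: field_simps)
    then show ?thesis by (simp add: H_def algebra_simps)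
  qed
  have HE: "expectation (\<lambda>\<omega>. H \<omega> * E \<omega>) = expectation H * exp (k\<^sup>2 * (u - t) / 2)"
    using indep_var_lebesgue_integral[OF ind intH intE] exp_increment_moment(2)[OF t(1) u, of k]
    by (simp add: E_def)
  have "expectation (\<lambda>\<omega>. indicator A \<omega> * (exp_mart k u \<omega> - exp_mart k t \<omega>))
      = exp (- (k\<^sup>2 * (u - t) / 2)) * expectation (\<lambda>\<omega>. H \<omega> * E \<omega>) - expectation H"
    unfolding eq using indep_var_integrable[OF ind intH intE] intH by simp
  also have "\<dots> = expectation H * (exp (- (k\<^sup>2 * (u - t) / 2)) * exp (k\<^sup>2 * (u - t) / 2)) - expectation H"
    unfolding HE by (simp only: mult.left_commute)
  also have "\<dots> = 0"
    unfolding exp_add[symmetric] by simp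
  finally show ?thesis .
qed simp

text \<open>The stopped time is rounded up to the grid with \<open>n + 1\<close> steps. The value at the rounded time is
  the initial value plus the sum of the grid increments that begin strictly before the hitting time.
  Whether an increment counts is decided by the past of its left end, so each contributes zero mean.\<close>

lemma exp_mart_grid_stopping:
  fixes k :: real
  assumes t0: "0 \<le> t0" "t0 < T" and C: "closed C"
  defines "\<sigma> \<equiv> \<lambda>\<omega>. real_of_ereal (min (hitting_time_after X t0 C \<omega>) (ereal T))"
  defines "grid \<equiv> \<lambda>n j. t0 + (T - t0) * (real j / real (Suc n))"
  defines "idx \<equiv> \<lambda>n \<omega>. nat \<lceil>(\<sigma> \<omega> - t0) / (T - t0) * real (Suc n)\<rceil>"
  shows "integrable M (\<lambda>\<omega>. exp_mart k (grid n (idx n \<omega>)) \<omega>)"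
    and "expectation (\<lambda>\<omega>. exp_mart k (grid n (idx n \<omega>)) \<omega>) = expectation (exp_mart k t0)"
    and "\<And>\<omega>. \<omega> \<in> space M \<Longrightarrow> t0 \<le> \<sigma> \<omega> \<and> \<sigma> \<omega> \<le> T"
    and "\<And>\<omega>. \<omega> \<in> space M \<Longrightarrow> t0 \<le> grid n (idx n \<omega>) \<and> grid n (idx n \<omega>) \<le> T"
proof -
  define A where "A i = {\<omega> \<in> space M. hitting_time_after X t0 C \<omega> > ereal (grid n i)}" for i
  define d where "d i \<omega> = exp_mart k (grid n (Suc i)) \<omega> - exp_mart k (grid n i) \<omega>" for i \<omega>
  have grid_mono: "grid n i \<le> grid n j" if "i \<le> j" for i j
    using that t0 unfolding grid_def by (intro add_left_mono mult_left_mono divide_right_mono) auto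
  have grid_0: "grid n 0 = t0" and grid_N: "grid n (Suc n) = T"
    by (simp_all add: grid_def del: of_nat_Suc)
  have grid_ge: "t0 \<le> grid n i" for i
    using grid_mono[of 0 i] grid_0 by simp
  show \<sigma>: "t0 \<le> \<sigma> \<omega> \<and> \<sigma> \<omega> \<le> T" if "\<omega> \<in> space M" for \<omega>
    by (rule hitting_time_after_cases[OF that t0(1) C]) (use t0 in \<open>auto simp: \<sigma>_def min_def\<close>)
  have grid_less_iff: "grid n i < \<sigma> \<omega> \<longleftrightarrow> i < idx n \<omega>" for i \<omega>
  proof -
    have "grid n i < \<sigma> \<omega> \<longleftrightarrow> (T - t0) * (real i / real (Suc n)) < \<sigma> \<omega> - t0"
      by (auto simp: grid_def)
    also have "\<dots> \<longleftrightarrow> real i / real (Suc n) < (\<sigma> \<omega> - t0) / (T - t0)"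
      using t0 by (simp add: pos_less_divide_eq mult.commute del: of_nat_Suc)
    also have "\<dots> \<longleftrightarrow> real i < (\<sigma> \<omega> - t0) / (T - t0) * real (Suc n)"
      by (simp add: pos_divide_less_eq del: of_nat_Suc)
    also have "\<dots> \<longleftrightarrow> int i < \<lceil>(\<sigma> \<omega> - t0) / (T - t0) * real (Suc n)\<rceil>"
      by (simp add: less_ceiling_iff del: of_nat_Suc)
    also have "\<dots> \<longleftrightarrow> i < idx n \<omega>"
      unfolding idx_def by (rule zless_nat_eq_int_zless[symmetric])
    finally show ?thesis .
  qed
  have idx_le: "idx n \<omega> \<le> Suc n" if "\<omega> \<in> space M" for \<omega>
    using grid_less_iff[of "Suc n" \<omega>] \<sigma>[OF that] grid_N by auto
  show "t0 \<le> grid n (idx n \<omega>) \<and> grid n (idx n \<omega>) \<le> T" if "\<omega> \<in> space M" for \<omega>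
    using grid_ge grid_mono[OF idx_le[OF that]] grid_N by auto
  have A_iff: "\<omega> \<in> A i \<longleftrightarrow> i < idx n \<omega>" if "\<omega> \<in> space M" "i < Suc n" for \<omega> i
  proof -
    have "grid n i < T"
    proof -
      have "(T - t0) * (real i / real (Suc n)) < (T - t0) * 1"
        using that(2) t0 by (intro mult_strict_left_mono) (simp_all add: divide_less_eq)
      then show ?thesis by (simp add: grid_def)
    qed
    have "hitting_time_after X t0 C \<omega> > ereal (grid n i) \<longleftrightarrow> grid n i < \<sigma> \<omega>"
      by (rule hitting_time_after_cases[OF that(1) t0(1) C])
         (use \<open>grid n i < T\<close> in \<open>auto simp: \<sigma>_def min_def\<close>)
    with that grid_less_iff show ?thesis by (simp add: A_def)
  qed
  have decomp: "exp_mart k (grid n (idx n \<omega>)) \<omega>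
      = exp_mart k t0 \<omega> + (\<Sum>i<Suc n. indicator (A i) \<omega> * d i \<omega>)" if "\<omega> \<in> space M" for \<omega>
  proof -
    have "(\<Sum>i<Suc n. indicator (A i) \<omega> * d i \<omega>) = (\<Sum>i<idx n \<omega>. indicator (A i) \<omega> * d i \<omega>)"
      using idx_le[OF that] A_iff[OF that]
      by (intro sum.mono_neutral_right) (auto simp: indicator_def simp del: sum.lessThan_Suc)
    also have "\<dots> = (\<Sum>i<idx n \<omega>. d i \<omega>)"
      using idx_le[OF that] A_iff[OF that] by (intro sum.cong) auto
    also have "\<dots> = exp_mart k (grid n (idx n \<omega>)) \<omega> - exp_mart k (grid n 0) \<omega>"
      unfolding d_def by (rule sum_lessThan_telescope)
    finally show ?thesis by (simp add: grid_0)
  qed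
  have A_past: "A i \<in> sets (past (grid n i))" for i
    unfolding A_def by (rule hitting_event_in_past[OF t0(1) grid_ge C])
  have A_ev: "A i \<in> events" for i
    using A_past subalgebra_past by (auto simp: subalgebra_def)
  have int0: "integrable M (exp_mart k t0)" and intg: "integrable M (exp_mart k (grid n i))" for i
    using t0 grid_ge[of i] by (auto intro!: integrable_exp_mart)
  have int1: "integrable M (\<lambda>\<omega>. indicator (A i) \<omega> * d i \<omega>)" for i
    using integrable_real_mult_indicator[OF A_ev, of "d i"] intg unfolding d_def
    by (simp add: mult.commute)
  have sum_int: "integrable M (\<lambda>\<omega>. exp_mart k t0 \<omega> + (\<Sum>i<Suc n. indicator (A i) \<omega> * d i \<omega>))"
    using int0 int1 by (intro Bochner_Integration.integrable_add Bochner_Integration.integrable_sum)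
  show "integrable M (\<lambda>\<omega>. exp_mart k (grid n (idx n \<omega>)) \<omega>)"
    using sum_int by (subst Bochner_Integration.integrable_cong[OF refl decomp]) auto
  have zero: "expectation (\<lambda>\<omega>. indicator (A i) \<omega> * d i \<omega>) = 0" for i
    unfolding d_def using t0 grid_ge[of i]
    by (intro exp_mart_orthogonal A_past grid_mono) auto
  have "expectation (\<lambda>\<omega>. exp_mart k (grid n (idx n \<omega>)) \<omega>)
      = expectation (\<lambda>\<omega>. exp_mart k t0 \<omega> + (\<Sum>i<Suc n. indicator (A i) \<omega> * d i \<omega>))"
    by (rule Bochner_Integration.integral_cong[OF refl decomp])
  also have "\<dots> = expectation (exp_mart k t0) + (\<Sum>i<Suc n. expectation (\<lambda>\<omega>. indicator (A i) \<omega> * d i \<omega>))"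
    by (simp only: Bochner_Integration.integral_add[OF int0 Bochner_Integration.integrable_sum[OF int1]]
        Bochner_Integration.integral_sum[OF int1])
  finally show "expectation (\<lambda>\<omega>. exp_mart k (grid n (idx n \<omega>)) \<omega>) = expectation (exp_mart k t0)"
    by (simp only: zero sum.neutral_const add_0_right)
qed

text \<open>As the grid is refined the rounded times converge to the stopped time. The means converge as
  well, because the square of the martingale for \<open>k\<close> is the martingale for \<open>2 k\<close> times a factor
  that is bounded up to time \<open>T\<close>, which gives a uniform bound on the second moments.\<close>

lemma exp_mart_optional_stopping:
  fixes k :: real
  assumes t0: "0 \<le> t0" "t0 < T" and C: "closed C"
  defines "\<sigma> \<equiv> \<lambda>\<omega>. real_of_ereal (min (hitting_time_after X t0 C \<omega>) (ereal T))"
  shows "integrable M (\<lambda>\<omega>. exp_mart k (\<sigma> \<omega>) \<omega>)"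
    and "expectation (\<lambda>\<omega>. exp_mart k (\<sigma> \<omega>) \<omega>) = expectation (exp_mart k t0)"
proof -
  define grid where "grid n j = t0 + (T - t0) * (real j / real (Suc n))" for n j
  define idx where "idx n \<omega> = nat \<lceil>(\<sigma> \<omega> - t0) / (T - t0) * real (Suc n)\<rceil>" for n \<omega>
  define Y where "Y h n \<omega> = exp_mart h (grid n (idx n \<omega>)) \<omega>" for h n \<omega>
  have int: "integrable M (Y h n)" for h n
    unfolding Y_def idx_def grid_def \<sigma>_def by (rule exp_mart_grid_stopping(1)[OF assms(1-3)])
  have mean: "expectation (Y h n) = expectation (exp_mart h t0)" for h n
    unfolding Y_def idx_def grid_def \<sigma>_def by (rule exp_mart_grid_stopping(2)[OF assms(1-3)])
  have range: "t0 \<le> grid n (idx n \<omega>)" "grid n (idx n \<omega>) \<le> T" "t0 \<le> \<sigma> \<omega>" "\<sigma> \<omega> \<le> T"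
    if "\<omega> \<in> space M" for n \<omega>
    unfolding idx_def grid_def \<sigma>_def
    using exp_mart_grid_stopping(3)[OF assms(1-3) that] exp_mart_grid_stopping(4)[OF assms(1-3) that, of n]
    by blast+
  have sq: "(Y k n \<omega>)\<^sup>2 \<le> exp (k\<^sup>2 * T) * Y (2 * k) n \<omega>" if "\<omega> \<in> space M" for n \<omega>
  proof -
    let ?s = "grid n (idx n \<omega>)"
    have "(Y k n \<omega>)\<^sup>2 = exp (k\<^sup>2 * ?s) * Y (2 * k) n \<omega>"
      unfolding Y_def exp_mart_def exp_double[symmetric] exp_add[symmetric]
      by (simp add: power2_eq_square algebra_simps)
    also have "\<dots> \<le> exp (k\<^sup>2 * T) * Y (2 * k) n \<omega>"
      using range(2)[OF that] by (intro mult_right_mono) (auto simp: Y_def exp_mart_def mult_left_mono)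
    finally show ?thesis .
  qed
  have [measurable]: "Y h n \<in> borel_measurable M" for h n using int by auto
  have int2: "integrable M (\<lambda>\<omega>. (Y k n \<omega>)\<^sup>2)" for n
  proof (rule Bochner_Integration.integrable_bound)
    show "integrable M (\<lambda>\<omega>. exp (k\<^sup>2 * T) * Y (2 * k) n \<omega>)" using int by simp
    show "AE \<omega> in M. norm ((Y k n \<omega>)\<^sup>2) \<le> norm (exp (k\<^sup>2 * T) * Y (2 * k) n \<omega>)"
      by (rule AE_I2) (use sq in \<open>auto intro: order_trans[OF _ abs_ge_self]\<close>)
  qed measurable
  have bound: "expectation (\<lambda>\<omega>. (Y k n \<omega>)\<^sup>2) \<le> exp (k\<^sup>2 * T) * expectation (exp_mart (2 * k) t0)" for n
  proof -
    have "expectation (\<lambda>\<omega>. (Y k n \<omega>)\<^sup>2) \<le> expectation (\<lambda>\<omega>. exp (k\<^sup>2 * T) * Y (2 * k) n \<omega>)"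
      using int2 int sq by (intro integral_mono) auto
    then show ?thesis by (simp add: mean)
  qed
  have lim: "(\<lambda>n. Y k n \<omega>) \<longlonglongrightarrow> exp_mart k (\<sigma> \<omega>) \<omega>" if "\<omega> \<in> space M" for \<omega>
  proof -
    have "(\<lambda>n. grid n (idx n \<omega>)) \<longlonglongrightarrow> t0 + (T - t0) * ((\<sigma> \<omega> - t0) / (T - t0))"
      unfolding grid_def idx_def using range(3)[OF that] t0
      by (intro tendsto_add tendsto_mult tendsto_const grid_floor_tendsto) auto
    then have g: "(\<lambda>n. grid n (idx n \<omega>)) \<longlonglongrightarrow> \<sigma> \<omega>" using t0 by simp
    have "(\<lambda>n. X (grid n (idx n \<omega>)) \<omega>) \<longlonglongrightarrow> X (\<sigma> \<omega>) \<omega>"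
      using range[OF that] t0 by (intro path_tendsto[OF that g]) (auto intro: order_trans)
    with g show ?thesis unfolding Y_def exp_mart_def by (intro tendsto_intros) simp_all
  qed
  note L2 = integral_tendsto_of_L2_bounded[where Y = "Y k" and Z = "\<lambda>\<omega>. exp_mart k (\<sigma> \<omega>) \<omega>"
      and e = "expectation (exp_mart k t0)"
      and C = "exp (k\<^sup>2 * T) * expectation (exp_mart (2 * k) t0)"]
  show "integrable M (\<lambda>\<omega>. exp_mart k (\<sigma> \<omega>) \<omega>)"
    by (rule L2(1)) (use int int2 lim mean bound in \<open>auto simp: Y_def exp_mart_def\<close>)
  show "expectation (\<lambda>\<omega>. exp_mart k (\<sigma> \<omega>) \<omega>) = expectation (exp_mart k t0)"
    by (rule L2(2)) (use int int2 lim mean bound in \<open>auto simp: Y_def exp_mart_def\<close>)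
qed

lemma exit_through_frontier:
  assumes \<omega>: "\<omega> \<in> space M" and t: "0 \<le> t0" "t0 \<le> t" and X: "X t0 \<omega> \<in> U" "X t \<omega> \<notin> U"
  obtains s where "t0 \<le> s" "s \<le> t" "X s \<omega> \<in> frontier U"
proof -
  have "continuous_on {t0..t} (\<lambda>s. X s \<omega>)"
    using t by (intro continuous_path_subset \<omega>) auto
  then have "connected ((\<lambda>s. X s \<omega>) ` {t0..t})"
    by (rule connected_continuous_image) simp
  then have "(\<lambda>s. X s \<omega>) ` {t0..t} \<inter> frontier U \<noteq> {}"
  proof (rule connected_Int_frontier)
    have "X t0 \<omega> \<in> (\<lambda>s. X s \<omega>) ` {t0..t}" "X t \<omega> \<in> (\<lambda>s. X s \<omega>) ` {t0..t}"
      using t by (auto intro!: imageI[of _ _ "\<lambda>s. X s \<omega>"])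
    then show "(\<lambda>s. X s \<omega>) ` {t0..t} \<inter> U \<noteq> {}" "(\<lambda>s. X s \<omega>) ` {t0..t} - U \<noteq> {}"
      using X by blast+
  qed
  then show ?thesis by (auto intro: that)
qed

text \<open>A path that starts in \<open>U\<close> can leave \<open>U\<close> only through the frontier, which belongs to \<open>R\<close>.\<close>

lemma hitting_time_after_component:
  assumes \<omega>: "\<omega> \<in> space M" and t0: "0 \<le> t0" and X: "X t0 \<omega> \<in> U"
    and U: "frontier U \<subseteq> R" "R \<inter> U = {}"
  shows "hitting_time_after X t0 R \<omega> = hitting_time_after X t0 (- U) \<omega>"
  unfolding hitting_time_after_def
proof (rule antisym)
  show "Inf (ereal ` {t. t0 \<le> t \<and> X t \<omega> \<in> R}) \<le> Inf (ereal ` {t. t0 \<le> t \<and> X t \<omega> \<in> - U})"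
  proof (rule Inf_mono)
    fix b assume "b \<in> ereal ` {t. t0 \<le> t \<and> X t \<omega> \<in> - U}"
    then obtain t where t: "b = ereal t" "t0 \<le> t" "X t \<omega> \<notin> U" by auto
    obtain s where "t0 \<le> s" "s \<le> t" "X s \<omega> \<in> frontier U"
      by (rule exit_through_frontier[OF \<omega> t0 t(2) X t(3)])
    with t U show "\<exists>a\<in>ereal ` {t. t0 \<le> t \<and> X t \<omega> \<in> R}. a \<le> b" by auto
  qed
  show "Inf (ereal ` {t. t0 \<le> t \<and> X t \<omega> \<in> - U}) \<le> Inf (ereal ` {t. t0 \<le> t \<and> X t \<omega> \<in> R})"
    using U by (intro Inf_superset_mono image_mono) auto
qed

text \<open>The combination of the two exponential martingales is \<open>exp (- k\<^sup>2 t / 2) v (X\<^sub>t)\<close> as long as the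
  path stays in the closure of \<open>U\<close>. Optional stopping applies up to a finite horizon; when the
  horizon tends to infinity, \<open>v\<close> being bounded on the closure gives bounded convergence, and paths
  that never leave \<open>U\<close> contribute nothing in the limit. The indicator allows a random position at
  time \<open>t0\<close>.\<close>

lemma exit_identity:
  fixes v :: "real \<Rightarrow> real" and k \<alpha> \<gamma> K t0 :: real
  assumes t0: "0 \<le> t0" and k: "0 < k" and U: "open U" "frontier U \<subseteq> R" "R \<inter> U = {}"
    and v: "\<And>y. y \<in> closure U \<Longrightarrow> v y = \<alpha> * exp (k * y) + \<gamma> * exp (- k * y)"
    and K: "\<And>y. y \<in> closure U \<Longrightarrow> \<bar>v y\<bar> \<le> K"
  defines "Q \<equiv> \<lambda>\<omega>. indicator U (X t0 \<omega>)
      * discounted_reward X (\<lambda>t. exp (- (k\<^sup>2 / 2 * t))) v (hitting_time_after X t0 R) \<omega>"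
    and "V \<equiv> \<lambda>\<omega>. indicator U (X t0 \<omega>) * v (X t0 \<omega>)"
  shows "integrable M Q" and "integrable M V"
    and "expectation Q = exp (- (k\<^sup>2 / 2 * t0)) * expectation V"
proof -
  define lam where "lam = k\<^sup>2 / 2"
  define \<tau> where "\<tau> = hitting_time_after X t0 (- U)"
  define \<sigma> where "\<sigma> n \<omega> = real_of_ereal (min (\<tau> \<omega>) (ereal (t0 + real (Suc n))))" for n \<omega>
  define G where "G t \<omega> = \<alpha> * exp_mart k t \<omega> + \<gamma> * exp_mart (- k) t \<omega>" for t \<omega>
  define I where "I \<omega> = (indicator U (X t0 \<omega>) :: real)" for \<omega>
  have C: "closed (- U)" using U by auto
  have [measurable]: "X t0 \<in> borel_measurable M" using t0 by (rule measurable_X)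
  have [measurable]: "U \<in> sets borel" using U by auto
  have [measurable]: "I \<in> borel_measurable M" unfolding I_def[abs_def] by measurable
  have G_eq: "G t \<omega> = exp (- (lam * t)) * v (X t \<omega>)" if "X t \<omega> \<in> closure U" for t \<omega>
    unfolding v[OF that] G_def exp_mart_def lam_def
    by (simp add: algebra_simps exp_add[symmetric] exp_diff exp_minus field_simps)
  have stop: "integrable M (\<lambda>\<omega>. G (\<sigma> n \<omega>) \<omega>)" "expectation (\<lambda>\<omega>. G (\<sigma> n \<omega>) \<omega>) = expectation (G t0)"
    and intG0: "integrable M (G t0)" for n
  proof -
    have *: "integrable M (\<lambda>\<omega>. exp_mart h (\<sigma> n \<omega>) \<omega>)"
      "expectation (\<lambda>\<omega>. exp_mart h (\<sigma> n \<omega>) \<omega>) = expectation (exp_mart h t0)" for h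
      unfolding \<sigma>_def \<tau>_def by (rule exp_mart_optional_stopping[OF t0 _ C]; simp)+
    have i: "integrable M (exp_mart h t0)" for h using t0 by (rule integrable_exp_mart)
    show "integrable M (\<lambda>\<omega>. G (\<sigma> n \<omega>) \<omega>)" "expectation (\<lambda>\<omega>. G (\<sigma> n \<omega>) \<omega>) = expectation (G t0)"
      "integrable M (G t0)"
      unfolding G_def[abs_def] using * i by (auto simp del: of_nat_Suc)
  qed
  have outside: "\<sigma> n \<omega> = t0" if "\<omega> \<in> space M" "X t0 \<omega> \<notin> U" for n \<omega>
  proof -
    have "\<tau> \<omega> = ereal t0"
      unfolding \<tau>_def by (rule hitting_time_after_cases[OF that(1) t0 C]) (use that in \<open>force+\<close>)
    then show ?thesis by (simp add: \<sigma>_def)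
  qed
  have IG: "I \<omega> * G (\<sigma> n \<omega>) \<omega> = G (\<sigma> n \<omega>) \<omega> - G t0 \<omega> + I \<omega> * G t0 \<omega>" if "\<omega> \<in> space M" for n \<omega>
    using outside[OF that] by (cases "X t0 \<omega> \<in> U") (auto simp: I_def)
  have V_eq: "I \<omega> * G t0 \<omega> = exp (- (lam * t0)) * V \<omega>" for \<omega>
    using G_eq[of t0 \<omega>] closure_subset[of U] by (auto simp: I_def V_def indicator_def)
  have intIG0: "integrable M (\<lambda>\<omega>. I \<omega> * G t0 \<omega>)"
  proof -
    have [measurable]: "G t0 \<in> borel_measurable M" using intG0 by auto
    show ?thesis
      using intG0 by (rule Bochner_Integration.integrable_bound) (measurable, auto simp: I_def indicator_def)
  qed
  have intIG: "integrable M (\<lambda>\<omega>. I \<omega> * G (\<sigma> n \<omega>) \<omega>)"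
    and mean: "expectation (\<lambda>\<omega>. I \<omega> * G (\<sigma> n \<omega>) \<omega>) = exp (- (lam * t0)) * expectation V" for n
  proof -
    have "integrable M (\<lambda>\<omega>. G (\<sigma> n \<omega>) \<omega> - G t0 \<omega> + I \<omega> * G t0 \<omega>)"
      using stop intG0 intIG0 by auto
    then show "integrable M (\<lambda>\<omega>. I \<omega> * G (\<sigma> n \<omega>) \<omega>)"
      by (subst Bochner_Integration.integrable_cong[OF refl IG]) auto
    have "expectation (\<lambda>\<omega>. I \<omega> * G (\<sigma> n \<omega>) \<omega>) = expectation (\<lambda>\<omega>. G (\<sigma> n \<omega>) \<omega> - G t0 \<omega> + I \<omega> * G t0 \<omega>)"
      by (rule Bochner_Integration.integral_cong[OF refl IG])
    also have "\<dots> = expectation (\<lambda>\<omega>. I \<omega> * G t0 \<omega>)"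
      using stop intG0 intIG0 by simp
    finally show "expectation (\<lambda>\<omega>. I \<omega> * G (\<sigma> n \<omega>) \<omega>) = exp (- (lam * t0)) * expectation V"
      by (simp add: V_eq)
  qed
  have "integrable M (\<lambda>\<omega>. exp (lam * t0) * (I \<omega> * G t0 \<omega>))" using intIG0 by simp
  also have "(\<lambda>\<omega>. exp (lam * t0) * (I \<omega> * G t0 \<omega>)) = V"
    unfolding V_eq mult.assoc[symmetric] exp_add[symmetric] by simp
  finally show "integrable M V" .
  have K0: "0 \<le> K" if "y \<in> U" for y
    using K[of y] that closure_subset[of U] by force
  have limit: "(\<lambda>n. I \<omega> * G (\<sigma> n \<omega>) \<omega>) \<longlonglongrightarrow> Q \<omega>"
    and bounded: "\<bar>I \<omega> * G (\<sigma> n \<omega>) \<omega>\<bar> \<le> \<bar>K\<bar>" if \<omega>: "\<omega> \<in> space M" for n \<omega>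
  proof -
    have "(\<lambda>n. I \<omega> * G (\<sigma> n \<omega>) \<omega>) \<longlonglongrightarrow> Q \<omega> \<and> (\<forall>n. \<bar>I \<omega> * G (\<sigma> n \<omega>) \<omega>\<bar> \<le> \<bar>K\<bar>)"
    proof (cases "X t0 \<omega> \<in> U")
      case False
      then show ?thesis by (simp add: I_def Q_def)
    next
      case True
      have \<tau>_eq: "hitting_time_after X t0 R \<omega> = \<tau> \<omega>"
        unfolding \<tau>_def by (rule hitting_time_after_component[OF \<omega> t0 True U(2,3)])
      have small: "\<bar>exp (- (lam * t)) * v (X t \<omega>)\<bar> \<le> exp (- (lam * t)) * K"
        if "X t \<omega> \<in> closure U" for t
        using K[OF that] by (simp add: abs_mult)
      have le1: "exp (- (lam * t)) * K \<le> \<bar>K\<bar>" if "t0 \<le> t" for t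
        using that t0 K0[OF True] by (auto simp: lam_def intro!: mult_left_le_one_le)
      show ?thesis
      proof (rule hitting_time_after_cases[OF \<omega> t0 C])
        assume inf: "hitting_time_after X t0 (- U) \<omega> = \<infinity>" and no: "\<And>t. t0 \<le> t \<Longrightarrow> X t \<omega> \<notin> - U"
        then have \<sigma>: "\<sigma> n \<omega> = t0 + real (Suc n)" for n by (simp add: \<sigma>_def \<tau>_def)
        have cl: "X (\<sigma> n \<omega>) \<omega> \<in> closure U" for n
          using no[of "\<sigma> n \<omega>"] closure_subset[of U] \<sigma> by auto
        have *: "\<bar>I \<omega> * G (\<sigma> n \<omega>) \<omega>\<bar> \<le> exp (- (lam * (t0 + real (Suc n)))) * K" for n
          using small[OF cl[of n]] True unfolding G_eq[OF cl[of n]] by (simp add: I_def \<sigma>)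
        have "(\<lambda>n. exp (- (lam * (t0 + real (Suc n)))) * K) \<longlonglongrightarrow> 0"
        proof -
          have "0 < lam" using k by (simp add: lam_def)
          have "filterlim (\<lambda>n. lam * (t0 + real (Suc n))) at_top sequentially"
            by (intro filterlim_tendsto_pos_mult_at_top[OF tendsto_const \<open>0 < lam\<close>]
                filterlim_tendsto_add_at_top[OF tendsto_const]
                filterlim_compose[OF filterlim_real_sequentially filterlim_Suc])
          then have "(\<lambda>n. exp (- (lam * (t0 + real (Suc n))))) \<longlonglongrightarrow> 0"
            by (intro filterlim_compose[OF exp_at_bot] filterlim_compose[OF filterlim_uminus_at_bot_at_top])
          then show ?thesis by (rule tendsto_mult_left_zero)
        qed
        then have "(\<lambda>n. I \<omega> * G (\<sigma> n \<omega>) \<omega>) \<longlonglongrightarrow> 0"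
          by (rule Lim_null_comparison[rotated]) (use * in auto)
        moreover have "Q \<omega> = 0"
          using \<tau>_eq inf by (simp add: Q_def discounted_reward_def \<tau>_def)
        ultimately show ?thesis
          using order_trans[OF * le1] by auto
      next
        fix s assume hit: "hitting_time_after X t0 (- U) \<omega> = ereal s" and s: "t0 \<le> s" "X s \<omega> \<in> - U"
          and before: "\<And>t. t0 \<le> t \<Longrightarrow> t < s \<Longrightarrow> X t \<omega> \<notin> - U"
        obtain r where r: "t0 \<le> r" "r \<le> s" "X r \<omega> \<in> frontier U"
          by (rule exit_through_frontier[OF \<omega> t0 s(1) True]) (use s in auto)
        have "X r \<omega> \<notin> U" using r U by auto
        then have "r = s" using before[of r] r by (cases "r < s") auto
        then have cl_s: "X s \<omega> \<in> closure U" using r by (simp add: frontier_def)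
        have cl: "X t \<omega> \<in> closure U" if "t0 \<le> t" "t \<le> s" for t
          using before[of t] cl_s closure_subset[of U] that by (cases "t < s") auto
        have \<sigma>: "\<sigma> n \<omega> = min s (t0 + real (Suc n))" for n
          unfolding \<sigma>_def \<tau>_def hit
          by (cases "s \<le> t0 + real (Suc n)") (simp_all add: min_def del: of_nat_Suc)
        then have \<sigma>_range: "t0 \<le> \<sigma> n \<omega>" "\<sigma> n \<omega> \<le> s" for n using s by auto
        have "\<bar>I \<omega> * G (\<sigma> n \<omega>) \<omega>\<bar> \<le> \<bar>K\<bar>" for n
          using small[OF cl[OF \<sigma>_range[of n]]] le1[OF \<sigma>_range(1)[of n]] True
          unfolding G_eq[OF cl[OF \<sigma>_range[of n]]] by (simp add: I_def)
        moreover have "(\<lambda>n. I \<omega> * G (\<sigma> n \<omega>) \<omega>) \<longlonglongrightarrow> Q \<omega>"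
        proof (rule tendsto_eventually)
          have Q: "Q \<omega> = I \<omega> * G s \<omega>"
            unfolding Q_def discounted_reward_def \<tau>_eq unfolding \<tau>_def hit
            by (simp add: G_eq[OF cl_s] I_def lam_def)
          have "eventually (\<lambda>n. \<sigma> n \<omega> = s) sequentially"
          proof -
            obtain N where "s - t0 < real N" using reals_Archimedean2 by blast
            then have "\<sigma> n \<omega> = s" if "N \<le> n" for n
              using that unfolding \<sigma> by (auto simp: min_def)
            then show ?thesis by (auto simp: eventually_sequentially)
          qed
          then show "eventually (\<lambda>n. I \<omega> * G (\<sigma> n \<omega>) \<omega> = Q \<omega>) sequentially"
            by eventually_elim (simp add: Q)
        qed
        ultimately show ?thesis by auto
      qed
    qed
    then show "(\<lambda>n. I \<omega> * G (\<sigma> n \<omega>) \<omega>) \<longlonglongrightarrow> Q \<omega>" "\<bar>I \<omega> * G (\<sigma> n \<omega>) \<omega>\<bar> \<le> \<bar>K\<bar>" by auto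
  qed
  have [measurable]: "(\<lambda>\<omega>. I \<omega> * G (\<sigma> n \<omega>) \<omega>) \<in> borel_measurable M" for n
    using intIG by auto
  have [measurable]: "Q \<in> borel_measurable M"
    by (rule borel_measurable_LIMSEQ_real[OF limit]) auto
  note dct = integral_dominated_convergence[where M = M and f = Q
      and s = "\<lambda>n \<omega>. I \<omega> * G (\<sigma> n \<omega>) \<omega>" and w = "\<lambda>_. \<bar>K\<bar>"]
    integrable_dominated_convergence[where M = M and f = Q
      and s = "\<lambda>n \<omega>. I \<omega> * G (\<sigma> n \<omega>) \<omega>" and w = "\<lambda>_. \<bar>K\<bar>"]
  show "integrable M Q"
    by (rule dct(2)) (use limit bounded in auto)
  have "(\<lambda>n. expectation (\<lambda>\<omega>. I \<omega> * G (\<sigma> n \<omega>) \<omega>)) \<longlonglongrightarrow> expectation Q"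
    by (rule dct(1)) (use limit bounded in auto)
  then have "expectation Q = exp (- (lam * t0)) * expectation V"
    unfolding mean by (simp add: LIMSEQ_const_iff)
  then show "expectation Q = exp (- (k\<^sup>2 / 2 * t0)) * expectation V"
    by (simp add: lam_def)
qed

end

section \<open>Exponentially discounted rewards\<close>

lemma sum_indicator_disjoint:
  assumes "finite \<U>" "disjoint \<U>"
  shows "(\<Sum>U\<in>\<U>. indicator U y) = (indicator (\<Union>\<U>) y :: real)"
proof (cases "y \<in> \<Union>\<U>")
  case True
  then obtain V where V: "V \<in> \<U>" "y \<in> V" by auto
  have "indicator U y = (if U = V then 1 else 0 :: real)" if "U \<in> \<U>" for U
    using disjointD[OF assms(2) that V(1)] V(2) by (auto simp: indicator_def)
  then have "(\<Sum>U\<in>\<U>. indicator U y) = (\<Sum>U\<in>\<U>. if U = V then 1 else 0 :: real)" by (rule sum.cong[OF refl])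
  also have "\<dots> = 1" using assms(1) V(1) by (simp add: sum.delta)
  finally show ?thesis using True by simp
next
  case False
  then show ?thesis by (auto simp: indicator_def intro!: sum.neutral)
qed

context brownian_motion
begin

text \<open>On different pieces of the complement of \<open>R\<close> the function \<open>v\<close> may be different combinations of
  the two exponentials. Paths that are in \<open>R\<close> at time \<open>t0\<close> are stopped at once.\<close>

lemma piecewise_exit_identity:
  fixes v :: "real \<Rightarrow> real" and k K t0 :: real
  assumes t0: "0 \<le> t0" and k: "0 < k"
    and \<U>: "finite \<U>" "disjoint \<U>" "\<And>U. U \<in> \<U> \<Longrightarrow> open U" "\<Union>\<U> = - R"
    and v: "\<And>U. U \<in> \<U> \<Longrightarrow> \<exists>\<alpha> \<gamma>. \<forall>y\<in>closure U. v y = \<alpha> * exp (k * y) + \<gamma> * exp (- k * y)"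
    and K: "\<And>y. \<bar>v y\<bar> \<le> K" and v_meas [measurable]: "v \<in> borel_measurable borel"
  shows "expectation (discounted_reward X (\<lambda>t. exp (- (k\<^sup>2 / 2 * t))) v (hitting_time_after X t0 R))
    = exp (- (k\<^sup>2 / 2 * t0)) * expectation (\<lambda>\<omega>. v (X t0 \<omega>))"
proof -
  define Z where "Z = discounted_reward X (\<lambda>t. exp (- (k\<^sup>2 / 2 * t))) v (hitting_time_after X t0 R)"
  define e where "e = exp (- (k\<^sup>2 / 2 * t0))"
  have [measurable]: "X t0 \<in> borel_measurable M" using t0 by (rule measurable_X)
  have "open (- R)" using \<U>(3) unfolding \<U>(4)[symmetric] by auto
  then have R: "closed R" by (simp add: closed_def)
  then have [measurable]: "R \<in> sets borel" by auto
  have U: "integrable M (\<lambda>\<omega>. indicator U (X t0 \<omega>) * Z \<omega>)"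
    "integrable M (\<lambda>\<omega>. indicator U (X t0 \<omega>) * v (X t0 \<omega>))"
    "expectation (\<lambda>\<omega>. indicator U (X t0 \<omega>) * Z \<omega>) = e * expectation (\<lambda>\<omega>. indicator U (X t0 \<omega>) * v (X t0 \<omega>))"
    if "U \<in> \<U>" for U
  proof -
    obtain \<alpha> \<gamma> where vU: "\<And>y. y \<in> closure U \<Longrightarrow> v y = \<alpha> * exp (k * y) + \<gamma> * exp (- k * y)"
      using v[OF \<open>U \<in> \<U>\<close>] by auto
    have "frontier U \<subseteq> R"
    proof -
      have "y \<in> R" if "y \<in> frontier U" for y
      proof (rule ccontr)
        assume "y \<notin> R"
        then obtain V where V: "V \<in> \<U>" "y \<in> V" using \<U>(4) by auto
        have "y \<notin> U" using that \<U>(3)[OF \<open>U \<in> \<U>\<close>] by (auto simp: frontier_def interior_open)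
        then have "V \<inter> U = {}" using disjointD[OF \<U>(2) V(1) \<open>U \<in> \<U>\<close>] V by auto
        then have "V \<inter> closure U = {}" using \<U>(3)[OF V(1)] by (simp add: open_Int_closure_eq_empty)
        then show False using V that by (auto simp: frontier_def)
      qed
      then show ?thesis by auto
    qed
    moreover have "R \<inter> U = {}" using \<U>(4) that by auto
    ultimately show "integrable M (\<lambda>\<omega>. indicator U (X t0 \<omega>) * Z \<omega>)"
    "integrable M (\<lambda>\<omega>. indicator U (X t0 \<omega>) * v (X t0 \<omega>))"
    "expectation (\<lambda>\<omega>. indicator U (X t0 \<omega>) * Z \<omega>) = e * expectation (\<lambda>\<omega>. indicator U (X t0 \<omega>) * v (X t0 \<omega>))"
      using exit_identity[OF t0 k \<U>(3)[OF that] _ _ vU K, of R] unfolding Z_def e_def by simp_all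
  qed
  have split: "g = (\<Sum>U\<in>\<U>. indicator U y * g) + indicator R y * g" for y g :: real
  proof -
    have "(\<Sum>U\<in>\<U>. indicator U y * g) + indicator R y * g = (indicator (- R) y + indicator R y) * g"
      by (simp only: sum_distrib_right[symmetric] sum_indicator_disjoint[OF \<U>(1,2)] \<U>(4) distrib_right)
    also have "\<dots> = g" by (simp add: indicator_def)
    finally show ?thesis by simp
  qed
  have on_R: "indicator R (X t0 \<omega>) * Z \<omega> = e * (indicator R (X t0 \<omega>) * v (X t0 \<omega>))" if "\<omega> \<in> space M" for \<omega>
  proof (cases "X t0 \<omega> \<in> R")
    case True
    have "hitting_time_after X t0 R \<omega> = ereal t0"
      by (rule hitting_time_after_cases[OF that t0 R]) (use True in \<open>force+\<close>)
    then show ?thesis by (simp add: Z_def discounted_reward_def e_def)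
  qed simp
  have intR: "integrable M (\<lambda>\<omega>. indicator R (X t0 \<omega>) * v (X t0 \<omega>))"
  proof (rule integrable_const_bound[where B = K])
    have "\<bar>indicator R y * v y\<bar> \<le> K" for y
      using K[of y] by (auto simp: indicator_def)
    then show "AE \<omega> in M. norm (indicator R (X t0 \<omega>) * v (X t0 \<omega>)) \<le> K" by simp
  qed measurable
  have intRZ: "integrable M (\<lambda>\<omega>. indicator R (X t0 \<omega>) * Z \<omega>)"
    using intR by (subst Bochner_Integration.integrable_cong[OF refl on_R]) auto
  have lin: "expectation (\<lambda>\<omega>. (\<Sum>U\<in>\<U>. F U \<omega>) + r \<omega>) = (\<Sum>U\<in>\<U>. expectation (F U)) + expectation r"
    if "\<And>U. U \<in> \<U> \<Longrightarrow> integrable M (F U)" "integrable M r" for F :: "real set \<Rightarrow> 'w \<Rightarrow> real" and r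
    by (simp only: Bochner_Integration.integral_add[OF Bochner_Integration.integrable_sum[OF that(1)] that(2)]
        Bochner_Integration.integral_sum[OF that(1)])
  have "expectation Z = expectation (\<lambda>\<omega>. (\<Sum>U\<in>\<U>. indicator U (X t0 \<omega>) * Z \<omega>) + indicator R (X t0 \<omega>) * Z \<omega>)"
    by (rule Bochner_Integration.integral_cong[OF refl split])
  also have "\<dots> = (\<Sum>U\<in>\<U>. expectation (\<lambda>\<omega>. indicator U (X t0 \<omega>) * Z \<omega>)) + expectation (\<lambda>\<omega>. indicator R (X t0 \<omega>) * Z \<omega>)"
    by (rule lin[OF U(1) intRZ])
  also have "(\<Sum>U\<in>\<U>. expectation (\<lambda>\<omega>. indicator U (X t0 \<omega>) * Z \<omega>))
      = (\<Sum>U\<in>\<U>. e * expectation (\<lambda>\<omega>. indicator U (X t0 \<omega>) * v (X t0 \<omega>)))"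
    by (rule sum.cong[OF refl U(3)])
  also have "expectation (\<lambda>\<omega>. indicator R (X t0 \<omega>) * Z \<omega>) = expectation (\<lambda>\<omega>. e * (indicator R (X t0 \<omega>) * v (X t0 \<omega>)))"
    by (rule Bochner_Integration.integral_cong[OF refl on_R])
  also have "\<dots> = e * expectation (\<lambda>\<omega>. indicator R (X t0 \<omega>) * v (X t0 \<omega>))" by simp
  also have "(\<Sum>U\<in>\<U>. e * expectation (\<lambda>\<omega>. indicator U (X t0 \<omega>) * v (X t0 \<omega>)))
        + e * expectation (\<lambda>\<omega>. indicator R (X t0 \<omega>) * v (X t0 \<omega>))
      = e * expectation (\<lambda>\<omega>. (\<Sum>U\<in>\<U>. indicator U (X t0 \<omega>) * v (X t0 \<omega>)) + indicator R (X t0 \<omega>) * v (X t0 \<omega>))"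
    by (simp only: lin[OF U(2) intR] sum_distrib_left distrib_left)
  also have "expectation (\<lambda>\<omega>. (\<Sum>U\<in>\<U>. indicator U (X t0 \<omega>) * v (X t0 \<omega>)) + indicator R (X t0 \<omega>) * v (X t0 \<omega>))
      = expectation (\<lambda>\<omega>. v (X t0 \<omega>))"
    by (rule Bochner_Integration.integral_cong[OF refl split[symmetric]])
  finally show ?thesis by (simp add: Z_def e_def)
qed

lemma hitting_times_tendsto:
  "(\<lambda>n. hitting_time_after X (1 / real (Suc n)) C \<omega>) \<longlonglongrightarrow> hitting_time X C \<omega>"
  unfolding hitting_time_eq_INF
proof (rule LIMSEQ_INF)
  show "decseq (\<lambda>n. hitting_time_after X (1 / real (Suc n)) C \<omega>)"
    unfolding hitting_time_after_def
  proof (intro decseq_SucI Inf_superset_mono image_mono subsetI)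
    fix n t assume "t \<in> {t. 1 / real (Suc n) \<le> t \<and> X t \<omega> \<in> C}"
    moreover have "1 / real (Suc (Suc n)) \<le> 1 / real (Suc n)" by (intro divide_left_mono) auto
    ultimately show "t \<in> {t. 1 / real (Suc (Suc n)) \<le> t \<and> X t \<omega> \<in> C}" by auto
  qed
qed

text \<open>The identity is applied from time \<open>1 / (n + 1)\<close> on and \<open>n\<close> tends to infinity. This treats all
  starting points alike; for \<open>x = b\<close> the result says that Brownian motion returns to its starting
  point immediately.\<close>

lemma hitting_time_laplace:
  assumes k: "0 < k"
  shows "expectation (discounted_reward X (\<lambda>t. exp (- (k\<^sup>2 / 2 * t))) (\<lambda>_. 1) (hitting_time X {b}))
    = exp (- (k * \<bar>x - b\<bar>))"
proof -
  define lam where "lam = k\<^sup>2 / 2"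
  define v where "v y = exp (- (k * \<bar>y - b\<bar>))" for y
  define \<tau> where "\<tau> n = hitting_time_after X (1 / real (Suc n)) {b}" for n
  define Z where "Z n = discounted_reward X (\<lambda>t. exp (- (lam * t))) v (\<tau> n)" for n
  have [measurable]: "v \<in> borel_measurable borel" unfolding v_def by measurable
  have v1: "0 \<le> v y" "v y \<le> 1" for y using k by (auto simp: v_def)
  have t0: "0 \<le> 1 / real (Suc n)" for n by simp
  have \<tau>_meas [measurable]: "\<tau> n \<in> borel_measurable M" for n
    unfolding \<tau>_def by (rule measurable_hitting_time_after) auto
  have \<tau>_ge: "0 \<le> \<tau> n \<omega>" if "\<omega> \<in> space M" for n \<omega>
    using hitting_time_after_ge[OF that t0, of "{b}" n] unfolding \<tau>_def
    by (rule order_trans[rotated]) auto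
  have [measurable]: "Z n \<in> borel_measurable M" for n
    unfolding Z_def using \<tau>_ge by (intro measurable_discounted_reward) auto
  have mean: "expectation (Z n) = exp (- (lam * (1 / real (Suc n)))) * expectation (\<lambda>\<omega>. v (X (1 / real (Suc n)) \<omega>))" for n
    unfolding Z_def \<tau>_def lam_def
  proof (rule piecewise_exit_identity[where \<U> = "{{..<b}, {b<..}}" and K = 1, OF t0 k])
    fix U assume "U \<in> {{..<b}, {b<..}}"
    then consider "closure U = {..b}" | "closure U = {b..}" by auto
    then show "\<exists>\<alpha> \<gamma>. \<forall>y\<in>closure U. v y = \<alpha> * exp (k * y) + \<gamma> * exp (- k * y)"
    proof cases
      case 1
      then show ?thesis
        by (intro exI[of _ "exp (- k * b)"] exI[of _ 0]) (auto simp: v_def exp_add[symmetric] algebra_simps)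
    next
      case 2
      then show ?thesis
        by (intro exI[of _ 0] exI[of _ "exp (k * b)"]) (auto simp: v_def exp_add[symmetric] algebra_simps)
    qed
  qed (use v1 in \<open>auto simp: disjoint_def\<close>)
  have lim: "(\<lambda>n. Z n \<omega>) \<longlonglongrightarrow> discounted_reward X (\<lambda>t. exp (- (lam * t))) (\<lambda>_. 1) (hitting_time X {b}) \<omega>"
    if \<omega>: "\<omega> \<in> space M" for \<omega>
  proof -
    have Z: "Z n \<omega> = (if \<tau> n \<omega> = \<infinity> then 0 else exp (- (lam * real_of_ereal (\<tau> n \<omega>))))" for n
      unfolding Z_def discounted_reward_def \<tau>_def
      by (rule hitting_time_after_cases[OF \<omega> t0, of "{b}" n]) (auto simp: v_def)
    have \<tau>: "(\<lambda>n. \<tau> n \<omega>) \<longlonglongrightarrow> hitting_time X {b} \<omega>"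
      unfolding \<tau>_def by (rule hitting_times_tendsto)
    show ?thesis
    proof (cases "hitting_time X {b} \<omega>")
      case (real r)
      have "eventually (\<lambda>n. \<tau> n \<omega> < \<infinity>) sequentially"
        using \<tau> real by (intro order_tendstoD(2)) auto
      moreover have "(\<lambda>n. real_of_ereal (\<tau> n \<omega>)) \<longlonglongrightarrow> r"
        using \<tau> unfolding real by (rule lim_real_of_ereal)
      then have "(\<lambda>n. exp (- (lam * real_of_ereal (\<tau> n \<omega>)))) \<longlonglongrightarrow> exp (- (lam * r))"
        by (intro tendsto_exp tendsto_minus tendsto_mult tendsto_const)
      ultimately have "(\<lambda>n. Z n \<omega>) \<longlonglongrightarrow> exp (- (lam * r))"
        by (subst tendsto_cong) (auto simp: Z elim!: eventually_mono)
      then show ?thesis by (simp add: discounted_reward_def real)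
    next
      case PInf
      have "hitting_time X {b} \<omega> \<le> \<tau> n \<omega>" for n
        unfolding \<tau>_def hitting_time_eq_INF by (rule INF_lower) simp
      then have "\<tau> n \<omega> = \<infinity>" for n using PInf by simp
      then show ?thesis using PInf by (simp add: Z discounted_reward_def)
    next
      case MInf
      then show ?thesis using hitting_time_nonneg[of "{b}" \<omega>] by simp
    qed
  qed
  have Z1: "norm (Z n \<omega>) \<le> 1" if \<omega>: "\<omega> \<in> space M" for n \<omega>
    using v1 \<tau>_ge[OF \<omega>, of n] k
    by (auto simp: Z_def discounted_reward_def lam_def real_of_ereal_pos intro!: mult_le_one)
  have "(\<lambda>n. expectation (Z n)) \<longlonglongrightarrow>
      expectation (discounted_reward X (\<lambda>t. exp (- (lam * t))) (\<lambda>_. 1) (hitting_time X {b}))"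
  proof (rule integral_dominated_convergence[where w = "\<lambda>_. 1"])
    show "discounted_reward X (\<lambda>t. exp (- (lam * t))) (\<lambda>_. 1) (hitting_time X {b}) \<in> borel_measurable M"
      by (intro measurable_discounted_reward measurable_hitting_time hitting_time_nonneg) auto
  qed (use lim Z1 in auto)
  moreover have "(\<lambda>n. expectation (Z n)) \<longlonglongrightarrow> exp (- (lam * 0)) * v x"
  proof -
    have inv: "(\<lambda>n. 1 / real (Suc n)) \<longlonglongrightarrow> 0" by (rule LIMSEQ_Suc[OF lim_1_over_n])
    have "(\<lambda>n. expectation (\<lambda>\<omega>. v (X (1 / real (Suc n)) \<omega>))) \<longlonglongrightarrow> expectation (\<lambda>\<omega>. v (X 0 \<omega>))"
    proof (rule integral_dominated_convergence[where w = "\<lambda>_. 1"])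
      have [measurable]: "X (1 / real (Suc n)) \<in> borel_measurable M" "X 0 \<in> borel_measurable M" for n
        by (auto intro!: measurable_X)
      show "(\<lambda>\<omega>. v (X 0 \<omega>)) \<in> borel_measurable M"
        "(\<lambda>\<omega>. v (X (1 / real (Suc n)) \<omega>)) \<in> borel_measurable M" for n by measurable
      show "AE \<omega> in M. (\<lambda>n. v (X (1 / real (Suc n)) \<omega>)) \<longlonglongrightarrow> v (X 0 \<omega>)"
      proof (rule AE_I2)
        fix \<omega> assume "\<omega> \<in> space M"
        then have "(\<lambda>n. X (1 / real (Suc n)) \<omega>) \<longlonglongrightarrow> X 0 \<omega>"
          by (rule path_tendsto[OF _ inv]) auto
        then show "(\<lambda>n. v (X (1 / real (Suc n)) \<omega>)) \<longlonglongrightarrow> v (X 0 \<omega>)"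
          unfolding v_def by (intro tendsto_intros)
      qed
    qed (use v1 in auto)
    also have "expectation (\<lambda>\<omega>. v (X 0 \<omega>)) = expectation (\<lambda>\<omega>. v x)"
    proof (rule integral_cong_AE)
      have [measurable]: "X 0 \<in> borel_measurable M" by (rule measurable_X) simp
      show "(\<lambda>\<omega>. v (X 0 \<omega>)) \<in> borel_measurable M" by measurable
    qed (use AE_start in \<open>auto elim!: eventually_mono\<close>)
    also have "\<dots> = v x" using prob_space by simp
    finally show ?thesis
      unfolding mean using inv by (intro tendsto_mult tendsto_intros)
  qed
  ultimately show ?thesis
    using LIMSEQ_unique unfolding lam_def v_def by fastforce
qed

text \<open>Since \<open>b \<in> R\<close>, the component of the complement of \<open>R\<close> that contains \<open>x\<close> lies on one side of \<open>b\<close>,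
  and there \<open>exp (- k \<bar>y - b\<bar>)\<close> is a single exponential.\<close>

lemma laplace_before_point:
  assumes k: "0 < k" and R: "closed R" "b \<in> R" "x \<notin> R"
  shows "expectation (discounted_reward X (\<lambda>t. exp (- (k\<^sup>2 / 2 * t))) (\<lambda>y. exp (- (k * \<bar>y - b\<bar>))) (hitting_time X R))
    = exp (- (k * \<bar>x - b\<bar>))"
proof -
  define U where "U = connected_component_set (- R) x"
  define v where "v y = exp (- (k * \<bar>y - b\<bar>))" for y
  have [measurable]: "v \<in> borel_measurable borel" unfolding v_def by measurable
  have x: "x \<in> U" using R by (simp add: U_def)
  have sub: "U \<subseteq> - R" unfolding U_def by (rule connected_component_subset)
  have "U \<in> components (- R)" unfolding U_def using R by (intro componentsI) auto
  then have fr: "frontier U \<subseteq> R" by (rule frontier_of_components_closed_complement[OF R(1)])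
  have op: "open U" unfolding U_def using R by (intro open_connected_component) auto
  have conn: "connected U" unfolding U_def by simp
  have "b \<notin> U" using sub R by auto
  \<comment> \<open>a connected set of reals that misses \<open>b\<close> cannot have points on both sides\<close>
  then have sides: "(\<forall>y\<in>U. y \<le> b) \<or> (\<forall>y\<in>U. b \<le> y)"
    using conn unfolding connected_iff_interval by (meson linear)
  obtain \<alpha> \<gamma> where v: "\<And>y. y \<in> closure U \<Longrightarrow> v y = \<alpha> * exp (k * y) + \<gamma> * exp (- k * y)"
    using sides
  proof
    assume "\<forall>y\<in>U. y \<le> b"
    then have "closure U \<subseteq> {..b}" by (intro closure_minimal) auto
    then have "v y = exp (- k * b) * exp (k * y) + 0 * exp (- k * y)" if "y \<in> closure U" for y
      using that by (auto simp: v_def exp_add[symmetric] algebra_simps)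
    then show ?thesis by (rule that)
  next
    assume "\<forall>y\<in>U. b \<le> y"
    then have "closure U \<subseteq> {b..}" by (intro closure_minimal) auto
    then have "v y = 0 * exp (k * y) + exp (k * b) * exp (- k * y)" if "y \<in> closure U" for y
      using that by (auto simp: v_def exp_add[symmetric] algebra_simps)
    then show ?thesis by (rule that)
  qed
  have v1: "\<bar>v y\<bar> \<le> 1" for y using k by (simp add: v_def)
  note E = exit_identity[OF order_refl k op fr _ v v1]
  have RU: "R \<inter> U = {}" using sub by auto
  have [measurable]: "X 0 \<in> borel_measurable M" by (rule measurable_X) simp
  have [measurable]: "U \<in> sets borel" using op by auto
  have [measurable]: "hitting_time X R \<in> borel_measurable M" "hitting_time_after X 0 R \<in> borel_measurable M"
    using R by (auto intro: measurable_hitting_time measurable_hitting_time_after)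
  have m: "discounted_reward X (\<lambda>t. exp (- (k\<^sup>2 / 2 * t))) v (hitting_time X R) \<in> borel_measurable M"
    "discounted_reward X (\<lambda>t. exp (- (k\<^sup>2 / 2 * t))) v (hitting_time_after X 0 R) \<in> borel_measurable M"
    using hitting_time_nonneg hitting_time_after_ge[OF _ order_refl R(1)]
    by (auto intro!: measurable_discounted_reward simp: zero_ereal_def)
  have "expectation (discounted_reward X (\<lambda>t. exp (- (k\<^sup>2 / 2 * t))) v (hitting_time X R))
      = expectation (\<lambda>\<omega>. indicator U (X 0 \<omega>) * discounted_reward X (\<lambda>t. exp (- (k\<^sup>2 / 2 * t))) v (hitting_time_after X 0 R) \<omega>)"
  proof (rule integral_cong_AE)
    show "AE \<omega> in M. discounted_reward X (\<lambda>t. exp (- (k\<^sup>2 / 2 * t))) v (hitting_time X R) \<omega>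
        = indicator U (X 0 \<omega>) * discounted_reward X (\<lambda>t. exp (- (k\<^sup>2 / 2 * t))) v (hitting_time_after X 0 R) \<omega>"
      using AE_hitting_time_outside[OF R(3)]
      by eventually_elim (use x in \<open>simp add: discounted_reward_def\<close>)
  qed (use m in measurable)
  also have "\<dots> = expectation (\<lambda>\<omega>. indicator U (X 0 \<omega>) * v (X 0 \<omega>))"
    using E(3)[OF RU] by simp
  also have "\<dots> = expectation (\<lambda>\<omega>. v x)"
    by (rule integral_cong_AE) (use AE_start x in \<open>auto elim!: eventually_mono\<close>)
  also have "\<dots> = v x" using prob_space by simp
  finally show ?thesis unfolding v_def .
qed

end

section \<open>Hyperbolically discounted rewards\<close>

context brownian_motion
begin

lemma discount_fubini:
  fixes g :: "real \<Rightarrow> real \<Rightarrow> real"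
  assumes \<tau> [measurable]: "\<tau> \<in> borel_measurable M" and nonneg: "\<And>\<omega>. \<omega> \<in> space M \<Longrightarrow> 0 \<le> \<tau> \<omega>"
    and g: "(\<lambda>p. g (fst p) (snd p)) \<in> borel_measurable (borel \<Otimes>\<^sub>M borel)"
    and K: "\<And>s y. 0 < s \<Longrightarrow> \<bar>g s y\<bar> \<le> K" and \<beta>: "0 < \<beta>"
  shows "expectation (\<lambda>\<omega>. \<integral>s. discounted_reward X (\<lambda>t. exp (- (\<beta> * s * t))) (g s) \<tau> \<omega> \<partial>exp_law)
      = (\<integral>s. expectation (discounted_reward X (\<lambda>t. exp (- (\<beta> * s * t))) (g s) \<tau>) \<partial>exp_law)"
    and "integrable M (\<lambda>\<omega>. \<integral>s. discounted_reward X (\<lambda>t. exp (- (\<beta> * s * t))) (g s) \<tau> \<omega> \<partial>exp_law)"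
    and "integrable exp_law (\<lambda>s. expectation (discounted_reward X (\<lambda>t. exp (- (\<beta> * s * t))) (g s) \<tau>))"
proof -
  interpret PP: pair_prob_space exp_law M ..
  define D where "D s \<omega> = discounted_reward X (\<lambda>t. exp (- (\<beta> * s * t))) (g s) \<tau> \<omega>" for s \<omega>
  define Y where "Y \<omega> = X (real_of_ereal (\<tau> \<omega>)) \<omega>" for \<omega>
  have [measurable]: "Y \<in> borel_measurable M"
    unfolding Y_def using nonneg by (intro measurable_X_at) (auto intro: real_of_ereal_pos)
  have gY [measurable]: "(\<lambda>p. g (fst p) (Y (snd p))) \<in> borel_measurable (exp_law \<Otimes>\<^sub>M M)"
  proof -
    have "(\<lambda>p. (fst p, Y (snd p))) \<in> exp_law \<Otimes>\<^sub>M M \<rightarrow>\<^sub>M borel \<Otimes>\<^sub>M borel" by measurable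
    from measurable_compose[OF this g] show ?thesis by simp
  qed
  have Dm [measurable]: "(\<lambda>p. D (fst p) (snd p)) \<in> borel_measurable (exp_law \<Otimes>\<^sub>M M)"
    unfolding D_def discounted_reward_def Y_def[symmetric] by measurable
  have bound: "\<bar>D s \<omega>\<bar> \<le> \<bar>K\<bar>" if "0 < s" "\<omega> \<in> space M" for s \<omega>
  proof -
    have "0 \<le> real_of_ereal (\<tau> \<omega>)" using nonneg[OF that(2)] by (rule real_of_ereal_pos)
    then have "\<bar>exp (- (\<beta> * s * real_of_ereal (\<tau> \<omega>)))\<bar> \<le> 1" using \<beta> that by simp
    moreover have "\<bar>g s y\<bar> \<le> \<bar>K\<bar>" for y using K[OF that(1), of y] by linarith
    ultimately have "\<bar>exp (- (\<beta> * s * real_of_ereal (\<tau> \<omega>)))\<bar> * \<bar>g s y\<bar> \<le> 1 * \<bar>K\<bar>" for y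
      by (intro mult_mono) auto
    then show ?thesis by (simp add: D_def discounted_reward_def abs_mult)
  qed
  have "AE p in exp_law \<Otimes>\<^sub>M M. \<bar>D (fst p) (snd p)\<bar> \<le> \<bar>K\<bar>"
  proof (rule PP.AE_pair_measure)
    show "{p \<in> space (exp_law \<Otimes>\<^sub>M M). \<bar>D (fst p) (snd p)\<bar> \<le> \<bar>K\<bar>} \<in> sets (exp_law \<Otimes>\<^sub>M M)"
      by measurable
    show "AE s in exp_law. AE \<omega> in M. \<bar>D (fst (s, \<omega>)) (snd (s, \<omega>))\<bar> \<le> \<bar>K\<bar>"
      using AE_exp_law_pos by eventually_elim (use bound in auto)
  qed
  then have int: "integrable (exp_law \<Otimes>\<^sub>M M) (\<lambda>p. D (fst p) (snd p))"
    by (intro PP.P.integrable_const_bound[where B = "\<bar>K\<bar>"]) auto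
  then have int': "integrable (exp_law \<Otimes>\<^sub>M M) (case_prod D)" by (simp add: case_prod_beta')
  show "expectation (\<lambda>\<omega>. \<integral>s. discounted_reward X (\<lambda>t. exp (- (\<beta> * s * t))) (g s) \<tau> \<omega> \<partial>exp_law)
      = (\<integral>s. expectation (discounted_reward X (\<lambda>t. exp (- (\<beta> * s * t))) (g s) \<tau>) \<partial>exp_law)"
    using PP.Fubini_integral[OF int'] by (simp add: D_def)
  show "integrable M (\<lambda>\<omega>. \<integral>s. discounted_reward X (\<lambda>t. exp (- (\<beta> * s * t))) (g s) \<tau> \<omega> \<partial>exp_law)"
    using PP.integrable_snd[OF int'] by (simp add: D_def)
  show "integrable exp_law (\<lambda>s. expectation (discounted_reward X (\<lambda>t. exp (- (\<beta> * s * t))) (g s) \<tau>))"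
    using PP.integrable_fst[OF int'] by (simp add: D_def)
qed

lemma mixture_discounted_reward:
  assumes "\<omega> \<in> space M" "0 \<le> \<tau> \<omega>" "0 < \<beta>"
  shows "(\<integral>s. discounted_reward X (\<lambda>t. exp (- (\<beta> * s * t))) g \<tau> \<omega> \<partial>exp_law)
    = discounted_reward X (hyperbolic_discount \<beta>) g \<tau> \<omega>"
proof (cases "\<tau> \<omega> = \<infinity>")
  case False
  have "0 \<le> \<beta> * real_of_ereal (\<tau> \<omega>)" using assms by (simp add: real_of_ereal_pos)
  then have "(\<integral>s. exp (- (\<beta> * s * real_of_ereal (\<tau> \<omega>))) \<partial>exp_law) = 1 / (1 + \<beta> * real_of_ereal (\<tau> \<omega>))"
    using exp_law_laplace[of "\<beta> * real_of_ereal (\<tau> \<omega>)"] by (simp add: mult_ac)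
  then show ?thesis
    using False by (simp add: discounted_reward_def hyperbolic_discount_def)
qed (simp add: discounted_reward_def)

lemma discounted_hitting_point:
  assumes \<beta>: "0 < \<beta>"
  shows "expectation (discounted_reward X (hyperbolic_discount \<beta>) (\<lambda>_. 1) (hitting_time X {b})) = point_value \<beta> (x - b)"
proof -
  have "expectation (discounted_reward X (hyperbolic_discount \<beta>) (\<lambda>_. 1) (hitting_time X {b}))
      = expectation (\<lambda>\<omega>. \<integral>s. discounted_reward X (\<lambda>t. exp (- (\<beta> * s * t))) (\<lambda>_. 1) (hitting_time X {b}) \<omega> \<partial>exp_law)"
    using \<beta> hitting_time_nonneg by (intro Bochner_Integration.integral_cong refl mixture_discounted_reward[symmetric])
  also have "\<dots> = (\<integral>s. expectation (discounted_reward X (\<lambda>t. exp (- (\<beta> * s * t))) (\<lambda>_. 1) (hitting_time X {b})) \<partial>exp_law)"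
    by (rule discount_fubini[where g = "\<lambda>_ _. 1" and K = 1])
       (use \<beta> in \<open>auto intro!: measurable_hitting_time hitting_time_nonneg\<close>)
  also have "\<dots> = point_value \<beta> (x - b)"
    unfolding point_value_def
  proof (rule integral_cong_AE)
    show "(\<lambda>s. expectation (discounted_reward X (\<lambda>t. exp (- (\<beta> * s * t))) (\<lambda>_. 1) (hitting_time X {b}))) \<in> borel_measurable exp_law"
      by (rule borel_measurable_integrable, rule discount_fubini(3)[where g = "\<lambda>_ _. 1" and K = 1])
       (use \<beta> in \<open>auto intro!: measurable_hitting_time hitting_time_nonneg\<close>)
    show "AE s in exp_law. expectation (discounted_reward X (\<lambda>t. exp (- (\<beta> * s * t))) (\<lambda>_. 1) (hitting_time X {b}))
        = exp (- (sqrt (2 * \<beta> * s) * \<bar>x - b\<bar>))"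
      using AE_exp_law_pos
    proof eventually_elim
      case (elim s)
      with \<beta> hitting_time_laplace[of "sqrt (2 * \<beta> * s)" b] show ?case by simp
    qed
  qed measurable
  finally show ?thesis .
qed

text \<open>Stopping at \<open>R\<close> and discounting the wait for \<open>b\<close> afresh from there is worth no more than waiting
  for \<open>b\<close> from the beginning. For each \<open>s\<close> there is equality by \<open>laplace_before_point\<close>; mixing the
  two discount factors separately loses by \<open>exp_law_association\<close>.\<close>

lemma discounted_point_value_le:
  assumes \<beta>: "0 < \<beta>" and R: "closed R" "b \<in> R" "x \<notin> R"
  defines "Z \<equiv> discounted_reward X (hyperbolic_discount \<beta>) (\<lambda>y. point_value \<beta> (y - b)) (hitting_time X R)"
  shows "integrable M Z" and "expectation Z \<le> point_value \<beta> (x - b)"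
proof -
  define g where "g s y = exp (- (sqrt (2 * \<beta> * s) * \<bar>y - b\<bar>))" for s y :: real
  have g1: "0 \<le> g s y \<and> g s y \<le> 1" if "0 \<le> s" for s y using \<beta> that by (simp add: g_def)
  have \<tau> [measurable]: "hitting_time X R \<in> borel_measurable M" using R by (intro measurable_hitting_time)
  have gm: "(\<lambda>p. g (fst p) (snd p)) \<in> borel_measurable (borel \<Otimes>\<^sub>M borel)"
    unfolding g_def by measurable
  have "\<And>s y. 0 < s \<Longrightarrow> \<bar>g s y\<bar> \<le> 1" using g1 by (simp add: less_imp_le)
  note F = discount_fubini[OF \<tau> hitting_time_nonneg gm this \<beta>]
  have [measurable]: "Z \<in> borel_measurable M"
    unfolding Z_def using hitting_time_nonneg
    by (intro measurable_discounted_reward) (auto simp: hyperbolic_discount_def[abs_def])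
  have Z: "0 \<le> Z \<omega>"
    "Z \<omega> \<le> (\<integral>s. discounted_reward X (\<lambda>t. exp (- (\<beta> * s * t))) (g s) (hitting_time X R) \<omega> \<partial>exp_law)" for \<omega>
  proof -
    let ?t = "real_of_ereal (hitting_time X R \<omega>)" and ?y = "X (real_of_ereal (hitting_time X R \<omega>)) \<omega>"
    have t: "0 \<le> \<beta> * ?t" using \<beta> hitting_time_nonneg by (simp add: real_of_ereal_pos)
    have gy: "(\<lambda>s. g s ?y) \<in> borel_measurable borel" unfolding g_def by measurable
    have "(\<integral>s. g s ?y \<partial>exp_law) / (1 + \<beta> * ?t) \<le> (\<integral>s. exp (- (\<beta> * ?t * s)) * g s ?y \<partial>exp_law)"
    proof (rule exp_law_association[OF gy t g1])
      show "g r ?y \<le> g s ?y" if "0 \<le> s" "s \<le> r" for s r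
        using \<beta> that by (auto simp: g_def intro!: mult_right_mono)
    qed
    then show "Z \<omega> \<le> (\<integral>s. discounted_reward X (\<lambda>t. exp (- (\<beta> * s * t))) (g s) (hitting_time X R) \<omega> \<partial>exp_law)"
      by (simp add: Z_def discounted_reward_def hyperbolic_discount_def point_value_def g_def mult_ac)
    show "0 \<le> Z \<omega>"
      using t point_value_bounds(1)[OF \<beta>] by (simp add: Z_def discounted_reward_def hyperbolic_discount_def)
  qed
  show intZ: "integrable M Z"
    using F(2) by (rule Bochner_Integration.integrable_bound) (use Z in \<open>auto intro: order_trans[OF _ abs_ge_self]\<close>)
  have "expectation Z \<le> expectation (\<lambda>\<omega>. \<integral>s. discounted_reward X (\<lambda>t. exp (- (\<beta> * s * t))) (g s) (hitting_time X R) \<omega> \<partial>exp_law)"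
    using intZ F(2) Z by (intro integral_mono) auto
  also have "\<dots> = (\<integral>s. expectation (discounted_reward X (\<lambda>t. exp (- (\<beta> * s * t))) (g s) (hitting_time X R)) \<partial>exp_law)"
    by (rule F(1))
  also have "\<dots> = point_value \<beta> (x - b)"
    unfolding point_value_def
  proof (rule integral_cong_AE)
    show "AE s in exp_law. expectation (discounted_reward X (\<lambda>t. exp (- (\<beta> * s * t))) (g s) (hitting_time X R))
        = exp (- (sqrt (2 * \<beta> * s) * \<bar>x - b\<bar>))"
      using AE_exp_law_pos
    proof eventually_elim
      case (elim s)
      with \<beta> laplace_before_point[of "sqrt (2 * \<beta> * s)" R b] R show ?case
        by (simp add: g_def[abs_def])
    qed
  qed (use F(3) in auto)
  finally show "expectation Z \<le> point_value \<beta> (x - b)" .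
qed

end

lemma (in brownian_motion) bounded_discounted_reward:
  assumes \<beta>: "0 < \<beta>" and \<tau>: "\<tau> \<in> borel_measurable M" "\<And>\<omega>. \<omega> \<in> space M \<Longrightarrow> 0 \<le> \<tau> \<omega>"
    and f: "f \<in> borel_measurable borel" "\<And>y. 0 \<le> f y" "\<And>y. f y \<le> K"
  shows "integrable M (discounted_reward X (hyperbolic_discount \<beta>) f \<tau>)"
    and "expectation (discounted_reward X (hyperbolic_discount \<beta>) f \<tau>) \<le> K"
proof -
  have K: "0 \<le> K" using f(2,3)[of 0] by linarith
  have b: "0 \<le> discounted_reward X (hyperbolic_discount \<beta>) f \<tau> \<omega> \<and> discounted_reward X (hyperbolic_discount \<beta>) f \<tau> \<omega> \<le> K"
    if "\<omega> \<in> space M" for \<omega>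
  proof -
    note h = hyperbolic_discount_bounds[OF \<beta> real_of_ereal_pos[OF \<tau>(2)[OF that]]]
    have "hyperbolic_discount \<beta> (real_of_ereal (\<tau> \<omega>)) * f y \<le> 1 * K" for y
      using h f K by (intro mult_mono) auto
    with h f K show ?thesis by (auto simp: discounted_reward_def)
  qed
  have m: "discounted_reward X (hyperbolic_discount \<beta>) f \<tau> \<in> borel_measurable M"
    using \<tau> f by (intro measurable_discounted_reward) auto
  show i: "integrable M (discounted_reward X (hyperbolic_discount \<beta>) f \<tau>)"
    by (rule integrable_const_bound[where B = K]) (use b m in auto)
  show "expectation (discounted_reward X (hyperbolic_discount \<beta>) f \<tau>) \<le> K"
    using i by (rule integral_le_const) (use b in auto)
qed

text \<open>A closed set that misses the starting point is reached only after a positive time, so even the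
  largest reward is strictly discounted.\<close>

lemma (in brownian_motion) discounted_reward_lt_max:
  assumes \<beta>: "0 < \<beta>" and R: "closed R" "x \<notin> R"
    and f: "f \<in> borel_measurable borel" "\<And>y. 0 \<le> f y" "\<And>y. f y \<le> K" and K: "0 < K"
  shows "expectation (discounted_reward X (hyperbolic_discount \<beta>) f (hitting_time X R)) < K"
proof (rule expectation_less)
  show "integrable M (discounted_reward X (hyperbolic_discount \<beta>) f (hitting_time X R))"
    using \<beta> f R by (intro bounded_discounted_reward(1)[where K = K] measurable_hitting_time hitting_time_nonneg)
  show "AE \<omega> in M. discounted_reward X (hyperbolic_discount \<beta>) f (hitting_time X R) \<omega> < K"
    using AE_hitting_time_outside[OF R(2)] AE_space
  proof eventually_elim
    case (elim \<omega>)
    show ?case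
    proof (rule hitting_time_after_cases[OF elim(2) order_refl R(1)])
      fix s assume s: "hitting_time_after X 0 R \<omega> = ereal s" "0 \<le> s" "X s \<omega> \<in> R"
      have "s \<noteq> 0" using s elim R by auto
      then have "0 < s" using s by simp
      then have "hyperbolic_discount \<beta> s < 1" "0 \<le> hyperbolic_discount \<beta> s"
        using hyperbolic_discount_bounds[OF \<beta> s(2)] by auto
      moreover have "hyperbolic_discount \<beta> s * f (X s \<omega>) \<le> hyperbolic_discount \<beta> s * K"
        using f calculation by (intro mult_left_mono) auto
      moreover have "hyperbolic_discount \<beta> s * K < 1 * K"
        using calculation K by (intro mult_strict_right_mono) auto
      ultimately show ?thesis using elim s by (simp add: discounted_reward_def)
    qed (use elim K in \<open>simp add: discounted_reward_def\<close>)
  qed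
qed

section \<open>The value of waiting for either of two points\<close>

lemma sinh_ge_self: "0 \<le> z \<Longrightarrow> z \<le> sinh (z::real)"
proof -
  assume z: "0 \<le> z"
  have "sinh 0 - 0 \<le> sinh z - z"
  proof (rule DERIV_nonneg_imp_nondecreasing[OF z])
    fix y :: real assume "0 \<le> y"
    have "((\<lambda>y. sinh y - y) has_real_derivative cosh y - 1) (at y)"
      by (auto intro!: derivative_eq_intros)
    moreover have "0 \<le> cosh y - 1" using cosh_real_ge_1[of y] by simp
    ultimately show "\<exists>d. ((\<lambda>y. sinh y - y) has_real_derivative d) (at y) \<and> 0 \<le> d" by blast
  qed
  then show ?thesis by simp
qed

lemma div_sinh_le:
  fixes k w :: real
  assumes "0 < k" "0 < w"
  shows "k / sinh (w * k) \<le> 1 / w"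
proof -
  have "w * k \<le> sinh (w * k)" "0 < w * k" using assms by (auto intro: sinh_ge_self)
  then have "k / sinh (w * k) \<le> k / (w * k)" using assms by (intro divide_left_mono) auto
  also have "k / (w * k) = 1 / w" using assms by simp
  finally show ?thesis .
qed

lemma mult_coth_le:
  fixes k w :: real
  assumes "0 < k" "0 < w"
  shows "k * (cosh (w * k) / sinh (w * k)) \<le> k + 1 / w"
proof -
  define S where "S = sinh (w * k)"
  have s: "0 < S" using assms by (simp add: S_def)
  have "cosh (w * k) = S + exp (- (w * k))"
    by (simp add: S_def cosh_minus_sinh[symmetric])
  then have "k * (cosh (w * k) / S) = k + exp (- (w * k)) * (k / S)"
    using s by (simp add: add_divide_distrib distrib_left)
  also have "\<dots> \<le> k + 1 * (k / S)"
    using assms s by (intro add_left_mono mult_right_mono) auto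
  also have "\<dots> \<le> k + 1 / w" using div_sinh_le[OF assms] by (simp add: S_def)
  finally show ?thesis by (simp add: S_def)
qed

text \<open>The bounded solution of \<open>v'' = k\<^sup>2 v\<close> off \<open>{a, b}\<close> with \<open>v a = c\<close> and \<open>v b = d\<close>. It is the value of
  waiting for \<open>{a, b}\<close> with rewards \<open>c\<close> and \<open>d\<close> under exponential discounting at rate \<open>k\<^sup>2 / 2\<close>.\<close>

definition two_point :: "real \<Rightarrow> real \<Rightarrow> real \<Rightarrow> real \<Rightarrow> real \<Rightarrow> real \<Rightarrow> real" where
  "two_point a b c d k y =
     (if y \<le> a then c * exp (- (k * (a - y)))
      else if y \<le> b then (c * sinh (k * (b - y)) + d * sinh (k * (y - a))) / sinh (k * (b - a))
      else d * exp (- (k * (y - b))))"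

text \<open>The right derivative of \<open>two_point a b c d k\<close> at \<open>a\<close>, for \<open>w = b - a\<close>. The left derivative is
  \<open>c * k\<close>.\<close>

definition slope_right :: "real \<Rightarrow> real \<Rightarrow> real \<Rightarrow> real \<Rightarrow> real" where
  "slope_right w c d k = d * (k / sinh (w * k)) - c * (k * (cosh (w * k) / sinh (w * k)))"

lemma measurable_two_point [measurable]: "two_point a b c d k \<in> borel_measurable borel"
  unfolding two_point_def[abs_def] sinh_def by measurable

lemma two_point_at:
  assumes "a < b" "0 < k"
  shows "two_point a b c d k a = c" "two_point a b c d k b = d"
  using assms by (auto simp: two_point_def)

lemma two_point_bounds:
  assumes "a < b" "0 < k" "0 < c" "c < d"
  shows "0 \<le> two_point a b c d k y" "two_point a b c d k y \<le> d"
proof -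
  have "0 \<le> two_point a b c d k y \<and> two_point a b c d k y \<le> d"
  proof -
    consider "y \<le> a" | "a < y" "y \<le> b" | "b < y" by linarith
    then show ?thesis
    proof cases
      case 1
      then have "c * exp (- (k * (a - y))) \<le> c * 1" using assms by (intro mult_left_mono) auto
      then have "c * exp (- (k * (a - y))) \<le> d" using assms by linarith
      then show ?thesis using 1 assms by (simp add: two_point_def)
    next
      case 2
      define A B where "A = k * (b - y)" and "B = k * (y - a)"
      have AB: "0 \<le> A" "0 \<le> B" "k * (b - a) = A + B" using 2 assms by (auto simp: A_def B_def algebra_simps)
      have pos: "0 < sinh (A + B)" using AB(3)[symmetric] assms by simp
      have "c * sinh A + d * sinh B \<le> d * sinh A + d * sinh B"
        using assms AB by (intro add_right_mono mult_right_mono) auto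
      also have "\<dots> = d * (sinh A * 1 + 1 * sinh B)" by (simp add: algebra_simps)
      also have "\<dots> \<le> d * (sinh A * cosh B + cosh A * sinh B)"
        using assms AB cosh_real_ge_1 by (intro mult_left_mono add_mono mult_right_mono) auto
      finally have "c * sinh A + d * sinh B \<le> d * sinh (A + B)" by (simp add: sinh_add)
      then show ?thesis
        using 2 pos assms AB by (simp add: two_point_def A_def[symmetric] B_def[symmetric] divide_le_eq)
    next
      case 3
      then have "d * exp (- (k * (y - b))) \<le> d * 1" using assms by (intro mult_left_mono) auto
      then show ?thesis using 3 assms by (simp add: two_point_def)
    qed
  qed
  then show "0 \<le> two_point a b c d k y" "two_point a b c d k y \<le> d" by auto
qed

lemma two_point_exponential:
  assumes ab: "a < b" and k: "0 < k" and U: "U \<in> {{..<a}, {a<..<b}, {b<..}}"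
  shows "\<exists>\<alpha> \<gamma>. \<forall>y\<in>closure U. two_point a b c d k y = \<alpha> * exp (k * y) + \<gamma> * exp (- k * y)"
proof -
  note at = two_point_at[OF ab k]
  consider "closure U = {..a}" | "closure U = {a..b}" | "closure U = {b..}" using U ab by auto
  then show ?thesis
  proof cases
    case 1
    then show ?thesis
      by (intro exI[of _ "c * exp (- k * a)"] exI[of _ 0])
         (auto simp: two_point_def exp_add[symmetric] algebra_simps)
  next
    case 2
    define S where "S = sinh (k * (b - a))"
    have S: "S \<noteq> 0" using ab k by (simp add: S_def)
    have *: "two_point a b c d k y = ((d * exp (- k * a) - c * exp (- k * b)) / (2 * S)) * exp (k * y)
        + ((c * exp (k * b) - d * exp (k * a)) / (2 * S)) * exp (- k * y)" if "a \<le> y" "y \<le> b" for y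
    proof -
      have "two_point a b c d k y = (c * sinh (k * (b - y)) + d * sinh (k * (y - a))) / S"
        using that ab at(1)[of c d] S by (cases "y = a") (auto simp: two_point_def S_def)
      also have "c * sinh (k * (b - y)) + d * sinh (k * (y - a))
        = ((d * exp (- k * a) - c * exp (- k * b)) * exp (k * y) + (c * exp (k * b) - d * exp (k * a)) * exp (- k * y)) / 2"
        by (simp add: sinh_def algebra_simps exp_add[symmetric] diff_divide_distrib add_divide_distrib)
      finally show ?thesis using S by (simp add: add_divide_distrib)
    qed
    show ?thesis unfolding 2 by (intro exI ballI, rule *) auto
  next
    case 3
    have "two_point a b c d k y = 0 * exp (k * y) + d * exp (k * b) * exp (- k * y)" if "b \<le> y" for y
      using that ab at(2)[of c d] by (cases "y = b") (auto simp: two_point_def exp_add[symmetric] algebra_simps)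
    with 3 show ?thesis by blast
  qed
qed

text \<open>A coefficient of \<open>(y - a)\<^sup>2\<close> that bounds how far \<open>two_point\<close> can exceed its one-sided tangents at
  \<open>a\<close>. The first summand bounds half the second derivative \<open>k\<^sup>2 v \<le> k\<^sup>2 d\<close> for \<open>y \<le> b\<close>; the other two
  absorb \<open>d\<close> and a negative linear term for \<open>y > b\<close>. It is a polynomial in \<open>k\<close> and hence integrable
  with respect to the mixing law.\<close>

definition curvature :: "real \<Rightarrow> real \<Rightarrow> real \<Rightarrow> real \<Rightarrow> real" where
  "curvature w c d k = d * k\<^sup>2 / 2 + d / w\<^sup>2 + c * (k + 1 / w) / w"

text \<open>The tangents at \<open>a\<close> have slope \<open>c * k\<close> to the left and \<open>p\<close> to the right. They are written as a
  multiple of \<open>\<bar>y - a\<bar>\<close>, carrying the jump of the slope, and a multiple of \<open>y - a\<close>, which has mean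
  zero for Brownian motion started in \<open>a\<close>.\<close>

lemma two_point_upper_bound:
  assumes ab: "a < b" and k: "0 < k" and cd: "0 < c" "c < d"
  defines "p \<equiv> slope_right (b - a) c d k"
  shows "two_point a b c d k y \<le> c + (p - c * k) / 2 * \<bar>y - a\<bar> + (p + c * k) / 2 * (y - a)
      + curvature (b - a) c d k * (y - a)\<^sup>2"
proof -
  define w where "w = b - a"
  define K where "K = curvature w c d k"
  have w: "0 < w" using ab by (simp add: w_def)
  have K: "d * k\<^sup>2 / 2 \<le> K" "d / w\<^sup>2 + c * (k + 1 / w) / w \<le> K" "0 \<le> K"
    using w k cd by (auto simp: K_def curvature_def)
  consider "y \<le> a" | "a < y" "y \<le> b" | "b < y" by linarith
  then have "two_point a b c d k y \<le> c + (p - c * k) / 2 * \<bar>y - a\<bar> + (p + c * k) / 2 * (y - a) + K * (y - a)\<^sup>2"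
  proof cases
    case 1
    define z where "z = a - y"
    have z: "0 \<le> z" using 1 by (simp add: z_def)
    have taylor: "exp (- t) \<le> 1 - t + t\<^sup>2 / 2" if t: "0 \<le> t" for t :: real
    proof -
      have 1: "0 \<le> (exp (- t) - 1 + t)" for t :: real using exp_ge_add_one_self[of "- t"] by simp
      have "(1 - 0 + 0\<^sup>2 / 2 - exp (- 0)) \<le> (1 - t + t\<^sup>2 / 2 - exp (- t))"
      proof (rule DERIV_nonneg_imp_nondecreasing[OF t])
        fix r :: real
        have "((\<lambda>t. 1 - t + t\<^sup>2 / 2 - exp (- t)) has_real_derivative (exp (- r) - 1 + r)) (at r)"
          by (auto intro!: derivative_eq_intros)
        then show "\<exists>d. ((\<lambda>t. 1 - t + t\<^sup>2 / 2 - exp (- t)) has_real_derivative d) (at r) \<and> 0 \<le> d"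
          using 1 by blast
      qed
      then show ?thesis by simp
    qed
    have "two_point a b c d k y = c * exp (- (k * z))" using 1 by (simp add: two_point_def z_def)
    also have "\<dots> \<le> c * (1 - k * z + (k * z)\<^sup>2 / 2)"
      using taylor[of "k * z"] k z cd by (intro mult_left_mono) auto
    also have "\<dots> = c - c * k * z + c * k\<^sup>2 / 2 * z\<^sup>2" by (simp add: power_mult_distrib algebra_simps)
    also have "\<dots> \<le> c - c * k * z + K * z\<^sup>2"
    proof -
      have "c * k\<^sup>2 / 2 \<le> d * k\<^sup>2 / 2" using cd by (intro divide_right_mono mult_right_mono) auto
      then show ?thesis using K(1) by (intro add_left_mono mult_right_mono) auto
    qed
    also have "\<dots> = c + (p - c * k) / 2 * \<bar>y - a\<bar> + (p + c * k) / 2 * (y - a) + K * (y - a)\<^sup>2"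
    proof -
      have e: "y - a = - z" by (simp add: z_def)
      show ?thesis unfolding e using z by (simp add: field_simps)
    qed
    finally show ?thesis .
  next
    case 2
    define z where "z = y - a"
    have z: "0 \<le> z" "z \<le> w" using 2 by (auto simp: z_def w_def)
    define S where "S = sinh (k * w)"
    have S: "0 < S" using w k by (simp add: S_def)
    define h where "h t = (c * sinh (k * (w - t)) + d * sinh (k * t)) / S" for t
    define h' where "h' t = (d * k * cosh (k * t) - c * k * cosh (k * (w - t))) / S" for t
    have dh: "(h has_real_derivative h' t) (at t)" for t
      unfolding h_def h'_def by (rule DERIV_cdivide) (auto intro!: derivative_eq_intros simp: algebra_simps)
    have dh': "(h' has_real_derivative k\<^sup>2 * h t) (at t)" for t
    proof -
      have "(h' has_real_derivative
          (d * k * (sinh (k * t) * k) - c * k * (sinh (k * (w - t)) * - k)) / S) (at t)"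
        unfolding h'_def by (rule DERIV_cdivide) (auto intro!: derivative_eq_intros)
      also have "(d * k * (sinh (k * t) * k) - c * k * (sinh (k * (w - t)) * - k)) / S = k\<^sup>2 * h t"
        by (simp add: h_def power2_eq_square algebra_simps)
      finally show ?thesis .
    qed
    have p: "h' 0 = p" unfolding h'_def p_def slope_right_def S_def w_def
      by (simp add: mult.commute mult.left_commute diff_divide_distrib)
    have h_le: "h t \<le> d" if "0 \<le> t" "t \<le> w" for t
    proof -
      have "h t = two_point a b c d k (a + t)"
        using that S two_point_at(1)[OF ab k, of c d] by (cases "t = 0") (auto simp: h_def two_point_def w_def S_def algebra_simps)
      then show ?thesis using two_point_bounds[OF ab k cd] by simp
    qed
    \<comment> \<open>\<open>h'' = k\<^sup>2 h \<le> k\<^sup>2 d\<close> is integrated twice from \<open>0\<close>, where \<open>h = c\<close> and \<open>h' = p\<close>\<close>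
    have first: "h' t \<le> p + d * k\<^sup>2 * t" if "0 \<le> t" "t \<le> w" for t
    proof -
      have "d * k\<^sup>2 * 0 - h' 0 \<le> d * k\<^sup>2 * t - h' t"
      proof (rule DERIV_nonneg_imp_nondecreasing[OF that(1)])
        fix r assume r: "0 \<le> r" "r \<le> t"
        have "((\<lambda>t. d * k\<^sup>2 * t - h' t) has_real_derivative (d * k\<^sup>2 - k\<^sup>2 * h r)) (at r)"
          by (auto intro!: derivative_eq_intros dh')
        moreover have "k\<^sup>2 * h r \<le> k\<^sup>2 * d" using h_le[of r] r that by (intro mult_left_mono) auto
        then have "0 \<le> d * k\<^sup>2 - k\<^sup>2 * h r" by (simp add: mult.commute)
        ultimately show "\<exists>d'. ((\<lambda>t. d * k\<^sup>2 * t - h' t) has_real_derivative d') (at r) \<and> 0 \<le> d'" by blast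
      qed
      then show ?thesis using p by simp
    qed
    have "(p * 0 + d * k\<^sup>2 / 2 * 0\<^sup>2) - h 0 \<le> (p * z + d * k\<^sup>2 / 2 * z\<^sup>2) - h z"
    proof (rule DERIV_nonneg_imp_nondecreasing[OF z(1)])
      fix r assume r: "0 \<le> r" "r \<le> z"
      have "((\<lambda>t. (p * t + d * k\<^sup>2 / 2 * t\<^sup>2) - h t) has_real_derivative (p + d * k\<^sup>2 * r - h' r)) (at r)"
        by (auto intro!: derivative_eq_intros dh)
      then show "\<exists>d'. ((\<lambda>t. (p * t + d * k\<^sup>2 / 2 * t\<^sup>2) - h t) has_real_derivative d') (at r) \<and> 0 \<le> d'"
        using first[of r] r z by (intro exI[of _ "p + d * k\<^sup>2 * r - h' r"] conjI) auto
    qed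
    moreover have "h 0 = c" using S by (simp add: h_def S_def[symmetric])
    ultimately have "h z \<le> c + p * z + d * k\<^sup>2 / 2 * z\<^sup>2" by simp
    also have "\<dots> \<le> c + p * z + K * z\<^sup>2" using K(1) by (intro add_left_mono mult_right_mono) auto
    also have "h z = two_point a b c d k y"
      using 2 by (simp add: h_def two_point_def z_def w_def S_def)
    finally have "two_point a b c d k y \<le> c + p * z + K * z\<^sup>2" .
    moreover have "c + (p - c * k) / 2 * \<bar>y - a\<bar> + (p + c * k) / 2 * (y - a) + K * (y - a)\<^sup>2 = c + p * z + K * z\<^sup>2"
      using z(1) by (simp add: z_def field_simps)
    ultimately show ?thesis by simp
  next
    case 3
    define z where "z = y - a"
    have z: "w \<le> z" "0 \<le> z" using 3 w by (auto simp: z_def w_def)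
    have "0 \<le> d * (k / sinh (w * k))" using k w cd by simp
    moreover have "c * (k * (cosh (w * k) / sinh (w * k))) \<le> c * (k + 1 / w)"
      using mult_coth_le[OF k w] cd by (intro mult_left_mono) auto
    ultimately have p: "- (c * (k + 1 / w)) \<le> p" by (simp add: p_def slope_right_def w_def)
    have zz: "z \<le> z\<^sup>2 / w" "1 \<le> z\<^sup>2 / w\<^sup>2"
    proof -
      have "w * z \<le> z * z" using z by (intro mult_right_mono) auto
      then show "z \<le> z\<^sup>2 / w" using w by (simp add: power2_eq_square le_divide_eq mult.commute)
      have "w\<^sup>2 \<le> z\<^sup>2" using z w by (intro power_mono) auto
      then show "1 \<le> z\<^sup>2 / w\<^sup>2" using w by simp
    qed
    have "d * 1 \<le> d * (z\<^sup>2 / w\<^sup>2)" using cd zz by (intro mult_left_mono) auto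
    moreover have "c * (k + 1 / w) * z \<le> c * (k + 1 / w) * (z\<^sup>2 / w)"
      using cd zz k w by (intro mult_left_mono) auto
    moreover have "- (c * (k + 1 / w)) * z \<le> p * z" using p z by (intro mult_right_mono) auto
    moreover have "(d / w\<^sup>2 + c * (k + 1 / w) / w) * z\<^sup>2 \<le> K * z\<^sup>2" using K by (intro mult_right_mono) auto
    moreover have "(d / w\<^sup>2 + c * (k + 1 / w) / w) * z\<^sup>2 = d * (z\<^sup>2 / w\<^sup>2) + c * (k + 1 / w) * (z\<^sup>2 / w)"
      by (simp add: distrib_right)
    ultimately have "d \<le> p * z + K * z\<^sup>2" by simp
    then have "d \<le> c + p * z + K * z\<^sup>2" using cd by simp
    moreover have "c + (p - c * k) / 2 * \<bar>y - a\<bar> + (p + c * k) / 2 * (y - a) + K * (y - a)\<^sup>2 = c + p * z + K * z\<^sup>2"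
      using z(2) by (simp add: z_def field_simps)
    ultimately show ?thesis using two_point_bounds(2)[OF ab k cd, of y] by simp
  qed
  then show ?thesis by (simp add: K_def w_def)
qed

section \<open>The gain from waiting a short time at the lower point\<close>

context brownian_motion
begin

lemma displacement_moments:
  assumes "0 < t"
  shows "integrable M (\<lambda>\<omega>. X t \<omega> - x)" "expectation (\<lambda>\<omega>. X t \<omega> - x) = 0"
    and "integrable M (\<lambda>\<omega>. \<bar>X t \<omega> - x\<bar>)" "expectation (\<lambda>\<omega>. \<bar>X t \<omega> - x\<bar>) = sqrt t * sqrt (2 / pi)"
    and "integrable M (\<lambda>\<omega>. (X t \<omega> - x)\<^sup>2)" "expectation (\<lambda>\<omega>. (X t \<omega> - x)\<^sup>2) = t"
proof -
  have [measurable]: "X t \<in> borel_measurable M" "X 0 \<in> borel_measurable M"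
    using assms by (auto intro!: measurable_X)
  note D = distributed_increment[OF order_refl assms]
  have *: "integrable M (\<lambda>\<omega>. h (X t \<omega> - x)) \<and> expectation (\<lambda>\<omega>. h (X t \<omega> - x)) = I"
    if "has_bochner_integral lborel (\<lambda>z. normal_density 0 (sqrt t) z * h z) I"
      and [measurable]: "h \<in> borel_measurable borel" for h :: "real \<Rightarrow> real" and I
  proof -
    have ae: "AE \<omega> in M. h (X t \<omega> - x) = h (X t \<omega> - X 0 \<omega>)"
      using AE_start by eventually_elim simp
    have "integrable M (\<lambda>\<omega>. h (X t \<omega> - x)) \<longleftrightarrow> integrable M (\<lambda>\<omega>. h (X t \<omega> - X 0 \<omega>))"
      by (rule integrable_cong_AE) (use ae in auto)
    moreover have "expectation (\<lambda>\<omega>. h (X t \<omega> - x)) = expectation (\<lambda>\<omega>. h (X t \<omega> - X 0 \<omega>))"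
      by (rule integral_cong_AE) (use ae in auto)
    moreover have "integrable M (\<lambda>\<omega>. h (X t \<omega> - X 0 \<omega>))"
      using distributed_integrable[OF D, of h] that by (auto simp: has_bochner_integral_iff)
    moreover have "expectation (\<lambda>\<omega>. h (X t \<omega> - X 0 \<omega>)) = I"
      using distributed_integral[OF D, of h] that by (auto simp: has_bochner_integral_iff)
    ultimately show ?thesis by simp
  qed
  have st: "0 < sqrt t" using assms by simp
  show "integrable M (\<lambda>\<omega>. X t \<omega> - x)" "expectation (\<lambda>\<omega>. X t \<omega> - x) = 0"
    using *[of "\<lambda>z. z" 0] normal_moment_odd[OF st, of 0 0] by simp_all
  show "integrable M (\<lambda>\<omega>. \<bar>X t \<omega> - x\<bar>)" "expectation (\<lambda>\<omega>. \<bar>X t \<omega> - x\<bar>) = sqrt t * sqrt (2 / pi)"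
    using *[of abs "sqrt t * sqrt (2 / pi)"] normal_moment_abs_odd[OF st, of 0 0] by simp_all
  show "integrable M (\<lambda>\<omega>. (X t \<omega> - x)\<^sup>2)" "expectation (\<lambda>\<omega>. (X t \<omega> - x)\<^sup>2) = t"
    using *[of "\<lambda>z. z\<^sup>2" t] normal_moment_even[OF st, of 0 1] assms by (simp_all add: fact_numeral)
qed

text \<open>For each \<open>s\<close> the piecewise exit identity, started at time \<open>\<epsilon>\<close>, gives \<open>exp (- \<beta> s \<epsilon>)\<close> times the
  mean of \<open>two_point\<close> at \<open>X\<^sub>\<epsilon>\<close>. The factor is at most one, and the mean is estimated by
  \<open>two_point_upper_bound\<close> with the moments of the normal distribution.\<close>

lemma delayed_two_point_reward:
  assumes x: "x = a" and ab: "a < b" and cd: "0 < c" "c < d" and \<beta>: "0 < \<beta>"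
    and f [measurable]: "f \<in> borel_measurable borel" and fab: "f a = c" "f b = d"
    and f_bound: "\<And>y. \<bar>f y\<bar> \<le> d" and \<epsilon>: "0 < \<epsilon>"
  defines "k \<equiv> \<lambda>s. sqrt (2 * \<beta> * s)"
  assumes int_slope: "integrable exp_law (\<lambda>s. slope_right (b - a) c d (k s) - c * k s)"
    and int_curv: "integrable exp_law (\<lambda>s. curvature (b - a) c d (k s))"
  shows "expectation (discounted_reward X (hyperbolic_discount \<beta>) f (hitting_time_after X \<epsilon> {a, b}))
    \<le> c + sqrt \<epsilon> * sqrt (2 / pi) / 2 * (\<integral>s. slope_right (b - a) c d (k s) - c * k s \<partial>exp_law)
        + \<epsilon> * (\<integral>s. curvature (b - a) c d (k s) \<partial>exp_law)"
proof -
  define \<tau> where "\<tau> = hitting_time_after X \<epsilon> {a, b}"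
  have C: "closed {a, b}" by simp
  have [measurable]: "X \<epsilon> \<in> borel_measurable M" using \<epsilon> by (intro measurable_X) auto
  have \<tau>: "\<tau> \<in> borel_measurable M" unfolding \<tau>_def using \<epsilon> by (intro measurable_hitting_time_after) auto
  have \<tau>0: "0 \<le> \<tau> \<omega>" if "\<omega> \<in> space M" for \<omega>
    using hitting_time_after_ge[OF that _ C, of \<epsilon>] \<epsilon> unfolding \<tau>_def
    by (auto intro: order_trans[rotated])
  have gm: "(\<lambda>p. f (snd p)) \<in> borel_measurable (borel \<Otimes>\<^sub>M borel)" by measurable
  note F = discount_fubini[where g = "\<lambda>_. f", OF \<tau> \<tau>0 gm f_bound \<beta>]
  have bound: "expectation (discounted_reward X (\<lambda>t. exp (- (\<beta> * s * t))) f \<tau>)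
      \<le> c + (slope_right (b - a) c d (k s) - c * k s) / 2 * (sqrt \<epsilon> * sqrt (2 / pi)) + curvature (b - a) c d (k s) * \<epsilon>"
    if s: "0 < s" for s
  proof -
    define u where "u = two_point a b c d (k s)"
    define p where "p = slope_right (b - a) c d (k s)"
    have ks: "0 < k s" and k2: "(k s)\<^sup>2 / 2 = \<beta> * s" using s \<beta> by (auto simp: k_def)
    have [measurable]: "u \<in> borel_measurable borel" unfolding u_def by measurable
    have uf: "u y = f y" if "y \<in> {a, b}" for y
      using that by (auto simp: u_def fab two_point_at[OF ab ks])
    have u: "0 \<le> u y" "u y \<le> d" for y using two_point_bounds[OF ab ks cd] by (auto simp: u_def)
    have "discounted_reward X (\<lambda>t. exp (- (\<beta> * s * t))) f \<tau> \<omega> = discounted_reward X (\<lambda>t. exp (- (\<beta> * s * t))) u \<tau> \<omega>"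
      if "\<omega> \<in> space M" for \<omega>
      unfolding \<tau>_def
      by (rule hitting_time_after_cases[OF that _ C, of \<epsilon>])
         (use \<epsilon> uf in \<open>simp_all add: discounted_reward_def\<close>)
    then have "expectation (discounted_reward X (\<lambda>t. exp (- (\<beta> * s * t))) f \<tau>)
        = expectation (discounted_reward X (\<lambda>t. exp (- (\<beta> * s * t))) u \<tau>)"
      by (rule Bochner_Integration.integral_cong[OF refl])
    also have "\<dots> = exp (- (\<beta> * s * \<epsilon>)) * expectation (\<lambda>\<omega>. u (X \<epsilon> \<omega>))"
      unfolding k2[symmetric] \<tau>_def
    proof (rule piecewise_exit_identity[where \<U> = "{{..<a}, {a<..<b}, {b<..}}" and K = d])
      show "\<Union>{{..<a}, {a<..<b}, {b<..}} = - {a, b}" using ab by auto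
      show "disjoint {{..<a}, {a<..<b}, {b<..}}" using ab by (auto simp: disjoint_def)
      show "\<exists>\<alpha> \<gamma>. \<forall>y\<in>closure U. u y = \<alpha> * exp (k s * y) + \<gamma> * exp (- k s * y)"
        if "U \<in> {{..<a}, {a<..<b}, {b<..}}" for U
        unfolding u_def by (rule two_point_exponential[OF ab ks that])
    qed (use \<epsilon> ks u in auto)
    also have "\<dots> \<le> 1 * expectation (\<lambda>\<omega>. u (X \<epsilon> \<omega>))"
      using s \<beta> \<epsilon> u by (intro mult_right_mono integral_nonneg_AE) auto
    also have "\<dots> \<le> expectation (\<lambda>\<omega>. c + (p - c * k s) / 2 * \<bar>X \<epsilon> \<omega> - x\<bar> + (p + c * k s) / 2 * (X \<epsilon> \<omega> - x)
        + curvature (b - a) c d (k s) * (X \<epsilon> \<omega> - x)\<^sup>2)"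
      unfolding mult_1
    proof (rule integral_mono)
      show "integrable M (\<lambda>\<omega>. u (X \<epsilon> \<omega>))"
        by (rule integrable_const_bound[where B = d]) (use u in auto)
    qed (use displacement_moments[OF \<epsilon>] two_point_upper_bound[OF ab ks cd] in \<open>auto simp: u_def p_def x\<close>)
    also have "\<dots> = c + (p - c * k s) / 2 * (sqrt \<epsilon> * sqrt (2 / pi)) + curvature (b - a) c d (k s) * \<epsilon>"
      using displacement_moments[OF \<epsilon>] prob_space by simp
    finally show ?thesis by (simp add: p_def)
  qed
  have "expectation (discounted_reward X (hyperbolic_discount \<beta>) f \<tau>)
      = expectation (\<lambda>\<omega>. \<integral>s. discounted_reward X (\<lambda>t. exp (- (\<beta> * s * t))) f \<tau> \<omega> \<partial>exp_law)"
    using \<beta> \<tau>0 by (intro Bochner_Integration.integral_cong refl mixture_discounted_reward[symmetric])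
  also have "\<dots> = (\<integral>s. expectation (discounted_reward X (\<lambda>t. exp (- (\<beta> * s * t))) f \<tau>) \<partial>exp_law)"
    by (rule F(1))
  also have "\<dots> \<le> (\<integral>s. c + (slope_right (b - a) c d (k s) - c * k s) / 2 * (sqrt \<epsilon> * sqrt (2 / pi))
      + curvature (b - a) c d (k s) * \<epsilon> \<partial>exp_law)"
  proof (rule integral_mono_AE[OF F(3)])
    show "AE s in exp_law. expectation (discounted_reward X (\<lambda>t. exp (- (\<beta> * s * t))) f \<tau>)
      \<le> c + (slope_right (b - a) c d (k s) - c * k s) / 2 * (sqrt \<epsilon> * sqrt (2 / pi)) + curvature (b - a) c d (k s) * \<epsilon>"
      using AE_exp_law_pos by eventually_elim (rule bound)
  qed (use int_slope int_curv in auto)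
  also have "\<dots> = c + (\<integral>s. slope_right (b - a) c d (k s) - c * k s \<partial>exp_law) / 2 * (sqrt \<epsilon> * sqrt (2 / pi))
      + (\<integral>s. curvature (b - a) c d (k s) \<partial>exp_law) * \<epsilon>"
    using int_slope int_curv exp_law.prob_space by simp
  finally show ?thesis by (simp add: \<tau>_def mult_ac)
qed

end

text \<open>Multiplied out, the assumed bound states that \<open>c\<close> times the mean of \<open>k + k coth (w k)\<close> exceeds
  \<open>d\<close> times the mean of \<open>k / sinh (w k)\<close>, that is, the mean jump of the slope at \<open>a\<close> is negative. The
  integrals exist because \<open>k / sinh (w k) \<le> 1 / w\<close> and \<open>k coth (w k) \<le> k + 1 / w\<close>.\<close>

lemma threshold_integrals:
  fixes w c d \<beta> :: real
  assumes \<beta>: "0 < \<beta>" and w: "0 < w" and cd: "0 < c" "c < d"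
  defines "k \<equiv> \<lambda>s. sqrt (2 * \<beta> * s)"
  assumes less: "(LBINT s=0..\<infinity>. exp (- s) * (sqrt (2 * \<beta> * s) / sinh (w * sqrt (2 * \<beta> * s))))
           / (sqrt (pi * \<beta> / 2)
              + (LBINT s=0..\<infinity>. exp (- s) * sqrt (2 * \<beta> * s)
                   * (cosh (w * sqrt (2 * \<beta> * s)) / sinh (w * sqrt (2 * \<beta> * s)))))
         < c / d"
  shows "integrable exp_law (\<lambda>s. slope_right w c d (k s) - c * k s)"
    and "(\<integral>s. slope_right w c d (k s) - c * k s \<partial>exp_law) < 0"
    and "integrable exp_law (\<lambda>s. curvature w c d (k s))"
proof -
  have [measurable]: "k \<in> borel_measurable borel" unfolding k_def by measurable
  have kpos: "0 < k s" if "0 < s" for s using that \<beta> by (simp add: k_def)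
  have k_eq: "k = (\<lambda>s. sqrt (2 * \<beta>) * sqrt s)" by (simp add: k_def real_sqrt_mult)
  have int_k: "integrable exp_law k" unfolding k_eq using exp_law_moments(2) by simp
  have val_k: "(\<integral>s. k s \<partial>exp_law) = sqrt (pi * \<beta> / 2)"
  proof -
    have "(\<integral>s. k s \<partial>exp_law) = sqrt (2 * \<beta>) * (sqrt pi / 2)"
      unfolding k_eq using exp_law_moments(3) by simp
    also have "\<dots> = sqrt (2 * \<beta> * pi) / sqrt 4" by (simp add: real_sqrt_mult)
    also have "\<dots> = sqrt (2 * \<beta> * pi / 4)" by (rule real_sqrt_divide[symmetric])
    finally show ?thesis by (simp add: field_simps)
  qed
  have int_k2: "integrable exp_law (\<lambda>s. (k s)\<^sup>2)"
  proof -
    have "integrable exp_law (\<lambda>s. 2 * \<beta> * s)" using exp_law_moments(1) by simp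
    moreover have "AE s in exp_law. 2 * \<beta> * s = (k s)\<^sup>2"
      using AE_exp_law_pos by eventually_elim (use \<beta> in \<open>simp add: k_def\<close>)
    ultimately show ?thesis by (subst (asm) integrable_cong_AE) auto
  qed
  define N where "N s = k s / sinh (w * k s)" for s
  define D where "D s = k s * (cosh (w * k s) / sinh (w * k s))" for s
  have [measurable]: "N \<in> borel_measurable borel" "D \<in> borel_measurable borel"
    unfolding N_def D_def sinh_def cosh_def by measurable
  have AE_N: "AE s in exp_law. 0 \<le> N s \<and> N s \<le> 1 / w"
    using AE_exp_law_pos by eventually_elim (use w div_sinh_le in \<open>auto simp: N_def kpos less_imp_le\<close>)
  have AE_D: "AE s in exp_law. 0 \<le> D s \<and> D s \<le> k s + 1 / w"
    using AE_exp_law_pos by eventually_elim (use w mult_coth_le in \<open>auto simp: D_def kpos less_imp_le\<close>)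
  have "AE s in exp_law. norm (N s) \<le> 1 / w"
    using AE_N by eventually_elim simp
  then have int_N: "integrable exp_law N"
    by (rule exp_law.integrable_const_bound) measurable
  have int_D: "integrable exp_law D"
  proof (rule Bochner_Integration.integrable_bound)
    show "integrable exp_law (\<lambda>s. k s + 1 / w)" using int_k by simp
    show "AE s in exp_law. norm (D s) \<le> norm (k s + 1 / w)"
      using AE_D by eventually_elim auto
  qed measurable
  have slope: "slope_right w c d (k s) - c * k s = d * N s - c * (k s + D s)" for s
    by (simp add: slope_right_def N_def D_def algebra_simps)
  show "integrable exp_law (\<lambda>s. slope_right w c d (k s) - c * k s)"
    unfolding slope using int_N int_D int_k by simp
  have "(LBINT s=0..\<infinity>. exp (- s) * (sqrt (2 * \<beta> * s) / sinh (w * sqrt (2 * \<beta> * s)))) = (\<integral>s. N s \<partial>exp_law)"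
    by (rule interval_integral_exp_law) (measurable, simp add: N_def k_def)
  moreover have "(LBINT s=0..\<infinity>. exp (- s) * sqrt (2 * \<beta> * s)
      * (cosh (w * sqrt (2 * \<beta> * s)) / sinh (w * sqrt (2 * \<beta> * s)))) = (\<integral>s. D s \<partial>exp_law)"
    by (rule interval_integral_exp_law) (measurable, simp add: D_def k_def)
  ultimately have lt: "(\<integral>s. N s \<partial>exp_law) / ((\<integral>s. k s \<partial>exp_law) + (\<integral>s. D s \<partial>exp_law)) < c / d"
    using less by (simp add: val_k)
  have "0 \<le> (\<integral>s. D s \<partial>exp_law)"
    using AE_D by (intro integral_nonneg_AE) (auto elim: eventually_mono)
  moreover have "0 < (\<integral>s. k s \<partial>exp_law)" using \<beta> by (simp add: val_k)
  ultimately have "d * (\<integral>s. N s \<partial>exp_law) < c * ((\<integral>s. k s \<partial>exp_law) + (\<integral>s. D s \<partial>exp_law))"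
    using lt cd by (simp add: pos_divide_less_eq pos_less_divide_eq mult.commute)
  then show "(\<integral>s. slope_right w c d (k s) - c * k s \<partial>exp_law) < 0"
    unfolding slope using int_N int_D int_k by simp
  show "integrable exp_law (\<lambda>s. curvature w c d (k s))"
    unfolding curvature_def using int_k int_k2 by simp
qed

lemma small_time_negative:
  fixes A B c :: real
  assumes "A < 0"
  shows "\<exists>\<epsilon>>0. \<forall>\<epsilon>'. 0 < \<epsilon>' \<and> \<epsilon>' \<le> \<epsilon> \<longrightarrow> c + sqrt \<epsilon>' * A + \<epsilon>' * B \<le> c"
proof -
  \<comment> \<open>the bound holds as soon as \<open>sqrt \<epsilon> \<le> r\<close>\<close>
  define r where "r = - A / (\<bar>B\<bar> + 1)"
  have r: "0 < r" unfolding r_def using assms by (intro divide_pos_pos) auto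
  show ?thesis
  proof (intro exI[of _ "r\<^sup>2"] conjI allI impI)
    fix e assume e: "0 < e \<and> e \<le> r\<^sup>2"
    have "sqrt e \<le> r" using e r by (intro real_le_lsqrt) auto
    then have "sqrt e * (\<bar>B\<bar> + 1) \<le> r * (\<bar>B\<bar> + 1)" by (intro mult_right_mono) auto
    moreover have "sqrt e * B \<le> sqrt e * (\<bar>B\<bar> + 1)" using e by (intro mult_left_mono) auto
    ultimately have "sqrt e * B \<le> r * (\<bar>B\<bar> + 1)" by linarith
    also have "\<dots> = - A" by (simp add: r_def)
    finally have "sqrt e * (A + sqrt e * B) \<le> 0" using e by (intro mult_nonneg_nonpos) auto
    then show "c + sqrt e * A + e * B \<le> c"
      using e by (simp add: distrib_left mult.assoc[symmetric])
  qed (use r in auto)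
qed

section \<open>The equilibria\<close>

lemma brownian_family_motion: "brownian_family P X \<Longrightarrow> brownian_motion (P x) X x"
  unfolding brownian_family_def brownian_motion_def brownian_motion_axioms_def
  by (auto simp: brownian_motion_from_def)

theorem proposition6p1:
  fixes P :: "real \<Rightarrow> 'w measure" and X :: "real \<Rightarrow> 'w \<Rightarrow> real"
    and \<beta> a b c d :: real and \<delta> f J\<^sub>b J\<^sub>a\<^sub>b :: "real \<Rightarrow> real"
  assumes "brownian_family P X"
    and "\<beta> > 0"
    and "\<delta> = hyperbolic_discount \<beta>"
    and "a < b" and "0 < c" and "c < d"
    and "(LBINT s=0..\<infinity>. exp (- s) * (sqrt (2 * \<beta> * s) / sinh ((b - a) * sqrt (2 * \<beta> * s))))
           / (sqrt (pi * \<beta> / 2)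
              + (LBINT s=0..\<infinity>. exp (- s) * sqrt (2 * \<beta> * s)
                   * (cosh ((b - a) * sqrt (2 * \<beta> * s)) / sinh ((b - a) * sqrt (2 * \<beta> * s)))))
         < c / d"
    and "c / d < (LBINT s=0..\<infinity>. exp (- (s + (b - a) * sqrt (2 * \<beta> * s))))"
    and "\<And>x. J\<^sub>b x = d * (\<integral>\<omega>. discounted_reward X \<delta> (\<lambda>_. 1) (hitting_time X {b}) \<omega> \<partial>(P x))"
    and "\<And>x. J\<^sub>a\<^sub>b x =
           c * (\<integral>\<omega>. discounted_reward X \<delta> (indicator {a}) (hitting_time X {a, b}) \<omega> \<partial>(P x))
         + d * (\<integral>\<omega>. discounted_reward X \<delta> (indicator {b}) (hitting_time X {a, b}) \<omega> \<partial>(P x))"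
    and "\<And>x. f x \<ge> 0"
    and "continuous_on UNIV f"
    and "growth_condition P X \<delta> f"
    and "piecewise_C2 f"
    and "f a = c" and "f b = d"
    and "\<And>x. x \<notin> {a, b} \<Longrightarrow> f x < min (J\<^sub>b x) (J\<^sub>a\<^sub>b x)"
  shows "optimal_mild_equilibrium P X \<delta> f {b}
       \<and> (\<forall>S. optimal_mild_equilibrium P X \<delta> f S \<longrightarrow> S = {b})
       \<and> strong_equilibrium P X \<delta> f {b}
       \<and> strong_equilibrium P X \<delta> f {a, b}"
proof -
  note \<beta> = assms(2) and \<delta> = assms(3) and ab = assms(4) and cd = assms(5,6) and f0 = assms(11)
    and fab = assms(15,16)
  have d: "0 < d" using cd by linarith
  have fm [measurable]: "f \<in> borel_measurable borel"
    using assms(12) by (rule borel_measurable_continuous_onI)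
  have BM: "brownian_motion (P x) X x" for x
    using assms(1) by (rule brownian_family_motion)
  define F where "F y = d * point_value \<beta> (y - b)" for y
  have Jb: "J\<^sub>b x = F x" for x
    unfolding F_def using assms(9)[of x] brownian_motion.discounted_hitting_point[OF BM \<beta>, of x b]
    by (simp add: \<delta>)
  have J_b: "J_value P X \<delta> f x {b} = F x" for x
  proof -
    interpret brownian_motion "P x" X x by (rule BM)
    have "J_value P X \<delta> f x {b} = expectation (\<lambda>\<omega>. d * discounted_reward X \<delta> (\<lambda>_. 1) (hitting_time X {b}) \<omega>)"
      unfolding J_value_def
      by (rule Bochner_Integration.integral_cong[OF refl])
         (use hitting_time_in_closed[of _ "{b}"] fab in \<open>auto simp: discounted_reward_def\<close>)
    then show ?thesis using Jb[of x] assms(9)[of x] by simp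
  qed
  have J_ab: "J_value P X \<delta> f x {a, b} = J\<^sub>a\<^sub>b x" for x
  proof -
    interpret brownian_motion "P x" X x by (rule BM)
    have int: "integrable (P x) (discounted_reward X \<delta> (indicator {y}) (hitting_time X {a, b}))" for y
      unfolding \<delta> using \<beta>
      by (intro bounded_discounted_reward(1)[where K = 1] measurable_hitting_time hitting_time_nonneg)
         (auto simp: indicator_def)
    have "J_value P X \<delta> f x {a, b} = expectation (\<lambda>\<omega>. c * discounted_reward X \<delta> (indicator {a}) (hitting_time X {a, b}) \<omega>
        + d * discounted_reward X \<delta> (indicator {b}) (hitting_time X {a, b}) \<omega>)"
      unfolding J_value_def
    proof (rule Bochner_Integration.integral_cong[OF refl])
      fix \<omega> assume "\<omega> \<in> space (P x)"
      from hitting_time_in_closed[OF this, of "{a, b}"]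
      show "discounted_reward X \<delta> f (hitting_time X {a, b}) \<omega> = c * discounted_reward X \<delta> (indicator {a}) (hitting_time X {a, b}) \<omega>
        + d * discounted_reward X \<delta> (indicator {b}) (hitting_time X {a, b}) \<omega>"
        using fab ab by (auto simp: discounted_reward_def)
    qed
    then show ?thesis using int assms(10)[of x] by simp
  qed
  have f_less: "f x < F x" if "x \<noteq> b" for x
  proof (cases "x = a")
    case True
    have "(LBINT s=0..\<infinity>. exp (- (s + (b - a) * sqrt (2 * \<beta> * s)))) = point_value \<beta> (a - b)"
      unfolding point_value_def using ab
      by (intro interval_integral_exp_law) (auto simp: exp_add[symmetric] mult.commute)
    then show ?thesis
      using True fab d assms(8) by (simp add: F_def pos_divide_less_eq mult.commute)
  next
    case False
    with that show ?thesis using assms(17)[of x] Jb[of x] by auto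
  qed
  have f_le: "f x \<le> F x" for x
    using f_less[of x] fab by (cases "x = b") (auto simp: F_def)
  have f_le_d: "f x \<le> d" for x
  proof -
    have "F x \<le> d * 1" unfolding F_def using d point_value_bounds[OF \<beta>] by (intro mult_left_mono) auto
    then show ?thesis using f_le[of x] by simp
  qed
  have mild_b: "mild_equilibrium P X \<delta> f {b}"
    unfolding mild_equilibrium_def using f_le J_b fab by (auto simp: F_def)
  have b_in: "b \<in> R" if "mild_equilibrium P X \<delta> f R" for R
  proof (rule ccontr)
    assume "b \<notin> R"
    then have "J_value P X \<delta> f b R < d"
      unfolding J_value_def \<delta> using that \<beta> fm f0 f_le_d d
      by (intro brownian_motion.discounted_reward_lt_max[OF BM]) (auto simp: mild_equilibrium_def)
    moreover have "f b \<le> J_value P X \<delta> f b R"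
      using that \<open>b \<notin> R\<close> by (simp add: mild_equilibrium_def)
    ultimately show False using fab by simp
  qed
  have J_le: "J_value P X \<delta> f x R \<le> F x" if R: "mild_equilibrium P X \<delta> f R" for R x
  proof (cases "x \<in> R")
    case True
    then have "J_value P X \<delta> f x R \<le> f x" using R by (simp add: mild_equilibrium_def)
    then show ?thesis using f_le[of x] by simp
  next
    case False
    interpret brownian_motion "P x" X x by (rule BM)
    have Rc: "closed R" using R by (simp add: mild_equilibrium_def)
    note pv = discounted_point_value_le[OF \<beta> Rc b_in[OF R] False]
    have "J_value P X \<delta> f x R \<le> expectation (\<lambda>\<omega>. d * discounted_reward X \<delta> (\<lambda>y. point_value \<beta> (y - b)) (hitting_time X R) \<omega>)"
      unfolding J_value_def
    proof (rule integral_mono)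
      show "integrable (P x) (discounted_reward X \<delta> f (hitting_time X R))"
        unfolding \<delta> using \<beta> fm f0 f_le_d Rc
        by (intro bounded_discounted_reward(1)[where K = d] measurable_hitting_time hitting_time_nonneg)
      show "integrable (P x) (\<lambda>\<omega>. d * discounted_reward X \<delta> (\<lambda>y. point_value \<beta> (y - b)) (hitting_time X R) \<omega>)"
        using pv(1) by (simp add: \<delta>)
      fix \<omega> assume "\<omega> \<in> space (P x)"
      have "\<delta> (real_of_ereal (hitting_time X R \<omega>)) * f y \<le> \<delta> (real_of_ereal (hitting_time X R \<omega>)) * F y" for y
        unfolding \<delta> using f_le hyperbolic_discount_bounds(1)[OF \<beta> real_of_ereal_pos[OF hitting_time_nonneg]]
        by (intro mult_left_mono) auto
      then show "discounted_reward X \<delta> f (hitting_time X R) \<omega>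
          \<le> d * discounted_reward X \<delta> (\<lambda>y. point_value \<beta> (y - b)) (hitting_time X R) \<omega>"
        by (simp add: discounted_reward_def F_def mult.left_commute)
    qed
    also have "\<dots> \<le> F x"
      unfolding F_def using pv(2) d by (simp add: \<delta>)
    finally show ?thesis .
  qed
  have opt_b: "optimal_mild_equilibrium P X \<delta> f {b}"
    unfolding optimal_mild_equilibrium_def using mild_b J_le J_b by simp
  have unique: "S = {b}" if S: "optimal_mild_equilibrium P X \<delta> f S" for S
  proof -
    have mS: "mild_equilibrium P X \<delta> f S" using S by (simp add: optimal_mild_equilibrium_def)
    have "x = b" if "x \<in> S" for x
    proof (rule ccontr)
      assume "x \<noteq> b"
      have "F x \<le> J_value P X \<delta> f x S"
        using S mild_b J_b[of x] unfolding optimal_mild_equilibrium_def by metis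
      also have "\<dots> \<le> f x" using mS that by (simp add: mild_equilibrium_def)
      finally show False using f_less[OF \<open>x \<noteq> b\<close>] by simp
    qed
    then show ?thesis using b_in[OF mS] by blast
  qed
  \<comment> \<open>the reward at \<open>b\<close> is the maximum of \<open>f\<close>, so no stopping rule can do better\<close>
  have at_b: "f b - (\<integral>\<omega>. discounted_reward X \<delta> f (hitting_time_after X \<epsilon> S) \<omega> \<partial>(P b)) \<ge> 0"
    if "0 < \<epsilon>" "closed S" for \<epsilon> S
  proof -
    interpret brownian_motion "P b" X b by (rule BM)
    have "expectation (discounted_reward X \<delta> f (hitting_time_after X \<epsilon> S)) \<le> d"
      unfolding \<delta>
    proof (rule bounded_discounted_reward(2)[OF \<beta> _ _ fm f0 f_le_d])
      show "hitting_time_after X \<epsilon> S \<in> borel_measurable (P b)"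
        using that by (intro measurable_hitting_time_after) auto
      show "0 \<le> hitting_time_after X \<epsilon> S \<omega>" if "\<omega> \<in> space (P b)" for \<omega>
        using hitting_time_after_ge[OF that, of \<epsilon> S] \<open>0 < \<epsilon>\<close> \<open>closed S\<close>
        by (auto intro: order_trans[rotated])
    qed
    then show ?thesis using fab by simp
  qed
  have strong_b: "strong_equilibrium P X \<delta> f {b}"
    unfolding strong_equilibrium_def using f_le J_b at_b by (auto intro!: exI[of _ 1])
  define A where "A = sqrt (2 / pi) / 2 * (\<integral>s. slope_right (b - a) c d (sqrt (2 * \<beta> * s)) - c * sqrt (2 * \<beta> * s) \<partial>exp_law)"
  define B where "B = (\<integral>s. curvature (b - a) c d (sqrt (2 * \<beta> * s)) \<partial>exp_law)"
  have w: "0 < b - a" using ab by simp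
  note I = threshold_integrals[OF \<beta> w cd assms(7)]
  have "A < 0" unfolding A_def using I(2) by (intro mult_pos_neg) auto
  have at_a: "expectation_a \<le> c + sqrt \<epsilon> * A + \<epsilon> * B"
    if "0 < \<epsilon>" "expectation_a = (\<integral>\<omega>. discounted_reward X \<delta> f (hitting_time_after X \<epsilon> {a, b}) \<omega> \<partial>(P a))"
    for \<epsilon> expectation_a
    using brownian_motion.delayed_two_point_reward[OF BM refl ab cd \<beta> fm fab _ that(1) I(1,3)] f0 f_le_d that(2)
    by (simp add: \<delta> A_def B_def mult.assoc)
  have strong_ab: "strong_equilibrium P X \<delta> f {a, b}"
    unfolding strong_equilibrium_def
  proof (intro conjI allI impI ballI)
    fix x assume "x \<notin> {a, b}"
    then show "f x \<le> J_value P X \<delta> f x {a, b}" using assms(17)[of x] J_ab[of x] by simp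
  next
    fix x assume "x \<in> {a, b}"
    then consider "x = a" | "x = b" by auto
    then show "\<exists>\<epsilon>>0. \<forall>\<epsilon>'. 0 < \<epsilon>' \<and> \<epsilon>' \<le> \<epsilon> \<longrightarrow>
        f x - (\<integral>\<omega>. discounted_reward X \<delta> f (hitting_time_after X \<epsilon>' {a, b}) \<omega> \<partial>(P x)) \<ge> 0"
    proof cases
      case 1
      obtain \<epsilon> where \<epsilon>: "0 < \<epsilon>" "\<And>\<epsilon>'. 0 < \<epsilon>' \<Longrightarrow> \<epsilon>' \<le> \<epsilon> \<Longrightarrow> c + sqrt \<epsilon>' * A + \<epsilon>' * B \<le> c"
        using small_time_negative[OF \<open>A < 0\<close>, of c B] by blast
      show ?thesis
        unfolding 1 fab
      proof (intro exI[of _ \<epsilon>] conjI allI impI)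
        fix \<epsilon>' assume e: "0 < \<epsilon>' \<and> \<epsilon>' \<le> \<epsilon>"
        then show "0 \<le> c - (\<integral>\<omega>. discounted_reward X \<delta> f (hitting_time_after X \<epsilon>' {a, b}) \<omega> \<partial>(P a))"
          using at_a[OF _ refl, of \<epsilon>'] \<epsilon>(2)[of \<epsilon>'] by linarith
      qed (rule \<epsilon>)
    next
      case 2
      then show ?thesis using at_b[of _ "{a, b}"] by (auto intro!: exI[of _ 1])
    qed
  qed simp
  show ?thesis using opt_b unique strong_b strong_ab by blast
qed

end
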